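(* Assume that $\mathbb{X}=\mathbb{Y}\times\mathbb{M}$ is the product of two complete separable metric spaces and let $\mathbb{Q}$ be a finite measure on $\mathbb{M}$. Suppose that $f\colon\mathbb{N}\to\mathbb{R}$ is a function satisfying $$\lim_{n\to\infty}f(n)\sqrt{n\log n}=0 .$$ Then for each $y\in\mathbb{Y}$ the function $t\mapsto\int\mathbb{E}_tf(|C^{(y,q)}|)\,\mathbb{Q}(dq)$ is continuously differentiable on $(0,\infty)$.
   Context: Setting. $\lambda$ is a locally finite (finite on bounded Borel sets) and diffuse measure on the complete separable metric space $\mathbb{X}$; $\varphi\colon\mathbb{X}^2\to[0,1]$ is measurable and symmetric with $\int\varphi(x,y)\,\lambda(dy)<\infty$ for $\lambda$-a.e. $x\in\mathbb{X}$. For $t>0$, under $\mathbb{P}_t$ (expectation $\mathbb{E}_t$), $\eta$ is a Poisson process on $\mathbb{X}$ with intensity measure $t\lambda$. For $v\in\mathbb{X}$, $\xi^v$ is the random graph with vertex set $\eta\cup\{v\}$ in which, given $\eta$, each pair of distinct vertices $x,y$ is joined by an edge with probability $\varphi(x,y)$, independently for different pairs. $C^v$ is the connected component of $v$ in $\xi^v$ and $|C^v|\in\mathbb{N}\cup\{\infty\}$ its number of vertices. Convention: $f(\infty):=0$, so $\mathbb{E}_tf(|C^v|)=\sum_{n\ge1}f(n)\mathbb{P}_t(|C^v|=n)$. *)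

theory Defs
  imports "HOL-Probability.Probability"
begin

text \<open>
  A Poisson process with intensity measure \<open>\<Lambda>\<close> is a random measure \<open>\<eta>\<close> with Poisson distributed values
  on Borel sets (where the Poisson distribution with infinite parameter is the point mass at
  infinity) and complete independence. It is almost surely integer-valued, and almost surely
  locally finite if \<open>\<Lambda>\<close> is.
\<close>

definition poisson_process ::
  "'w measure \<Rightarrow> ('w \<Rightarrow> 'a::topological_space measure) \<Rightarrow> 'a measure \<Rightarrow> bool" where
  "poisson_process M \<eta> \<Lambda> \<longleftrightarrow>
     prob_space M \<and>
     (\<forall>\<omega>\<in>space M. sets (\<eta> \<omega>) = sets borel) \<and>
     (\<forall>B\<in>sets borel. (\<lambda>\<omega>. emeasure (\<eta> \<omega>) B) \<in> borel_measurable M) \<and>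
     (\<forall>B\<in>sets borel. emeasure \<Lambda> B < \<infinity> \<longrightarrow>
        (\<forall>k::nat. measure M {\<omega>\<in>space M. emeasure (\<eta> \<omega>) B = of_nat k}
           = exp (- measure \<Lambda> B) * measure \<Lambda> B ^ k / fact k)) \<and>
     (\<forall>B\<in>sets borel. emeasure \<Lambda> B = \<infinity> \<longrightarrow> (AE \<omega> in M. emeasure (\<eta> \<omega>) B = \<infinity>)) \<and>
     (\<forall>(n::nat) B. (\<forall>i<n. B i \<in> sets borel) \<longrightarrow> disjoint_family_on B {..<n} \<longrightarrow>
        prob_space.indep_vars M (\<lambda>_. borel) (\<lambda>i \<omega>. emeasure (\<eta> \<omega>) (B i)) {..<n})"

text \<open>The point process \<open>\<Sum>n<\<kappa>. \<delta>\<^bsub>X n\<^esub>\<close>.\<close>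

definition point_process ::
  "('w \<Rightarrow> enat) \<Rightarrow> (nat \<Rightarrow> 'w \<Rightarrow> 'a::topological_space) \<Rightarrow> 'w \<Rightarrow> 'a measure" where
  "point_process \<kappa> X \<omega> = distr (count_space {n. enat n < \<kappa> \<omega>}) borel (\<lambda>n. X n \<omega>)"

text \<open>
  The random input of the random connection model: a Poisson process, enumerated as
  \<open>X 0, X 1, \<dots>\<close> with random length \<open>\<kappa>\<close>, and, independent of it, independent random variables
  uniform on \<open>[0,1]\<close>, one for each unordered pair of labels. The label \<open>0\<close> is reserved for the
  added vertex \<open>v\<close>, and the label \<open>Suc n\<close> belongs to the point \<open>X n\<close>.
\<close>

definition label_pairs :: "nat set set" where
  "label_pairs = {e. card e = 2}"

definition rcm_input ::
  "'w measure \<Rightarrow> 'a::topological_space measure \<Rightarrow> ('w \<Rightarrow> enat) \<Rightarrow> (nat \<Rightarrow> 'w \<Rightarrow> 'a) \<Rightarrow>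
   (nat set \<Rightarrow> 'w \<Rightarrow> real) \<Rightarrow> bool" where
  "rcm_input M \<Lambda> \<kappa> X U \<longleftrightarrow>
     \<kappa> \<in> measurable M (count_space UNIV) \<and>
     (\<forall>n. X n \<in> borel_measurable M) \<and>
     poisson_process M (point_process \<kappa> X) \<Lambda> \<and>
     (\<forall>e\<in>label_pairs. U e \<in> borel_measurable M \<and>
        distr M borel (U e) = uniform_measure lborel {0..1}) \<and>
     prob_space.indep_vars M (\<lambda>_. borel) U label_pairs \<and>
     (let S = count_space UNIV \<Otimes>\<^sub>M Pi\<^sub>M UNIV (\<lambda>_. borel);
          T = Pi\<^sub>M label_pairs (\<lambda>_. borel);
          pts = (\<lambda>\<omega>. (\<kappa> \<omega>, \<lambda>n. X n \<omega>));
          marks = (\<lambda>\<omega>. \<lambda>e\<in>label_pairs. U e \<omega>)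
      in distr M (S \<Otimes>\<^sub>M T) (\<lambda>\<omega>. (pts \<omega>, marks \<omega>)) = distr M S pts \<Otimes>\<^sub>M distr M T marks)"

definition labels :: "('w \<Rightarrow> enat) \<Rightarrow> 'w \<Rightarrow> nat set" where
  "labels \<kappa> \<omega> = insert 0 (Suc ` {n. enat n < \<kappa> \<omega>})"

definition vertex :: "'a \<Rightarrow> (nat \<Rightarrow> 'w \<Rightarrow> 'a) \<Rightarrow> 'w \<Rightarrow> nat \<Rightarrow> 'a" where
  "vertex v X \<omega> i = (case i of 0 \<Rightarrow> v | Suc n \<Rightarrow> X n \<omega>)"

text \<open>
  The edges of the random graph \<open>\<xi>\<^sup>v\<close>, whose vertex set is \<open>vertex v X \<omega> ` labels \<kappa> \<omega>\<close>. For a diffuse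
  intensity measure distinct labels almost surely have distinct vertices, so that, given the
  points, distinct vertices \<open>x\<close> and \<open>y\<close> are joined with probability \<open>\<phi> x y\<close>, independently for
  different pairs.
\<close>

definition rcm_edges ::
  "('a \<Rightarrow> 'a \<Rightarrow> real) \<Rightarrow> ('w \<Rightarrow> enat) \<Rightarrow> (nat \<Rightarrow> 'w \<Rightarrow> 'a) \<Rightarrow> (nat set \<Rightarrow> 'w \<Rightarrow> real) \<Rightarrow>
   'a \<Rightarrow> 'w \<Rightarrow> ('a \<times> 'a) set" where
  "rcm_edges \<phi> \<kappa> X U v \<omega> =
     {(vertex v X \<omega> i, vertex v X \<omega> j) | i j.
        i \<in> labels \<kappa> \<omega> \<and> j \<in> labels \<kappa> \<omega> \<and> vertex v X \<omega> i \<noteq> vertex v X \<omega> j \<and>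
        U {i, j} \<omega> \<le> \<phi> (vertex v X \<omega> i) (vertex v X \<omega> j)}"

definition cluster ::
  "('a \<Rightarrow> 'a \<Rightarrow> real) \<Rightarrow> ('w \<Rightarrow> enat) \<Rightarrow> (nat \<Rightarrow> 'w \<Rightarrow> 'a) \<Rightarrow> (nat set \<Rightarrow> 'w \<Rightarrow> real) \<Rightarrow>
   'a \<Rightarrow> 'w \<Rightarrow> 'a set" where
  "cluster \<phi> \<kappa> X U v \<omega> = {x. (v, x) \<in> (rcm_edges \<phi> \<kappa> X U v \<omega>)\<^sup>*}"

definition ecard :: "'a set \<Rightarrow> enat" where
  "ecard A = (if finite A then enat (card A) else \<infinity>)"

definition extend_zero :: "(nat \<Rightarrow> real) \<Rightarrow> enat \<Rightarrow> real" where
  "extend_zero f k = (case k of enat n \<Rightarrow> f n | \<infinity> \<Rightarrow> 0)"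

end

theory Submission
  imports Defs
begin

text \<open>
For a fixed root \<open>v\<close>, the probability that its cluster has \<open>n + 1\<close> points has the form
\<open>p\<^sub>n(t) = t^n * \<integral> exp (- t a) d\<mu>\<^sub>n\<close> with a measure \<open>\<mu>\<^sub>n\<close> that does not depend on \<open>t\<close>. The cluster
consists of \<open>v\<close> and \<open>n\<close> Poisson points; these contribute \<open>t^n\<close>, their positions and the event that they
form a connected graph together with \<open>v\<close> are absorbed in \<open>\<mu>\<^sub>n\<close>, and \<open>exp (- t a)\<close> is the probability that
no further Poisson point is joined to any of them. Here \<open>a = \<integral> (1 - \<Prod>\<^sub>i (1 - \<phi> x\<^sub>i z)) \<lambda>(dz)\<close> measures
the region exposed to the cluster. Integrating over the mark of the root merely replaces \<open>\<mu>\<^sub>n\<close> by a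
mixture.

Consequently \<open>t p\<^sub>n'(t) = \<integral> (n - t a) t^n exp (- t a) d\<mu>\<^sub>n\<close>, and the question is how large \<open>n - t a\<close>
can be. A change of intensity answers it: multiplying the integrand \<open>t^n exp (- t a)\<close> by
\<open>exp (\<theta> (n - t a))\<close> gives the same integrand for the intensity \<open>t (1 + \<theta>)\<close>, up to the factor
\<open>(exp \<theta> / (1 + \<theta>))^n \<le> exp (2 n \<theta>\<^sup>2)\<close>, and at every intensity the integral \<open>p\<^sub>n\<close> is bounded by the
total mass \<open>K\<close> of the law of the root. So deviations beyond \<open>5 sqrt (n ln n)\<close> are negligible, and
\<open>\<bar>p\<^sub>n'(t)\<bar> \<le> (5 sqrt (n ln n) p\<^sub>n(t) + 2 K / n\<^sup>2) / t\<close>. As \<open>f n * sqrt (n ln n)\<close> tends to \<open>0\<close> and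
\<open>\<Sum>\<^sub>n p\<^sub>n(t) \<le> K\<close>, the series of the derivatives \<open>f (n + 1) p\<^sub>n'\<close> has uniformly small tails on compact
subsets of \<open>(0, \<infinity>)\<close>. This is \<open>C1_limit_of_cluster_series\<close>.

The formula for \<open>p\<^sub>n\<close> is only needed for the cluster inside a ball \<open>B\<close>, where the intensity is finite
and the Poisson process has finitely many points. On the event that there are \<open>m\<close> of them, the measure
that lists their positions in all possible orders is \<open>exp (- t \<lambda>(B)) t^m\<close> times the \<open>m\<close>-fold power of the restriction of \<open>\<lambda>\<close> to \<open>B\<close>
(\<open>tuple_measure_eq\<close>); together with the independence of the edges this yields \<open>cluster_card_prob\<close>.
The estimates for the derivatives do not depend on the ball, so the balls can be increased to the whole
space at the very end: by \<open>C1_differentiable_on_limit\<close>, a pointwise limit of functions with locally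
uniformly equicontinuous derivatives is continuously differentiable.
\<close>

section \<open>Limits of series of tilted Laplace transforms\<close>

text \<open>
Equicontinuity of the derivatives makes the first-order Taylor estimate uniform in \<open>k\<close>. Difference
quotients of a pointwise convergent sequence converge, so the derivatives form Cauchy sequences;
passing to the limit in the Taylor estimate identifies their limit as the derivative of \<open>G\<close>.
\<close>

lemma C1_differentiable_on_limit:
  fixes F D :: "nat \<Rightarrow> real \<Rightarrow> real" and G :: "real \<Rightarrow> real"
  assumes deriv: "\<And>k t. t > 0 \<Longrightarrow> (F k has_real_derivative D k t) (at t)"
    and equi: "\<And>a b e. 0 < a \<Longrightarrow> a \<le> b \<Longrightarrow> 0 < e \<Longrightarrow>
      \<exists>d>0. \<forall>k. \<forall>s\<in>{a..b}. \<forall>t\<in>{a..b}. \<bar>s - t\<bar> < d \<longrightarrow> \<bar>D k s - D k t\<bar> \<le> e"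
    and lim: "\<And>t. t > 0 \<Longrightarrow> (\<lambda>k. F k t) \<longlonglongrightarrow> G t"
  shows "G C1_differentiable_on {0<..}"
proof -
  have taylor: "\<exists>d>0. \<forall>k. \<forall>s\<in>{a..b}. \<forall>t\<in>{a..b}. \<bar>s - t\<bar> < d \<longrightarrow>
      \<bar>D k s - D k t\<bar> \<le> e \<and> \<bar>F k s - F k t - D k t * (s - t)\<bar> \<le> e * \<bar>s - t\<bar>"
    if ab: "0 < a" "a \<le> b" "0 < e" for a b e
  proof -
    obtain d where "d > 0"
      and d: "\<And>k s t. s \<in> {a..b} \<Longrightarrow> t \<in> {a..b} \<Longrightarrow> \<bar>s - t\<bar> < d \<Longrightarrow> \<bar>D k s - D k t\<bar> \<le> e"
      using equi[OF ab] by metis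
    have "\<bar>F k s - F k t - D k t * (s - t)\<bar> \<le> e * \<bar>s - t\<bar>"
      if st: "s \<in> {a..b}" "t \<in> {a..b}" "\<bar>s - t\<bar> < d" for k s t
    proof -
      have "\<exists>z\<in>{a..b}. \<bar>z - t\<bar> < d \<and> F k s - F k t = (s - t) * D k z"
      proof (cases s t rule: linorder_cases)
        case less
        have "\<exists>z>s. z < t \<and> F k t - F k s = (t - s) * D k z"
          using less st \<open>0 < a\<close> by (intro MVT2) (auto intro!: deriv)
        then obtain z where "z > s" "z < t" "F k t - F k s = (t - s) * D k z" by auto
        then show ?thesis using st by (intro bexI[of _ z]) (auto simp: algebra_simps)
      next
        case equal then show ?thesis using st \<open>d > 0\<close> by (intro bexI[of _ t]) auto
      next
        case greater
        have "\<exists>z>t. z < s \<and> F k s - F k t = (s - t) * D k z"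
          using greater st \<open>0 < a\<close> by (intro MVT2) (auto intro!: deriv)
        then obtain z where "z > t" "z < s" "F k s - F k t = (s - t) * D k z" by auto
        then show ?thesis using st by (intro bexI[of _ z]) (auto simp: algebra_simps)
      qed
      then obtain z where z: "z \<in> {a..b}" "\<bar>z - t\<bar> < d" "F k s - F k t = (s - t) * D k z" by auto
      have "\<bar>F k s - F k t - D k t * (s - t)\<bar> = \<bar>s - t\<bar> * \<bar>D k z - D k t\<bar>"
        unfolding z(3) by (simp add: abs_mult[symmetric] algebra_simps)
      also have "\<dots> \<le> \<bar>s - t\<bar> * e" using d[OF z(1) st(2) z(2)] by (intro mult_left_mono) auto
      finally show ?thesis by (simp add: mult.commute)
    qed
    then show ?thesis using \<open>d > 0\<close> d by blast
  qed
  have conv: "convergent (\<lambda>k. D k t)" if t: "t > 0" for t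
  proof (rule real_Cauchy_convergent, rule metric_CauchyI)
    fix e :: real assume e: "e > 0"
    obtain d where "d > 0" and d: "\<And>k s. s \<in> {t/2..2*t} \<Longrightarrow> \<bar>s - t\<bar> < d \<Longrightarrow>
        \<bar>F k s - F k t - D k t * (s - t)\<bar> \<le> e/4 * \<bar>s - t\<bar>"
      using taylor[of "t/2" "2*t" "e/4"] e t by (auto simp: Ball_def)
    define h where "h = min (d/2) (t/2)"
    have h: "h > 0" "h < d" "t + h \<le> 2 * t" using \<open>d > 0\<close> t by (auto simp: h_def)
    have *: "\<bar>(F k (t + h) - F k t) / h - D k t\<bar> \<le> e/4" for k
    proof -
      have "\<bar>F k (t+h) - F k t - D k t * h\<bar> \<le> e/4 * h"
        using d[of "t+h" k] h t by (auto simp: algebra_simps)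
      moreover have "(F k (t + h) - F k t) / h - D k t = (F k (t+h) - F k t - D k t * h) / h"
        using h by (simp add: field_simps)
      ultimately show ?thesis using h by (simp add: abs_divide divide_le_eq)
    qed
    have cauchy: "Cauchy (\<lambda>k. (F k (t + h) - F k t) / h)"
      using h t by (intro LIMSEQ_imp_Cauchy[of _ "(G (t + h) - G t) / h"] tendsto_intros lim) auto
    then obtain N where N: "\<And>m n. m \<ge> N \<Longrightarrow> n \<ge> N \<Longrightarrow>
        dist ((F m (t + h) - F m t) / h) ((F n (t + h) - F n t) / h) < e/4"
      using metric_CauchyD[OF cauchy, of "e/4"] e by auto
    show "\<exists>N. \<forall>m\<ge>N. \<forall>n\<ge>N. dist (D m t) (D n t) < e"
    proof (intro exI[of _ N] allI impI)
      fix m n assume "m \<ge> N" "n \<ge> N"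
      then show "dist (D m t) (D n t) < e"
        using N[of m n] *[of m] *[of n] e unfolding dist_real_def by linarith
    qed
  qed
  define E where "E t = lim (\<lambda>k. D k t)" for t
  have E: "(\<lambda>k. D k t) \<longlonglongrightarrow> E t" if "t > 0" for t
    using conv[OF that] unfolding E_def by (simp add: convergent_LIMSEQ_iff)
  have taylorG: "\<exists>d>0. \<forall>s\<in>{a..b}. \<forall>t\<in>{a..b}. \<bar>s - t\<bar> < d \<longrightarrow>
      \<bar>E s - E t\<bar> \<le> e \<and> \<bar>G s - G t - E t * (s - t)\<bar> \<le> e * \<bar>s - t\<bar>"
    if ab: "0 < a" "a \<le> b" "0 < e" for a b e
  proof -
    obtain d where "d > 0" and d: "\<And>k s t. s \<in> {a..b} \<Longrightarrow> t \<in> {a..b} \<Longrightarrow> \<bar>s - t\<bar> < d \<Longrightarrow>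
      \<bar>D k s - D k t\<bar> \<le> e \<and> \<bar>F k s - F k t - D k t * (s - t)\<bar> \<le> e * \<bar>s - t\<bar>"
      using taylor[OF ab] by metis
    have "\<bar>E s - E t\<bar> \<le> e \<and> \<bar>G s - G t - E t * (s - t)\<bar> \<le> e * \<bar>s - t\<bar>"
      if st: "s \<in> {a..b}" "t \<in> {a..b}" "\<bar>s - t\<bar> < d" for s t
    proof
      have st0: "s > 0" "t > 0" using st ab by auto
      have "(\<lambda>k. \<bar>D k s - D k t\<bar>) \<longlonglongrightarrow> \<bar>E s - E t\<bar>"
        using st0 by (intro tendsto_intros E)
      then show "\<bar>E s - E t\<bar> \<le> e" using d[OF st] by (intro LIMSEQ_le_const2) auto
      have "(\<lambda>k. \<bar>F k s - F k t - D k t * (s - t)\<bar>) \<longlonglongrightarrow> \<bar>G s - G t - E t * (s - t)\<bar>"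
        using st0 by (intro tendsto_intros E lim)
      then show "\<bar>G s - G t - E t * (s - t)\<bar> \<le> e * \<bar>s - t\<bar>"
        using d[OF st] by (intro LIMSEQ_le_const2) auto
    qed
    then show ?thesis using \<open>d > 0\<close> by blast
  qed
  have local: "\<exists>d>0. \<forall>s. \<bar>s - t\<bar> < d \<longrightarrow>
      \<bar>E s - E t\<bar> \<le> e \<and> \<bar>G s - G t - E t * (s - t)\<bar> \<le> e * \<bar>s - t\<bar>" if t: "t > 0" and e: "e > 0" for t e
  proof -
    have half: "0 < t/2" "t/2 \<le> 2*t" using t by auto
    obtain d where d: "d > 0" "\<forall>s\<in>{t/2..2*t}. \<forall>t\<in>{t/2..2*t}. \<bar>s - t\<bar> < d \<longrightarrow>
      \<bar>E s - E t\<bar> \<le> e \<and> \<bar>G s - G t - E t * (s - t)\<bar> \<le> e * \<bar>s - t\<bar>"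
      using taylorG[OF half e] by (elim exE conjE)
    have "min d (t/2) > 0" using d t by auto
    moreover have "\<bar>E s - E t\<bar> \<le> e \<and> \<bar>G s - G t - E t * (s - t)\<bar> \<le> e * \<bar>s - t\<bar>"
      if "\<bar>s - t\<bar> < min d (t/2)" for s
    proof -
      have sd: "\<bar>s - t\<bar> < t/2" "\<bar>s - t\<bar> < d" using that by auto
      then have "t/2 \<le> s" "s \<le> 2*t" using t by linarith+
      then have "s \<in> {t/2..2*t}" "t \<in> {t/2..2*t}" "\<bar>s - t\<bar> < d" using sd t by auto
      then show ?thesis using d by blast
    qed
    ultimately show ?thesis by blast
  qed
  show ?thesis
    unfolding C1_differentiable_on_def
  proof (intro exI[of _ E] conjI ballI)
    fix t :: real assume "t \<in> {0<..}"
    then have t: "t > 0" by simp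
    show "(G has_vector_derivative E t) (at t)"
      unfolding has_real_derivative_iff_has_vector_derivative[symmetric] has_field_derivative_def
        has_derivative_at_alt
    proof (intro conjI allI impI)
      fix e :: real assume "e > 0"
      then obtain d where "d > 0"
        "\<forall>s. \<bar>s - t\<bar> < d \<longrightarrow> \<bar>E s - E t\<bar> \<le> e \<and> \<bar>G s - G t - E t * (s - t)\<bar> \<le> e * \<bar>s - t\<bar>"
        using local[OF t] by blast
      then show "\<exists>d>0. \<forall>s. norm (s - t) < d \<longrightarrow> norm (G s - G t - E t * (s - t)) \<le> e * norm (s - t)"
        by (intro exI[of _ d]) simp
    qed (rule bounded_linear_mult_right)
  next
    show "continuous_on {0<..} E"
      unfolding continuous_on_iff
    proof (intro ballI allI impI)
      fix t e :: real assume "t \<in> {0<..}" "e > 0"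
      then obtain d where "d > 0" "\<forall>s. \<bar>s - t\<bar> < d \<longrightarrow> \<bar>E s - E t\<bar> \<le> e/2" using local[of t "e/2"] by auto
      then show "\<exists>d>0. \<forall>s\<in>{0<..}. dist s t < d \<longrightarrow> dist (E s) (E t) < e"
        using \<open>e > 0\<close> by (intro exI[of _ d]) (fastforce simp: dist_real_def)
    qed
  qed
qed

lemma exp_taylor1_bounds:
  fixes y :: real
  shows "\<bar>exp y - 1 - y\<bar> \<le> y\<^sup>2 * exp \<bar>y\<bar>"
proof -
  have lower: "exp y - 1 - y \<ge> 0" using exp_ge_add_one_self[of y] by linarith
  have "exp y * (1 - y) \<le> exp y * exp (-y)"
    using exp_ge_add_one_self[of "-y"] by (intro mult_left_mono) auto
  then have *: "exp y - 1 \<le> y * exp y" by (simp add: exp_minus algebra_simps)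
  then have "exp y - 1 - y \<le> y * (exp y - 1)" by (simp add: algebra_simps)
  also have "\<dots> \<le> y\<^sup>2 * exp \<bar>y\<bar>"
  proof (cases "y \<ge> 0")
    case True then show ?thesis using mult_left_mono[OF * True] by (simp add: power2_eq_square)
  next
    case False
    have "y * (exp y - 1) \<le> y * y"
    proof (rule mult_left_mono_neg)
      show "y \<le> exp y - 1" using exp_ge_add_one_self[of y] by linarith
    qed (use False in simp)
    also have "\<dots> \<le> y * y * exp \<bar>y\<bar>" using mult_left_mono[of 1 "exp \<bar>y\<bar>" "y * y"] by simp
    finally show ?thesis by (simp add: power2_eq_square)
  qed
  finally show ?thesis using lower by simp
qed

text \<open>
The measure \<open>M\<close> plays the role of \<open>\<mu>\<^sub>n\<close>, and \<open>a\<close> that of the exposed measure of a cluster. Boundedness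
of \<open>a\<close>, which holds inside a ball, allows differentiation under the integral.
\<close>

locale bounded_laplace = finite_measure M for M :: "'b measure" +
  fixes a :: "'b \<Rightarrow> real" and A :: real
  assumes a_meas[measurable]: "a \<in> borel_measurable M"
    and a_nonneg: "\<And>x. x \<in> space M \<Longrightarrow> 0 \<le> a x"
    and a_le: "\<And>x. x \<in> space M \<Longrightarrow> a x \<le> A"
begin

definition L :: "nat \<Rightarrow> real \<Rightarrow> real" where
  "L j t = (\<integral>x. a x ^ j * exp (- (t * a x)) \<partial>M)"

lemma integrable_L: "t \<ge> 0 \<Longrightarrow> integrable M (\<lambda>x. a x ^ j * exp (- (t * a x)))"
proof (rule integrable_const_bound[where B="A ^ j"])
  assume t: "t \<ge> 0"
  show "AE x in M. norm (a x ^ j * exp (- (t * a x))) \<le> A ^ j"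
  proof (rule AE_I2)
    fix x assume x: "x \<in> space M"
    have "a x ^ j * exp (- (t * a x)) \<le> A ^ j * 1"
      using a_nonneg[OF x] a_le[OF x] t by (intro mult_mono power_mono) auto
    then show "norm (a x ^ j * exp (- (t * a x))) \<le> A ^ j"
      using a_nonneg[OF x] by (simp add: abs_mult)
  qed
qed measurable

lemma L_nonneg: "L j t \<ge> 0"
  unfolding L_def by (intro integral_nonneg_AE AE_I2) (auto simp: a_nonneg)

lemma L_deriv:
  assumes t: "t > 0"
  shows "(L j has_real_derivative - L (Suc j) t) (at t)"
  unfolding has_field_derivative_def has_derivative_at_alt
proof (intro conjI allI impI)
  show "bounded_linear ((*) (- L (Suc j) t))" by (rule bounded_linear_mult_right)
  fix e :: real assume e: "e > 0"
  define C where "C = \<bar>A\<bar> ^ j * A\<^sup>2 * exp \<bar>A\<bar> * measure M (space M) + 1"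
  have C: "C > 0" unfolding C_def by (intro add_nonneg_pos mult_nonneg_nonneg) auto
  define d where "d = min (min 1 t) (e / C)"
  have d: "d > 0" "d \<le> 1" "d \<le> t" "d \<le> e / C" using C e t by (auto simp: d_def)
  show "\<exists>d>0. \<forall>s. norm (s - t) < d \<longrightarrow>
      norm (L j s - L j t - - L (Suc j) t * (s - t)) \<le> e * norm (s - t)"
  proof (intro exI[of _ d] conjI allI impI)
    fix s assume "norm (s - t) < d"
    then have st: "\<bar>s - t\<bar> < d" by simp
    then have s: "s \<ge> 0" using d by linarith
    \<comment> \<open>The remainder of the first-order expansion in \<open>t\<close>; it is of order \<open>(s - t)\<^sup>2\<close> uniformly.\<close>
    let ?D = "\<lambda>x. a x ^ j * exp (- (s * a x)) - a x ^ j * exp (- (t * a x))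
      + a x ^ Suc j * exp (- (t * a x)) * (s - t)"
    have pw: "\<bar>?D x\<bar> \<le> \<bar>A\<bar> ^ j * (A\<^sup>2 * exp \<bar>A\<bar>) * (s - t)\<^sup>2" if x: "x \<in> space M" for x
    proof -
      define y where "y = - ((s - t) * a x)"
      have aA: "a x \<le> \<bar>A\<bar>" "0 \<le> a x" using a_le[OF x] a_nonneg[OF x] by auto
      have "exp (- (s * a x)) = exp (- (t * a x)) * exp y"
        unfolding y_def exp_add[symmetric] by (simp add: algebra_simps)
      then have "?D x = a x ^ j * exp (- (t * a x)) * (exp y - 1 - y)"
        by (simp add: y_def algebra_simps)
      then have "\<bar>?D x\<bar> = a x ^ j * exp (- (t * a x)) * \<bar>exp y - 1 - y\<bar>"
        using aA by (simp add: abs_mult)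
      also have "\<dots> \<le> \<bar>A\<bar> ^ j * 1 * (y\<^sup>2 * exp \<bar>y\<bar>)"
        using aA t by (intro mult_mono exp_taylor1_bounds power_mono) auto
      also have "y\<^sup>2 * exp \<bar>y\<bar> \<le> (A\<^sup>2 * (s - t)\<^sup>2) * exp \<bar>A\<bar>"
      proof (intro mult_mono)
        show "y\<^sup>2 \<le> A\<^sup>2 * (s - t)\<^sup>2"
          using mult_right_mono[OF power_mono[OF aA, of 2], of "(s - t)\<^sup>2"]
          by (simp add: y_def power_mult_distrib mult.commute)
        have "\<bar>y\<bar> = \<bar>s - t\<bar> * a x" using aA by (simp add: y_def abs_mult)
        also have "\<dots> \<le> 1 * \<bar>A\<bar>" using aA st d by (intro mult_mono) auto
        finally show "exp \<bar>y\<bar> \<le> exp \<bar>A\<bar>" by simp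
      qed auto
      finally show ?thesis by (simp only: mult_1_right mult.assoc mult_left_mono abs_ge_zero zero_le_power)
        (simp only: mult_ac)
    qed
    have int: "L j s - L j t - - L (Suc j) t * (s - t) = (\<integral>x. ?D x \<partial>M)"
      unfolding L_def using integrable_L[OF s, of j] integrable_L[of t j] integrable_L[of t "Suc j"] t
      by (simp del: power_Suc)
    have "\<bar>\<integral>x. ?D x \<partial>M\<bar> \<le> (\<integral>x. \<bar>?D x\<bar> \<partial>M)" by (rule integral_abs_bound)
    also have "\<dots> \<le> (\<integral>x. \<bar>A\<bar> ^ j * (A\<^sup>2 * exp \<bar>A\<bar>) * (s - t)\<^sup>2 \<partial>M)"
    proof (rule integral_mono[OF _ _ pw])
      show "integrable M (\<lambda>x. \<bar>?D x\<bar>)"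
        using integrable_L[OF s, of j] integrable_L[of t j] integrable_L[of t "Suc j"] t
        by (intro integrable_abs Bochner_Integration.integrable_add
          Bochner_Integration.integrable_diff integrable_mult_left) auto
    qed auto
    also have "\<dots> = (C - 1) * \<bar>s - t\<bar> * \<bar>s - t\<bar>"
      by (simp add: C_def power2_eq_square)
    also have "\<dots> \<le> C * \<bar>s - t\<bar> * \<bar>s - t\<bar>" by (intro mult_right_mono) auto
    also have "\<dots> \<le> e * \<bar>s - t\<bar>"
    proof (rule mult_right_mono)
      have "C * \<bar>s - t\<bar> \<le> C * (e / C)" using st d C by (intro mult_left_mono) auto
      then show "C * \<bar>s - t\<bar> \<le> e" using C by simp
    qed simp
    finally show "norm (L j s - L j t - - L (Suc j) t * (s - t)) \<le> e * norm (s - t)"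
      unfolding int by simp
  qed (rule d)
qed

text \<open>
In the application, \<open>p n t\<close> is the probability of a cluster with \<open>n + 1\<close> points at intensity \<open>t\<close>; by
\<open>p_deriv\<close> below, \<open>p'\<close> is the derivative of \<open>p\<close>.
\<close>
definition p :: "nat \<Rightarrow> real \<Rightarrow> real" where "p n t = t ^ n * L 0 t"
definition p' :: "nat \<Rightarrow> real \<Rightarrow> real" where "p' n t = real n * p n t / t - t ^ n * L 1 t"

lemma p_nonneg: "t > 0 \<Longrightarrow> p n t \<ge> 0" by (simp add: p_def L_nonneg)

lemma p_deriv:
  assumes t: "t > 0"
  shows "(p n has_real_derivative p' n t) (at t)"
proof -
  have "((\<lambda>t. t ^ n * L 0 t) has_real_derivative (real n * t ^ (n - 1) * L 0 t + t ^ n * - L 1 t)) (at t)"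
    using L_deriv[OF t, of 0] t by (auto intro!: derivative_eq_intros)
  also have "real n * t ^ (n - 1) * L 0 t = real n * p n t / t"
    using t by (cases n) (auto simp: p_def)
  finally show ?thesis unfolding p_def[abs_def] p'_def by simp
qed

text \<open>
A power of \<open>a\<close> costs half of the exponent. This bounds the moments of \<open>a\<close> by the total mass at another
intensity, with constants that do not involve the bound \<open>A\<close>, hence not the size of the ball.
\<close>

lemma L_le_half:
  assumes t: "t > 0"
  shows "t ^ n * L 1 t \<le> 2 ^ (n + 1) * p n (t/2) / t"
    and "t ^ n * L 2 t \<le> 2 ^ (n + 3) * p n (t/2) / t\<^sup>2"
proof -
  have half: "exp (- (t * a x)) = exp (- (t/2 * a x)) / exp (t * a x / 2)" for x
    by (simp add: exp_diff[symmetric] field_simps)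
  have "L 1 t \<le> (\<integral>x. 2 / t * (a x ^ 0 * exp (- (t/2 * a x))) \<partial>M)"
    unfolding L_def
  proof (intro integral_mono integrable_L integrable_mult_right)
    fix x assume "x \<in> space M"
    have "t * a x / 2 \<le> exp (t * a x / 2)" using exp_ge_add_one_self[of "t * a x / 2"] by linarith
    then have "a x \<le> 2 / t * exp (t * a x / 2)" using t by (simp add: field_simps)
    then have "a x * exp (- (t * a x)) \<le> (2 / t * exp (t * a x / 2)) * exp (- (t * a x))"
      by (intro mult_right_mono) auto
    also have "\<dots> = 2 / t * exp (- (t/2 * a x))" by (simp add: half)
    finally show "a x ^ 1 * exp (- (t * a x)) \<le> 2 / t * (a x ^ 0 * exp (- (t/2 * a x)))" by simp
  qed (use t in auto)
  also have "\<dots> = 2 / t * L 0 (t/2)" unfolding L_def by simp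
  finally have "t ^ n * L 1 t \<le> t ^ n * (2 / t * L 0 (t/2))" using t by (intro mult_left_mono) auto
  also have "\<dots> = 2 ^ (n + 1) * p n (t/2) / t" using t by (simp add: p_def field_simps power_divide)
  finally show "t ^ n * L 1 t \<le> 2 ^ (n + 1) * p n (t/2) / t" .
  have "L 2 t \<le> (\<integral>x. 8 / t\<^sup>2 * (a x ^ 0 * exp (- (t/2 * a x))) \<partial>M)"
    unfolding L_def
  proof (intro integral_mono integrable_L integrable_mult_right)
    fix x assume x: "x \<in> space M"
    have nn: "t * a x / 2 \<ge> 0" using a_nonneg[OF x] t by auto
    have "(t * a x / 2)\<^sup>2 / 2 \<le> exp (t * a x / 2)"
      using exp_lower_Taylor_quadratic[OF nn] nn by simp
    then have "(a x)\<^sup>2 \<le> 8 / t\<^sup>2 * exp (t * a x / 2)" using t by (simp add: field_simps)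
    then have "(a x)\<^sup>2 * exp (- (t * a x)) \<le> (8 / t\<^sup>2 * exp (t * a x / 2)) * exp (- (t * a x))"
      by (intro mult_right_mono) auto
    also have "\<dots> = 8 / t\<^sup>2 * exp (- (t/2 * a x))" by (simp add: half)
    finally show "(a x)\<^sup>2 * exp (- (t * a x)) \<le> 8 / t\<^sup>2 * (a x ^ 0 * exp (- (t/2 * a x)))" by simp
  qed (use t in auto)
  also have "\<dots> = 8 / t\<^sup>2 * L 0 (t/2)" unfolding L_def by simp
  finally have "t ^ n * L 2 t \<le> t ^ n * (8 / t\<^sup>2 * L 0 (t/2))" using t by (intro mult_left_mono) auto
  also have "\<dots> = 2 ^ (n + 3) * p n (t/2) / t\<^sup>2" using t by (simp add: p_def field_simps power_divide power_add)
  finally show "t ^ n * L 2 t \<le> 2 ^ (n + 3) * p n (t/2) / t\<^sup>2" .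
qed

text \<open>
For a fixed \<open>n\<close> the second derivative is bounded in terms of \<open>n\<close>, \<open>b\<close> and \<open>K\<close> only. This settles the
equicontinuity of finitely many terms of the series; \<open>p'_bound\<close> controls the rest.
\<close>

lemma p'_lipschitz:
  assumes K: "\<And>t. t > 0 \<Longrightarrow> p n t \<le> K" and b: "b > 0" and st: "s \<ge> b" "t \<ge> b"
  shows "\<bar>p' n s - p' n t\<bar> \<le> (real n * (real n + 2 ^ (n+1)) + real n + real n * 2 ^ (n+1) + 2 ^ (n+3)) * K / b\<^sup>2 * \<bar>s - t\<bar>"
    (is "_ \<le> ?C * K / _ * _")
proof -
  have K0: "K \<ge> 0" using K[of 1] p_nonneg[of 1 n] by simp
  let ?p'' = "\<lambda>t. real n * p' n t / t - real n * p n t / t\<^sup>2 - (real n * t ^ n * L 1 t / t - t ^ n * L 2 t)"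
  have deriv: "(p' n has_real_derivative ?p'' t) (at t)" if t: "t > 0" for t
  proof -
    have q: "((\<lambda>t. t ^ n * L 1 t) has_real_derivative (real n * t ^ (n - 1) * L 1 t + t ^ n * - L 2 t)) (at t)"
      using L_deriv[OF t, of 1] t by (auto intro!: derivative_eq_intros simp: numeral_2_eq_2)
    have n1: "real n * t ^ (n - 1) = real n * t ^ n / t" using t by (cases n) auto
    have "((\<lambda>t. real n * p n t / t) has_real_derivative
        (real n * p' n t * t - real n * p n t * 1) / (t * t)) (at t)"
      using t by (intro DERIV_divide DERIV_cmult p_deriv DERIV_ident) auto
    then have "(p' n has_real_derivative (real n * p' n t * t - real n * p n t * 1) / (t * t)
        - (real n * t ^ (n - 1) * L 1 t + t ^ n * - L 2 t)) (at t)"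
      unfolding p'_def[abs_def] using q by (rule DERIV_diff)
    also have "(real n * p' n t * t - real n * p n t * 1) / (t * t)
        - (real n * t ^ (n - 1) * L 1 t + t ^ n * - L 2 t) = ?p'' t"
      unfolding n1 using t by (simp add: field_simps power2_eq_square)
    finally show ?thesis .
  qed
  have bound: "\<bar>?p'' t\<bar> \<le> ?C * K / b\<^sup>2" if t: "t \<ge> b" for t
  proof -
    have t0: "t > 0" using t b by simp
    have p: "0 \<le> p n t" "p n t \<le> K" "p n (t/2) \<le> K" using K[of t] K[of "t/2"] p_nonneg t0 by auto
    have q1: "t ^ n * L 1 t \<le> 2 ^ (n+1) * K / t"
      using order_trans[OF L_le_half(1)[OF t0, of n] divide_right_mono[OF mult_left_mono[OF p(3)]]] t0 by auto
    have q2: "t ^ n * L 2 t \<le> 2 ^ (n+3) * K / t\<^sup>2"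
      using order_trans[OF L_le_half(2)[OF t0, of n] divide_right_mono[OF mult_left_mono[OF p(3)]]] t0 by auto
    have q10: "0 \<le> t ^ n * L 1 t" and q20: "0 \<le> t ^ n * L 2 t" using t0 L_nonneg by auto
    have "\<bar>p' n t\<bar> \<le> real n * p n t / t + t ^ n * L 1 t"
      unfolding p'_def using q10 p t0 by (intro order_trans[OF abs_triangle_ineq4]) (simp add: abs_mult L_nonneg)
    also have "\<dots> \<le> real n * K / t + 2 ^ (n+1) * K / t"
      using p t0 q1 by (intro add_mono divide_right_mono mult_left_mono) auto
    also have "\<dots> = (real n + 2 ^ (n+1)) * K / t" by (simp add: distrib_right add_divide_distrib)
    finally have p': "\<bar>p' n t\<bar> \<le> (real n + 2 ^ (n+1)) * K / t" .
    have "\<bar>?p'' t\<bar> \<le> \<bar>real n * p' n t / t\<bar> + \<bar>real n * p n t / t\<^sup>2\<bar> + \<bar>real n * (t ^ n * L 1 t) / t\<bar> + \<bar>t ^ n * L 2 t\<bar>"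
    proof -
      have "\<bar>u - v - (w - z)\<bar> \<le> \<bar>u\<bar> + \<bar>v\<bar> + \<bar>w\<bar> + \<bar>z\<bar>" for u v w z :: real by linarith
      then show ?thesis by (simp only: mult.assoc)
    qed
    also have "\<dots> = real n * \<bar>p' n t\<bar> / t + real n * p n t / t\<^sup>2 + real n * (t ^ n * L 1 t) / t + t ^ n * L 2 t"
      using t0 p L_nonneg[of 1] L_nonneg[of 2] q10 q20 by (simp only: abs_mult abs_divide abs_of_nonneg abs_of_nat abs_of_pos zero_less_power)
    also have "\<dots> \<le> real n * ((real n + 2 ^ (n+1)) * K / t) / t + real n * K / t\<^sup>2
        + real n * (2 ^ (n+1) * K / t) / t + 2 ^ (n+3) * K / t\<^sup>2"
      using p t0 q1 q2 p' by (intro add_mono divide_right_mono mult_left_mono) auto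
    also have "\<dots> = ?C * K / t\<^sup>2" using t0 by (simp add: field_simps power2_eq_square)
    also have "\<dots> \<le> ?C * K / b\<^sup>2"
      using t b K0 by (intro divide_left_mono power_mono mult_nonneg_nonneg) auto
    finally show ?thesis .
  qed
  have "norm (p' n s - p' n t) \<le> ?C * K / b\<^sup>2 * norm (s - t)"
  proof (rule field_differentiable_bound[where S="{b..}" and f'="?p''"])
    show "convex {b..}" by auto
  qed (use st b deriv bound in \<open>auto intro: has_field_derivative_at_within\<close>)
  then show ?thesis by simp
qed

text \<open>
The key estimate. The factor \<open>\<bar>n - t a\<bar>\<close> is at most \<open>r\<close> plus an exponential that is small unless
\<open>\<bar>n - t a\<bar>\<close> exceeds \<open>r\<close>, and the exponential is absorbed by moving the intensity to \<open>t (1 \<plusminus> \<theta>)\<close>.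
\<close>

lemma p'_bound:
  assumes K: "\<And>t. t > 0 \<Longrightarrow> p n t \<le> K" and t: "t > 0" and \<theta>: "0 < \<theta>" "\<theta> \<le> 1/2"
  shows "\<bar>p' n t\<bar> \<le> (r * p n t + 2 * K * exp (2 * real n * \<theta>\<^sup>2 - \<theta> * r) / \<theta>) / t"
proof -
  let ?x = "\<lambda>x. real n - t * a x"
  let ?w = "\<lambda>x. t ^ n * exp (- (t * a x))"
  have int0: "integrable M (\<lambda>x. exp (- (s * a x)))" if "s \<ge> 0" for s
    using integrable_L[OF that, of 0] by simp
  have int1: "integrable M (\<lambda>x. a x * exp (- (t * a x)))"
    using integrable_L[of t 1] t by simp
  \<comment> \<open>The change of intensity, for \<open>h = \<theta>\<close> and \<open>h = - \<theta>\<close>.\<close>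
  have tilt: "?w x * exp (h * ?x x) \<le> exp (2 * real n * \<theta>\<^sup>2) * ((t * (1 + h)) ^ n * exp (- (t * (1 + h) * a x)))"
    if h: "\<bar>h\<bar> = \<theta>" for h x
  proof -
    have h1: "1 + h > 0" "\<bar>h\<bar> \<le> 1/2" using h \<theta> by auto
    have "h - ln (1 + h) \<le> 2 * \<theta>\<^sup>2"
      using abs_ln_one_plus_x_minus_x_bound[OF h1(2)] h by (auto simp: power2_eq_square abs_if split: if_splits)
    then have "real n * (h - ln (1 + h)) \<le> real n * (2 * \<theta>\<^sup>2)" by (intro mult_left_mono) auto
    then have "real n * h \<le> 2 * real n * \<theta>\<^sup>2 + real n * ln (1 + h)" by (simp add: algebra_simps)
    then have "exp (real n * h) \<le> exp (2 * real n * \<theta>\<^sup>2) * (1 + h) ^ n"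
      using h1 by (metis exp_add exp_le_cancel_iff exp_of_nat_mult exp_ln)
    then have "exp (real n * h) * (t ^ n * exp (- (t * (1 + h) * a x)))
        \<le> exp (2 * real n * \<theta>\<^sup>2) * (1 + h) ^ n * (t ^ n * exp (- (t * (1 + h) * a x)))"
      using t by (intro mult_right_mono) auto
    moreover have "?w x * exp (h * ?x x) = exp (real n * h) * (t ^ n * exp (- (t * (1 + h) * a x)))"
    proof -
      have "exp (- (t * a x)) * exp (h * ?x x) = exp (real n * h) * exp (- (t * (1 + h) * a x))"
        unfolding exp_add[symmetric] by (simp add: algebra_simps)
      then have "t ^ n * (exp (- (t * a x)) * exp (h * ?x x)) = t ^ n * (exp (real n * h) * exp (- (t * (1 + h) * a x)))"
        by (rule arg_cong)
      then show ?thesis by (simp only: mult.assoc mult.left_commute)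
    qed
    ultimately show ?thesis by (simp only: power_mult_distrib mult.assoc) (simp only: mult.left_commute)
  qed
  \<comment> \<open>This is \<open>z \<le> exp z\<close> for \<open>z = \<theta> (\<bar>y\<bar> - r)\<close>.\<close>
  have abs_le: "\<bar>y\<bar> \<le> r + exp (- \<theta> * r) / \<theta> * (exp (\<theta> * y) + exp ((- \<theta>) * y))" for y
  proof -
    have "\<theta> * (\<bar>y\<bar> - r) \<le> exp (\<theta> * (\<bar>y\<bar> - r))" using exp_ge_add_one_self[of "\<theta> * (\<bar>y\<bar> - r)"] by linarith
    then have "\<bar>y\<bar> \<le> r + exp (\<theta> * (\<bar>y\<bar> - r)) / \<theta>" using \<theta> by (simp add: field_simps)
    also have "exp (\<theta> * (\<bar>y\<bar> - r)) = exp (- \<theta> * r) * exp (\<theta> * \<bar>y\<bar>)"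
      unfolding exp_add[symmetric] by (simp add: algebra_simps)
    also have "exp (\<theta> * \<bar>y\<bar>) \<le> exp (\<theta> * y) + exp ((- \<theta>) * y)" by (auto simp: abs_if)
    finally show ?thesis using \<theta> by (simp add: mult_left_mono divide_right_mono)
  qed
  let ?c = "exp (2 * real n * \<theta>\<^sup>2 - \<theta> * r) / \<theta>"
  let ?T = "\<lambda>h x. (t * (1 + h)) ^ n * exp (- (t * (1 + h) * a x))"
  have pw: "\<bar>?x x * ?w x\<bar> \<le> r * ?w x + ?c * (?T \<theta> x + ?T (-\<theta>) x)" for x
  proof -
    have w: "?w x \<ge> 0" using t by simp
    have "\<bar>?x x * ?w x\<bar> = \<bar>?x x\<bar> * ?w x" by (simp only: abs_mult[of "?x x" "?w x"] abs_of_nonneg[OF w])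
    also have "\<dots> \<le> (r + exp (- \<theta> * r) / \<theta> * (exp (\<theta> * ?x x) + exp ((- \<theta>) * ?x x))) * ?w x"
      using w by (intro mult_right_mono abs_le)
    also have "\<dots> = r * ?w x + exp (- \<theta> * r) / \<theta> * (?w x * exp (\<theta> * ?x x) + ?w x * exp ((- \<theta>) * ?x x))"
      by (simp add: algebra_simps add_divide_distrib)
    also have "\<dots> \<le> r * ?w x + exp (- \<theta> * r) / \<theta> *
        (exp (2 * real n * \<theta>\<^sup>2) * ?T \<theta> x + exp (2 * real n * \<theta>\<^sup>2) * ?T (-\<theta>) x)"
      using \<theta> by (intro add_left_mono mult_left_mono add_mono tilt) auto
    also have "\<dots> = r * ?w x + exp (- \<theta> * r) * exp (2 * real n * \<theta>\<^sup>2) / \<theta> * (?T \<theta> x + ?T (-\<theta>) x)"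
      by (simp add: algebra_simps add_divide_distrib)
    also have "exp (- \<theta> * r) * exp (2 * real n * \<theta>\<^sup>2) = exp (2 * real n * \<theta>\<^sup>2 - \<theta> * r)"
      unfolding exp_add[symmetric] by simp
    finally show ?thesis .
  qed
  have pI: "p n s = (\<integral>x. s ^ n * exp (- (s * a x)) \<partial>M)" for s unfolding p_def L_def by simp
  have "p' n t = (\<integral>x. ?x x * ?w x \<partial>M) / t"
  proof -
    have "(\<integral>x. ?x x * ?w x \<partial>M) = (\<integral>x. real n * t ^ n * exp (- (t * a x)) - t * t ^ n * (a x * exp (- (t * a x))) \<partial>M)"
      by (simp add: algebra_simps)
    also have "\<dots> = real n * t ^ n * (\<integral>x. exp (- (t * a x)) \<partial>M) - t * t ^ n * (\<integral>x. a x * exp (- (t * a x)) \<partial>M)"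
      using int0[of t] int1 t by simp
    finally show ?thesis unfolding p'_def p_def L_def using t by (simp add: field_simps)
  qed
  also have "\<bar>\<dots>\<bar> \<le> (\<integral>x. \<bar>?x x * ?w x\<bar> \<partial>M) / t"
    using t by (simp add: integral_abs_bound divide_right_mono)
  also have "(\<integral>x. \<bar>?x x * ?w x\<bar> \<partial>M) \<le> (\<integral>x. r * ?w x + ?c * (?T \<theta> x + ?T (-\<theta>) x) \<partial>M)"
  proof (intro integral_mono pw)
    have "integrable M (\<lambda>x. real n * t ^ n * exp (- (t * a x)) - t * t ^ n * (a x * exp (- (t * a x))))"
      using int0[of t] int1 t by simp
    then have "integrable M (\<lambda>x. ?x x * ?w x)" by (simp add: algebra_simps)
    then show "integrable M (\<lambda>x. \<bar>?x x * ?w x\<bar>)" by simp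
    show "integrable M (\<lambda>x. r * ?w x + ?c * (?T \<theta> x + ?T (-\<theta>) x))"
      using t \<theta> by (intro Bochner_Integration.integrable_add integrable_mult_right int0) auto
  qed
  also have "\<dots> = r * p n t + ?c * (p n (t * (1 + \<theta>)) + p n (t * (1 + -\<theta>)))"
    unfolding pI using t \<theta> int0 by (subst Bochner_Integration.integral_add) (auto intro!: integrable_mult_right
      Bochner_Integration.integrable_add)
  also have "\<dots> \<le> r * p n t + ?c * (K + K)"
    using t \<theta> by (intro add_left_mono mult_left_mono add_mono K) auto
  finally show ?thesis using t by (simp add: divide_right_mono mult_ac)
qed

end

text \<open>
In the application \<open>k\<close> numbers the balls. The partial sum of length \<open>k\<close> is paired with the \<open>k\<close>-th ball,
so that a single limit covers both the series and the exhaustion of the space.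
\<close>

lemma C1_limit_of_cluster_series:
  fixes M :: "nat \<Rightarrow> nat \<Rightarrow> 'b measure" and a :: "nat \<Rightarrow> nat \<Rightarrow> 'b \<Rightarrow> real" and c :: "nat \<Rightarrow> real"
  assumes lap: "\<And>k n. bounded_laplace (M k n) (a k n) (A k n)"
    and total: "\<And>k t. t > 0 \<Longrightarrow> (\<Sum>n<k. t ^ n * (\<integral>x. exp (- (t * a k n x)) \<partial>M k n)) \<le> K"
    and c: "(\<lambda>n. c n * sqrt (real n * ln (real n))) \<longlonglongrightarrow> 0"
    and lim: "\<And>t. t > 0 \<Longrightarrow>
      (\<lambda>k. \<Sum>n<k. c n * (t ^ n * (\<integral>x. exp (- (t * a k n x)) \<partial>M k n))) \<longlonglongrightarrow> G t"
  shows "G C1_differentiable_on {0<..}"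
proof -
  define P where "P k n = bounded_laplace.p (M k n) (a k n) n" for k n
  define P' where "P' k n = bounded_laplace.p' (M k n) (a k n) n" for k n
  have P_eq: "P k n t = t ^ n * (\<integral>x. exp (- (t * a k n x)) \<partial>M k n)" for k n t
    unfolding P_def bounded_laplace.p_def[OF lap] bounded_laplace.L_def[OF lap] by simp
  have P_nonneg: "P k n t \<ge> 0" if "t > 0" for k n t
    unfolding P_def using bounded_laplace.p_nonneg[OF lap that] .
  have P_sum: "(\<Sum>n<k. P k n t) \<le> K" if "t > 0" for k t
    unfolding P_eq using total[OF that] .
  have P_le: "P k n t \<le> K" if "t > 0" "n < k" for k n t
    using member_le_sum[of n "{..<k}" "\<lambda>n. P k n t"] P_sum[OF that(1), of k] P_nonneg that by force
  have K0: "K \<ge> 0" using P_sum[of 1 0] by simp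
  have bound: "\<bar>P' k n t\<bar> \<le> (5 * sqrt (real n * ln (real n)) * P k n t + 2 * K / real n ^ 2) / t"
    if t: "t > 0" and n: "n < k" "n \<ge> 64" for k n t
  proof -
    define l where "l = ln (real n)"
    have "exp 1 \<le> (3::real)" by (rule exp_le)
    then have l1: "l \<ge> 1" unfolding l_def using n by (subst ln_ge_iff) auto
    \<comment> \<open>This makes \<open>\<theta> = sqrt (ln n / n)\<close> at most \<open>1/2\<close>, from \<open>n = 64\<close> onwards.\<close>
    have l3: "l \<le> real n / 4"
    proof -
      have s8: "sqrt (real n) \<ge> 8" using real_sqrt_le_mono[of 64 "real n"] n by simp
      have "l = 2 * ln (sqrt (real n))" unfolding l_def using n by (simp add: ln_sqrt)
      also have "ln (sqrt (real n)) \<le> sqrt (real n) - 1" using n by (intro ln_le_minus_one) auto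
      finally have "l \<le> 2 * sqrt (real n)" by simp
      also have "8 * sqrt (real n) \<le> sqrt (real n) * sqrt (real n)" using s8 by (intro mult_right_mono) auto
      then have "2 * sqrt (real n) \<le> real n / 4" by simp
      finally show ?thesis .
    qed
    define \<theta> where "\<theta> = sqrt (l / real n)"
    have n0: "real n > 0" using n by simp
    have \<theta>2: "\<theta>\<^sup>2 = l / real n" unfolding \<theta>_def using l1 by simp
    have \<theta>: "0 < \<theta>" "\<theta> \<le> 1/2"
    proof -
      show "0 < \<theta>" unfolding \<theta>_def using l1 n0 by simp
      have "sqrt (l / real n) \<le> sqrt ((1/2)\<^sup>2)"
        using l3 n0 by (intro real_sqrt_le_mono) (simp add: field_simps power2_eq_square)
      then show "\<theta> \<le> 1/2" unfolding \<theta>_def by (simp only: real_sqrt_abs)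
    qed
    have \<theta>r: "\<theta> * sqrt (real n * l) = l"
      unfolding \<theta>_def real_sqrt_mult[symmetric] using l1 n0 by simp
    have "1 / real n \<le> \<theta>"
    proof -
      have "sqrt ((1 / real n)\<^sup>2) \<le> sqrt (l / real n)"
      proof (rule real_sqrt_le_mono)
        have "1 \<le> l * real n" using mult_mono[OF l1, of 1 "real n"] n l1 by simp
        then show "(1 / real n)\<^sup>2 \<le> l / real n" using n0 by (simp add: field_simps power2_eq_square)
      qed
      then show ?thesis unfolding \<theta>_def by (simp only: real_sqrt_abs)
    qed
    then have inv: "1 / \<theta> \<le> real n" using \<theta> n0 by (simp add: field_simps)
    have "exp (2 * real n * \<theta>\<^sup>2 - \<theta> * (5 * sqrt (real n * l))) = exp (- (3 * l))"
    proof -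
      have "2 * real n * \<theta>\<^sup>2 - \<theta> * (5 * sqrt (real n * l)) = 2 * l - 5 * l"
        using \<theta>r \<theta>2 n0 by simp
      then show ?thesis by simp
    qed
    also have "\<dots> = 1 / real n ^ 3"
    proof -
      have "exp (3 * l) = exp l ^ 3" by (metis exp_of_nat_mult of_nat_numeral)
      then show ?thesis using n0 by (simp add: l_def exp_minus inverse_eq_divide)
    qed
    finally have ex: "exp (2 * real n * \<theta>\<^sup>2 - \<theta> * (5 * sqrt (real n * l))) = 1 / real n ^ 3" .
    have "\<bar>P' k n t\<bar> \<le> (5 * sqrt (real n * l) * P k n t +
        2 * K * exp (2 * real n * \<theta>\<^sup>2 - \<theta> * (5 * sqrt (real n * l))) / \<theta>) / t"
      unfolding P_def P'_def
      by (rule bounded_laplace.p'_bound[OF lap _ t \<theta>]) (use P_le n in \<open>auto simp: P_def\<close>)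
    also have "2 * K * exp (2 * real n * \<theta>\<^sup>2 - \<theta> * (5 * sqrt (real n * l))) / \<theta>
        = 2 * K / real n ^ 3 * (1 / \<theta>)" unfolding ex by simp
    also have "\<dots> \<le> 2 * K / real n ^ 3 * real n" using K0 by (intro mult_left_mono inv) auto
    also have "\<dots> = 2 * K / real n ^ 2" using n0 by (simp add: power2_eq_square power3_eq_cube)
    finally show ?thesis using t by (simp add: l_def divide_right_mono)
  qed
  show ?thesis
  proof (rule C1_differentiable_on_limit[where F="\<lambda>k t. \<Sum>n<k. c n * P k n t" and D="\<lambda>k t. \<Sum>n<k. c n * P' k n t"])
    fix k and t :: real assume t: "t > 0"
    show "((\<lambda>t. \<Sum>n<k. c n * P k n t) has_real_derivative (\<Sum>n<k. c n * P' k n t)) (at t)"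
      unfolding P_def P'_def by (intro DERIV_sum DERIV_cmult bounded_laplace.p_deriv[OF lap t])
  next
    fix t :: real assume "t > 0"
    then show "(\<lambda>k. \<Sum>n<k. c n * P k n t) \<longlonglongrightarrow> G t" unfolding P_eq by (rule lim)
  next
    fix \<alpha> \<beta> e :: real assume ab: "0 < \<alpha>" "\<alpha> \<le> \<beta>" and e: "0 < e"
    \<comment> \<open>The tail will be at most \<open>3 \<eta> K / \<alpha>\<close>, which must stay below \<open>3 e / 8\<close>.\<close>
    define \<eta> where "\<eta> = e * \<alpha> / (8 * (K + 1))"
    have \<eta>: "\<eta> > 0" unfolding \<eta>_def using e ab K0 by auto
    have ev1: "eventually (\<lambda>n. \<bar>c n * sqrt (real n * ln (real n))\<bar> < min 1 (\<eta> / 5)) sequentially"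
      using tendstoD[OF c, of "min 1 (\<eta>/5)"] \<eta> by (simp add: dist_real_def)
    have "summable (\<lambda>n. 1 / real n ^ 2)" using inverse_power_summable[of 2] by (simp add: inverse_eq_divide)
    then obtain N2 where N2: "\<And>m n. m \<ge> N2 \<Longrightarrow> \<bar>\<Sum>n\<in>{m..<n}. 1 / real n ^ 2\<bar> < \<eta>"
      using \<eta> unfolding summable_Cauchy real_norm_def by blast
    obtain N1 where N1: "\<And>n. n \<ge> N1 \<Longrightarrow> \<bar>c n * sqrt (real n * ln (real n))\<bar> < min 1 (\<eta> / 5)"
      using ev1 unfolding eventually_sequentially by auto
    define N where "N = max 64 (max N1 N2)"
    have tail: "\<bar>\<Sum>n\<in>{N..<k}. c n * P' k n t\<bar> \<le> e / 2 - e / 8" if t: "t \<in> {\<alpha>..\<beta>}" for k t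
    proof -
      have t0: "t > 0" using t ab by auto
      have "\<bar>\<Sum>n\<in>{N..<k}. c n * P' k n t\<bar> \<le> (\<Sum>n\<in>{N..<k}. \<bar>c n * P' k n t\<bar>)" by (rule sum_abs)
      also have "\<dots> \<le> (\<Sum>n\<in>{N..<k}. (\<eta> * P k n t + 2 * K * (1 / real n ^ 2)) / \<alpha>)"
      proof (rule sum_mono)
        fix n assume n: "n \<in> {N..<k}"
        then have n': "n < k" "n \<ge> 64" "n \<ge> N1" by (auto simp: N_def)
        let ?s = "sqrt (real n * ln (real n))"
        have "exp 1 \<le> (3::real)" by (rule exp_le)
        then have l1: "ln (real n) \<ge> 1" using n' by (subst ln_ge_iff) auto
        have s0: "?s \<ge> 1" using mult_mono[OF _ l1, of 1 "real n"] n' by simp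
        have cs: "\<bar>c n\<bar> * ?s < 1" "\<bar>c n\<bar> * ?s < \<eta> / 5" using N1[OF n'(3)] s0 by (auto simp: abs_mult)
        have c1: "\<bar>c n\<bar> \<le> 1" using mult_left_mono[OF s0, of "\<bar>c n\<bar>"] cs(1) by simp
        have "\<bar>c n * P' k n t\<bar> \<le> \<bar>c n\<bar> * ((5 * ?s * P k n t + 2 * K / real n ^ 2) / t)"
          unfolding abs_mult by (intro mult_left_mono bound t0 n') auto
        also have "\<dots> = (5 * (\<bar>c n\<bar> * ?s) * P k n t + \<bar>c n\<bar> * (2 * K / real n ^ 2)) / t"
          by (simp add: algebra_simps add_divide_distrib)
        also have "\<dots> \<le> (\<eta> * P k n t + 1 * (2 * K / real n ^ 2)) / t"
          using t0 cs c1 K0 P_nonneg[OF t0] by (intro divide_right_mono add_mono mult_right_mono) auto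
        also have "\<dots> \<le> (\<eta> * P k n t + 1 * (2 * K / real n ^ 2)) / \<alpha>"
          using t ab K0 \<eta> P_nonneg[OF t0] by (intro divide_left_mono add_nonneg_nonneg mult_nonneg_nonneg) auto
        finally show "\<bar>c n * P' k n t\<bar> \<le> (\<eta> * P k n t + 2 * K * (1 / real n ^ 2)) / \<alpha>" by simp
      qed
      also have "\<dots> = (\<eta> * (\<Sum>n\<in>{N..<k}. P k n t) + 2 * K * (\<Sum>n\<in>{N..<k}. 1 / real n ^ 2)) / \<alpha>"
        by (simp only: sum_divide_distrib[symmetric] sum.distrib sum_distrib_left)
      also have "\<dots> \<le> (\<eta> * K + 2 * K * \<eta>) / \<alpha>"
      proof (intro divide_right_mono add_mono mult_left_mono)
        have "(\<Sum>n\<in>{N..<k}. P k n t) \<le> (\<Sum>n<k. P k n t)"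
          using P_nonneg[OF t0] by (intro sum_mono2) auto
        then show "(\<Sum>n\<in>{N..<k}. P k n t) \<le> K" using P_sum[OF t0, of k] by simp
        show "(\<Sum>n\<in>{N..<k}. 1 / real n ^ 2) \<le> \<eta>" using abs_ge_self N2[of N k]
          by (rule order_trans[OF _ less_imp_le]) (simp add: N_def)
      qed (use \<eta> K0 ab in auto)
      also have "\<dots> = 3 * K * (\<eta> / \<alpha>)" by (simp add: add_divide_distrib)
      also have "\<eta> / \<alpha> = e / (8 * (K + 1))" using ab by (simp add: \<eta>_def)
      also have "3 * K * (e / (8 * (K + 1))) = 3 * (e / 8) * (K / (K + 1))" by simp
      also have "\<dots> \<le> 3 * (e / 8) * 1" using e K0 by (intro mult_left_mono) auto
      finally show ?thesis by simp
    qed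
    define C where "C n = \<bar>c n\<bar> * ((real n * (real n + 2 ^ (n+1)) + real n + real n * 2 ^ (n+1) + 2 ^ (n+3)) * K / \<alpha>\<^sup>2)" for n
    have C0: "C n \<ge> 0" for n unfolding C_def using K0 by (intro mult_nonneg_nonneg divide_nonneg_nonneg) auto
    define d where "d = e / (4 * ((\<Sum>n<N. C n) + 1))"
    have S0: "(\<Sum>n<N. C n) \<ge> 0" by (intro sum_nonneg C0)
    have d0: "d > 0" unfolding d_def using e S0 by (intro divide_pos_pos) auto
    show "\<exists>d>0. \<forall>k. \<forall>s\<in>{\<alpha>..\<beta>}. \<forall>t\<in>{\<alpha>..\<beta>}. \<bar>s - t\<bar> < d \<longrightarrow>
        \<bar>(\<Sum>n<k. c n * P' k n s) - (\<Sum>n<k. c n * P' k n t)\<bar> \<le> e"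
    proof (intro exI[of _ d] conjI d0 allI ballI impI)
      fix k s t assume st: "s \<in> {\<alpha>..\<beta>}" "t \<in> {\<alpha>..\<beta>}" "\<bar>s - t\<bar> < d"
      have split: "(\<Sum>n<k. g n) = (\<Sum>n<min N k. g n) + (\<Sum>n\<in>{N..<k}. g n)" for g :: "nat \<Rightarrow> real"
      proof -
        have "{..<k} = {..<min N k} \<union> {N..<k}" by auto
        then have "sum g {..<k} = sum g ({..<min N k} \<union> {N..<k})" by (rule arg_cong)
        also have "\<dots> = (\<Sum>n<min N k. g n) + (\<Sum>n\<in>{N..<k}. g n)"
          by (rule sum.union_disjoint) auto
        finally show ?thesis .
      qed
      have "\<bar>(\<Sum>n<min N k. c n * P' k n s) - (\<Sum>n<min N k. c n * P' k n t)\<bar>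
          = \<bar>\<Sum>n<min N k. c n * (P' k n s - P' k n t)\<bar>"
        by (simp add: sum_subtractf right_diff_distrib)
      also have "\<dots> \<le> (\<Sum>n<min N k. \<bar>c n * (P' k n s - P' k n t)\<bar>)" by (rule sum_abs)
      also have "\<dots> \<le> (\<Sum>n<min N k. C n * \<bar>s - t\<bar>)"
      proof (rule sum_mono)
        fix n assume n: "n \<in> {..<min N k}"
        have "\<bar>P' k n s - P' k n t\<bar> \<le> (real n * (real n + 2 ^ (n+1)) + real n + real n * 2 ^ (n+1) + 2 ^ (n+3)) * K / \<alpha>\<^sup>2 * \<bar>s - t\<bar>"
          unfolding P'_def
          by (rule bounded_laplace.p'_lipschitz[OF lap]) (use P_le n st ab in \<open>auto simp: P_def\<close>)
        then show "\<bar>c n * (P' k n s - P' k n t)\<bar> \<le> C n * \<bar>s - t\<bar>"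
          unfolding C_def abs_mult mult.assoc by (intro mult_left_mono) auto
      qed
      also have "\<dots> \<le> (\<Sum>n<N. C n * \<bar>s - t\<bar>)" using C0 by (intro sum_mono2) auto
      also have "\<dots> = (\<Sum>n<N. C n) * \<bar>s - t\<bar>" by (simp add: sum_distrib_right)
      also have "\<dots> \<le> (\<Sum>n<N. C n) * d" using st S0 by (intro mult_left_mono) auto
      also have "\<dots> \<le> ((\<Sum>n<N. C n) + 1) * d" using d0 by (intro mult_right_mono) auto
      also have "\<dots> = e / 4"
      proof -
        have "Z * (e / (4 * Z)) = e / 4" if "Z > 0" for Z :: real using that by simp
        from this[of "(\<Sum>n<N. C n) + 1"] show ?thesis unfolding d_def using S0 by linarith
      qed
      finally show "\<bar>(\<Sum>n<k. c n * P' k n s) - (\<Sum>n<k. c n * P' k n t)\<bar> \<le> e"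
        using tail[OF st(1), of k] tail[OF st(2), of k] unfolding split[of "\<lambda>n. c n * P' k n s"]
          split[of "\<lambda>n. c n * P' k n t"] by linarith
    qed
  qed
qed

section \<open>Counting bijections that respect a colouring\<close>

text \<open>
Prescribing the colour of every value serves two purposes: with cells of a partition as colours it
computes Poisson probabilities, and with two colours, for the cluster and its complement, it counts
the orderings of a configuration that list the cluster first.
\<close>

definition coloured_bijections ::
  "'s set \<Rightarrow> 'j set \<Rightarrow> ('j \<Rightarrow> 'c) \<Rightarrow> ('s \<Rightarrow> 'c) \<Rightarrow> ('s \<Rightarrow> 'j) set" where
  "coloured_bijections S J s c = {\<tau> \<in> S \<rightarrow>\<^sub>E J. bij_betw \<tau> S J \<and> (\<forall>j\<in>S. s (\<tau> j) = c j)}"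

lemma coloured_bijections_insert:
  assumes "x \<notin> S"
  shows "coloured_bijections (insert x S) J s c =
    (\<Union>i\<in>{i\<in>J. s i = c x}. (\<lambda>\<tau>. \<tau>(x := i)) ` coloured_bijections S (J - {i}) s c)" (is "?L = ?R")
proof (intro set_eqI iffI)
  fix \<tau> assume \<tau>: "\<tau> \<in> ?L"
  define \<sigma> where "\<sigma> = \<tau>(x := undefined)"
  have b: "bij_betw \<tau> (insert x S) J" and e: "\<tau> \<in> extensional (insert x S)"
    and col: "\<forall>j\<in>insert x S. s (\<tau> j) = c j"
    using \<tau> by (auto simp: coloured_bijections_def PiE_def)
  have "bij_betw \<tau> S (J - {\<tau> x})"
    unfolding bij_betw_def
  proof
    show "inj_on \<tau> S" using b by (auto simp: bij_betw_def)
    have "\<tau> x \<notin> \<tau> ` S" using b assms by (auto simp: bij_betw_def inj_on_def)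
    then show "\<tau> ` S = J - {\<tau> x}" using b unfolding bij_betw_def by blast
  qed
  then have bs: "bij_betw \<sigma> S (J - {\<tau> x})"
    using assms by (subst bij_betw_cong[of S \<sigma> \<tau>]) (auto simp: \<sigma>_def)
  have "\<sigma> \<in> extensional S" using e by (auto simp: \<sigma>_def extensional_def)
  then have "\<sigma> \<in> coloured_bijections S (J - {\<tau> x}) s c"
    using bs bij_betwE[OF bs] col assms unfolding coloured_bijections_def PiE_def
    by (auto simp: \<sigma>_def)
  moreover have "\<tau> = \<sigma>(x := \<tau> x)" by (auto simp: \<sigma>_def)
  moreover have "\<tau> x \<in> {i\<in>J. s i = c x}" using b col by (auto dest: bij_betwE)
  ultimately show "\<tau> \<in> ?R" by blast
next
  fix \<tau> assume "\<tau> \<in> ?R"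
  then obtain i \<sigma> where i: "i \<in> J" "s i = c x" and \<sigma>: "\<sigma> \<in> coloured_bijections S (J - {i}) s c"
    and \<tau>: "\<tau> = \<sigma>(x := i)" by auto
  have "bij_betw \<sigma> S (J - {i})" using \<sigma> by (auto simp: coloured_bijections_def)
  then have "bij_betw \<tau> S (J - {i})" using assms
    by (subst bij_betw_cong[of S \<tau> \<sigma>]) (auto simp: \<tau>)
  moreover have "bij_betw \<tau> {x} {i}" by (simp add: \<tau>)
  ultimately have b: "bij_betw \<tau> (insert x S) J"
    using bij_betw_combine[of \<tau> S "J - {i}" "{x}" "{i}"] i
    by (simp add: insert_absorb Un_commute)
  have "\<tau> \<in> extensional (insert x S)"
    using \<sigma> by (auto simp: \<tau> coloured_bijections_def PiE_def extensional_def)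
  then show "\<tau> \<in> ?L" using b \<sigma> i by (auto simp: coloured_bijections_def PiE_def \<tau> dest: bij_betwE)
qed

lemma finite_coloured_bijections:
  "finite S \<Longrightarrow> finite J \<Longrightarrow> finite (coloured_bijections S J s c)"
  unfolding coloured_bijections_def by (rule finite_subset[OF _ finite_PiE[of S "\<lambda>_. J"]]) auto

lemma card_coloured_bijections:
  assumes "finite S" "finite L" "c ` S \<subseteq> L" "finite J"
    and "\<And>l. card {i\<in>J. s i = l} = card {j\<in>S. c j = l}"
  shows "card (coloured_bijections S J s c) = (\<Prod>l\<in>L. fact (card {j\<in>S. c j = l}))"
  using assms
proof (induction S arbitrary: J rule: finite_induct)
  case empty
  have "J = {}"
  proof (rule ccontr)
    assume "J \<noteq> {}"
    then obtain i where "i \<in> J" by auto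
    then have "card {i'\<in>J. s i' = s i} \<noteq> 0" using empty.prems by auto
    then show False using empty.prems(4)[of "s i"] by simp
  qed
  then have "coloured_bijections {} J s c = {\<lambda>_. undefined}"
    by (auto simp: coloured_bijections_def bij_betw_def)
  then show ?case by simp
next
  case (insert x S)
  have fJ: "finite J" by fact
  have cx: "{j\<in>insert x S. c j = c x} = insert x {j\<in>S. c j = c x}"
    and cl: "l \<noteq> c x \<Longrightarrow> {j\<in>insert x S. c j = l} = {j\<in>S. c j = l}" for l by auto
  have card: "card (coloured_bijections S (J - {i}) s c) = (\<Prod>l\<in>L. fact (card {j\<in>S. c j = l}))"
    if i: "i \<in> J" "s i = c x" for i
  proof (rule insert.IH)
    fix l
    show "card {i'\<in>J - {i}. s i' = l} = card {j\<in>S. c j = l}"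
    proof (cases "l = c x")
      case True
      have "{i'\<in>J - {i}. s i' = l} = {i'\<in>J. s i' = l} - {i}" by auto
      then have "card {i'\<in>J - {i}. s i' = l} = card {i'\<in>J. s i' = l} - 1"
        using i True fJ by simp
      moreover have "card {j\<in>insert x S. c j = c x} = Suc (card {j\<in>S. c j = c x})"
        unfolding cx using insert.hyps by simp
      ultimately show ?thesis unfolding insert.prems(4) by (simp only: True diff_Suc_1)
    next
      case False
      then have "{i'\<in>J - {i}. s i' = l} = {i'\<in>J. s i' = l}" using i by auto
      then show ?thesis using insert.prems(4)[of l] cl[OF False] by simp
    qed
  qed (use insert.prems in auto)
  have inj: "inj_on (\<lambda>\<tau>. \<tau>(x := i)) (coloured_bijections S (J - {i}) s c)" for i
  proof (rule inj_onI)
    fix \<tau> \<sigma> assume a: "\<tau> \<in> coloured_bijections S (J - {i}) s c" "\<sigma> \<in> coloured_bijections S (J - {i}) s c"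
      "\<tau>(x := i) = \<sigma>(x := i)"
    have "\<tau> x = undefined" "\<sigma> x = undefined"
      using a insert.hyps by (auto simp: coloured_bijections_def PiE_def extensional_def)
    then show "\<tau> = \<sigma>" using a(3) by (auto simp: fun_eq_iff split: if_splits) metis
  qed
  have "card (coloured_bijections (insert x S) J s c) =
      (\<Sum>i\<in>{i\<in>J. s i = c x}. card ((\<lambda>\<tau>. \<tau>(x := i)) ` coloured_bijections S (J - {i}) s c))"
    unfolding coloured_bijections_insert[OF insert.hyps(2)]
  proof (rule card_UN_disjoint)
    show "\<forall>i\<in>{i \<in> J. s i = c x}. \<forall>j\<in>{i \<in> J. s i = c x}. i \<noteq> j \<longrightarrow>
       (\<lambda>\<tau>. \<tau>(x := i)) ` coloured_bijections S (J - {i}) s c \<inter>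
       (\<lambda>\<tau>. \<tau>(x := j)) ` coloured_bijections S (J - {j}) s c = {}"
    proof (intro ballI impI equals0I)
      fix i j \<rho> assume "i \<noteq> j"
        and "\<rho> \<in> (\<lambda>\<tau>. \<tau>(x := i)) ` coloured_bijections S (J - {i}) s c \<inter>
          (\<lambda>\<tau>. \<tau>(x := j)) ` coloured_bijections S (J - {j}) s c"
      then obtain \<tau> \<sigma> where "\<rho> = \<tau>(x := i)" "\<rho> = \<sigma>(x := j)" by blast
      then have "\<rho> x = i" "\<rho> x = j" by (metis fun_upd_same)+
      then show False using \<open>i \<noteq> j\<close> by simp
    qed
  qed (use fJ insert.hyps in \<open>auto intro!: finite_coloured_bijections\<close>)
  also have "\<dots> = (\<Sum>i\<in>{i\<in>J. s i = c x}. (\<Prod>l\<in>L. fact (card {j\<in>S. c j = l})))"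
    using card by (intro sum.cong refl) (simp add: card_image[OF inj])
  also have "\<dots> = card {i\<in>J. s i = c x} * (\<Prod>l\<in>L. fact (card {j\<in>S. c j = l}))" by simp
  also have "card {i\<in>J. s i = c x} = Suc (card {j\<in>S. c j = c x})"
    unfolding insert.prems(4) cx using insert.hyps by simp
  also have "Suc (card {j\<in>S. c j = c x}) * (\<Prod>l\<in>L. fact (card {j\<in>S. c j = l}))
      = (\<Prod>l\<in>L. fact (card {j\<in>insert x S. c j = l}))"
  proof -
    have cL: "c x \<in> L" using insert.prems by auto
    have "(\<Prod>l\<in>L - {c x}. fact (card {j\<in>insert x S. c j = l})) = (\<Prod>l\<in>L - {c x}. fact (card {j\<in>S. c j = l}) :: nat)"
      by (intro prod.cong refl) (use cl in auto)
    moreover have "fact (card {j\<in>insert x S. c j = c x}) = Suc (card {j\<in>S. c j = c x}) * fact (card {j\<in>S. c j = c x})"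
      unfolding cx using insert.hyps by simp
    ultimately show ?thesis
      unfolding prod.remove[OF \<open>finite L\<close> cL] by (simp only: mult.assoc)
  qed
  finally show ?case .
qed

lemma coloured_bijections_fibres:
  assumes "\<tau> \<in> coloured_bijections S J s c"
  shows "card {i\<in>J. s i = l} = card {j\<in>S. c j = l}"
proof -
  have "bij_betw \<tau> {j\<in>S. c j = l} {i\<in>J. s i = l}"
    using assms unfolding coloured_bijections_def bij_betw_def
    by (auto simp: inj_on_def)
  then show ?thesis by (simp add: bij_betw_same_card)
qed

text \<open>
The case of two colours, given by membership in \<open>I\<close> and by being less than \<open>n\<close>.
\<close>

lemma card_bijections_onto_prefix:
  fixes J :: "nat set"
  assumes J: "finite J" "card J = m" and I: "I \<subseteq> J" "card I = n"
  shows "card {\<tau> \<in> {..<m} \<rightarrow>\<^sub>E J. bij_betw \<tau> {..<m} J \<and> \<tau> ` {..<n} = I} = fact n * fact (m - n)"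
proof -
  have nm: "n \<le> m" using J I card_mono by blast
  have cI: "{j\<in>{..<m}. (j < n) = True} = {..<n}" "{j\<in>{..<m}. (j < n) = False} = {n..<m}" using nm by auto
  have eq: "{\<tau> \<in> {..<m} \<rightarrow>\<^sub>E J. bij_betw \<tau> {..<m} J \<and> \<tau> ` {..<n} = I}
      = coloured_bijections {..<m} J (\<lambda>i. i \<in> I) (\<lambda>j. j < n)"
  proof -
    have "\<tau> ` {..<n} = I \<longleftrightarrow> (\<forall>j\<in>{..<m}. (\<tau> j \<in> I) = (j < n))" if b: "bij_betw \<tau> {..<m} J" for \<tau>
    proof
      assume a: "\<tau> ` {..<n} = I"
      show "\<forall>j\<in>{..<m}. (\<tau> j \<in> I) = (j < n)"
      proof
        fix j assume j: "j \<in> {..<m}"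
        show "(\<tau> j \<in> I) = (j < n)"
          using inj_on_image_mem_iff[of \<tau> "{..<m}" j "{..<n}"] b j nm a by (auto simp: bij_betw_def)
      qed
    next
      assume a: "\<forall>j\<in>{..<m}. (\<tau> j \<in> I) = (j < n)"
      show "\<tau> ` {..<n} = I"
      proof (intro set_eqI iffI)
        fix i assume "i \<in> I"
        then obtain j where "j < m" "i = \<tau> j" using I(1) b by (auto simp: bij_betw_def)
        then show "i \<in> \<tau> ` {..<n}" using a \<open>i \<in> I\<close> by auto
      qed (use a nm in auto)
    qed
    then show ?thesis unfolding coloured_bijections_def by (intro Collect_cong conj_cong refl) auto
  qed
  have "card (coloured_bijections {..<m} J (\<lambda>i. i \<in> I) (\<lambda>j. j < n)) =
      (\<Prod>l\<in>UNIV. fact (card {j\<in>{..<m}. (j < n) = l}))"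
  proof (rule card_coloured_bijections)
    fix l :: bool
    have "{i\<in>J. (i \<in> I) = True} = I" "{i\<in>J. (i \<in> I) = False} = J - I" using I by auto
    moreover have "card (J - I) = m - n" using J I by (metis card_Diff_subset finite_subset)
    ultimately show "card {i\<in>J. (i \<in> I) = l} = card {j\<in>{..<m}. (j < n) = l}"
      by (cases l) (simp_all only: cI I card_lessThan card_atLeastLessThan)
  qed (use J in auto)
  also have "\<dots> = fact n * fact (m - n)" unfolding UNIV_bool by (simp add: cI[simplified] mult.commute)
  finally show ?thesis unfolding eq .
qed

section \<open>Ordered configurations of a Poisson process\<close>

definition labels_in :: "('w \<Rightarrow> enat) \<Rightarrow> (nat \<Rightarrow> 'w \<Rightarrow> 'a) \<Rightarrow> 'a set \<Rightarrow> 'w \<Rightarrow> nat set" where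
  "labels_in \<kappa> X B \<omega> = {n. enat n < \<kappa> \<omega> \<and> X n \<omega> \<in> B}"

text \<open>
A tuple lists \<open>m\<close> distinct labels of Poisson points. The labels of the points are an arbitrary
enumeration, whereas the sum over all orderings is determined by the point process.
\<close>

definition tuples :: "nat \<Rightarrow> (nat \<Rightarrow> nat) set" where
  "tuples m = {\<tau> \<in> {..<m} \<rightarrow>\<^sub>E UNIV. inj_on \<tau> {..<m}}"

definition tuple_points :: "(nat \<Rightarrow> 'w \<Rightarrow> 'a) \<Rightarrow> nat \<Rightarrow> (nat \<Rightarrow> nat) \<Rightarrow> 'w \<Rightarrow> nat \<Rightarrow> 'a" where
  "tuple_points X m \<tau> \<omega> = (\<lambda>j\<in>{..<m}. X (\<tau> j) \<omega>)"

lemma countable_tuples: "countable (tuples m)"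
  unfolding tuples_def by (rule countable_subset[OF _ countable_PiE[of "{..<m}" "\<lambda>_. UNIV"]]) auto

definition measure_on :: "'a measure \<Rightarrow> 'a set \<Rightarrow> 'a measure" where
  "measure_on lam B = density lam (indicator B)"

abbreviation power_on :: "'a measure \<Rightarrow> 'a set \<Rightarrow> nat \<Rightarrow> (nat \<Rightarrow> 'a) measure" where
  "power_on lam B n \<equiv> Pi\<^sub>M {..<n} (\<lambda>_. measure_on lam B)"

lemma space_measure_on[simp]: "space (measure_on lam B) = space lam"
  and sets_measure_on[simp, measurable_cong]: "sets (measure_on lam B) = sets lam"
  by (simp_all add: measure_on_def)

lemma emeasure_measure_on:
  "B \<in> sets lam \<Longrightarrow> S \<in> sets lam \<Longrightarrow> emeasure (measure_on lam B) S = emeasure lam (S \<inter> B)"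
  unfolding measure_on_def
  by (simp add: emeasure_density nn_integral_indicator' indicator_inter_arith[symmetric] Int_commute)

lemma finite_measure_measure_on:
  "B \<in> sets lam \<Longrightarrow> emeasure lam B < \<infinity> \<Longrightarrow> finite_measure (measure_on lam B)"
  by (rule finite_measureI) (simp add: emeasure_measure_on sets.Int_space_eq1)

locale poisson_input = prob_space M for M :: "'w measure" +
  fixes \<kappa> :: "'w \<Rightarrow> enat" and X :: "nat \<Rightarrow> 'w \<Rightarrow> 'a::{metric_space, second_countable_topology}"
    and lam :: "'a measure" and t :: real
  assumes kappa[measurable]: "\<kappa> \<in> measurable M (count_space UNIV)"
    and X[measurable]: "\<And>n. X n \<in> borel_measurable M"
    and poisson: "poisson_process M (point_process \<kappa> X) (scale_measure (ennreal t) lam)"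
    and t: "t > 0"
    and sets_lam[measurable_cong]: "sets lam = sets borel"
begin

abbreviation "indices \<equiv> labels_in \<kappa> X"

lemma space_lam[simp]: "space lam = UNIV"
  using sets_eq_imp_space_eq[OF sets_lam] by simp

lemma emeasure_point_process:
  assumes "D \<in> sets borel"
  shows "emeasure (point_process \<kappa> X \<omega>) D =
    (if finite (indices D \<omega>) then of_nat (card (indices D \<omega>)) else \<infinity>)"
proof -
  have "emeasure (point_process \<kappa> X \<omega>) D = emeasure (count_space {n. enat n < \<kappa> \<omega>}) (indices D \<omega>)"
    unfolding point_process_def using assms
    by (subst emeasure_distr) (auto intro!: arg_cong2[where f=emeasure] simp: labels_in_def)
  also have "indices D \<omega> \<subseteq> {n. enat n < \<kappa> \<omega>}" by (auto simp: labels_in_def)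
  then have "emeasure (count_space {n. enat n < \<kappa> \<omega>}) (indices D \<omega>) =
    (if finite (indices D \<omega>) then of_nat (card (indices D \<omega>)) else \<infinity>)"
    by (simp add: emeasure_count_space)
  finally show ?thesis .
qed

lemma pred_labels_in[measurable]:
  assumes [measurable]: "D \<in> sets borel"
  shows "Measurable.pred M (\<lambda>\<omega>. n \<in> indices D \<omega>)"
  unfolding labels_in_def mem_Collect_eq by measurable

lemma prob_counts:
  fixes D :: "nat \<Rightarrow> 'a set" and k :: "nat \<Rightarrow> nat"
  assumes D: "\<And>i. i < r \<Longrightarrow> D i \<in> sets borel" and disj: "disjoint_family_on D {..<r}"
    and fin: "\<And>i. i < r \<Longrightarrow> emeasure lam (D i) < \<infinity>"
  shows "prob {\<omega>\<in>space M. \<forall>i<r. finite (indices (D i) \<omega>) \<and> card (indices (D i) \<omega>) = k i}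
    = (\<Prod>i<r. exp (- (t * measure lam (D i))) * (t * measure lam (D i)) ^ k i / fact (k i))"
proof (cases "r = 0")
  case True then show ?thesis by (simp add: prob_space)
next
  case False
  let ?N = "\<lambda>i \<omega>. emeasure (point_process \<kappa> X \<omega>) (D i)"
  have N: "?N i \<omega> = of_nat (k i) \<longleftrightarrow> finite (indices (D i) \<omega>) \<and> card (indices (D i) \<omega>) = k i"
    if "i < r" for i \<omega>
    using D[OF that] by (auto simp: emeasure_point_process)
  have ind: "indep_vars (\<lambda>_. borel) ?N {..<r}"
    using poisson D disj unfolding poisson_process_def by blast
  have "{\<omega>\<in>space M. \<forall>i<r. finite (indices (D i) \<omega>) \<and> card (indices (D i) \<omega>) = k i}
      = (\<Inter>i\<in>{..<r}. ?N i -` {of_nat (k i)} \<inter> space M)"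
    using False N by auto
  also have "prob \<dots> = (\<Prod>i\<in>{..<r}. prob (?N i -` {of_nat (k i)} \<inter> space M))"
    using False by (intro indep_varsD_finite[OF ind]) auto
  also have "\<dots> = (\<Prod>i<r. exp (- (t * measure lam (D i))) * (t * measure lam (D i)) ^ k i / fact (k i))"
  proof (rule prod.cong[OF refl])
    fix i assume i: "i \<in> {..<r}"
    have "emeasure (scale_measure (ennreal t) lam) (D i) < \<infinity>"
      using fin[of i] i by (auto simp: ennreal_mult_less_top)
    then have "prob {\<omega>\<in>space M. ?N i \<omega> = of_nat (k i)} =
        exp (- measure (scale_measure (ennreal t) lam) (D i)) *
        measure (scale_measure (ennreal t) lam) (D i) ^ k i / fact (k i)"
      using poisson D[of i] i unfolding poisson_process_def by blast
    moreover have "?N i -` {of_nat (k i)} \<inter> space M = {\<omega>\<in>space M. ?N i \<omega> = of_nat (k i)}" by auto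
    moreover have "measure (scale_measure (ennreal t) lam) (D i) = t * measure lam (D i)"
      using t by (simp add: measure_def enn2real_mult)
    ultimately show "prob (?N i -` {of_nat (k i)} \<inter> space M) =
        exp (- (t * measure lam (D i))) * (t * measure lam (D i)) ^ k i / fact (k i)" by simp
  qed
  finally show ?thesis .
qed

text \<open>
The Poisson weights sum to \<open>1\<close>.
\<close>

lemma AE_finite_labels_in:
  assumes B[measurable]: "B \<in> sets borel" and fin: "emeasure lam B < \<infinity>"
  shows "AE \<omega> in M. finite (indices B \<omega>)"
proof -
  let ?E = "\<lambda>k. {\<omega>\<in>space M. finite (indices B \<omega>) \<and> card (indices B \<omega>) = k}"
  define a where "a = t * measure lam B"
  have p: "prob (?E k) = exp (-a) * (a ^ k / fact k)" for k
    using prob_counts[of 1 "\<lambda>_. B" "\<lambda>_. k"] fin by (simp add: disjoint_family_on_def a_def)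
  have "(\<lambda>k. prob (?E k)) sums prob (\<Union>k. ?E k)"
    by (intro finite_measure_UNION) (auto simp: disjoint_family_on_def)
  moreover have "(\<lambda>k. prob (?E k)) sums (exp (-a) * exp a)"
    unfolding p using exp_converges[of a] by (intro sums_mult) (simp add: field_simps)
  ultimately have "prob (\<Union>k. ?E k) = 1" by (simp add: exp_minus sums_iff)
  then have "AE \<omega> in M. \<omega> \<in> (\<Union>k. ?E k)" by (subst AE_in_set_eq_1) auto
  then show ?thesis by auto
qed

text \<open>
The expected number of orderings of the points in \<open>B\<close>, as a measure on their positions, restricted to
the event that there are exactly \<open>m\<close> points in \<open>B\<close>.
\<close>

definition tuple_measure :: "'a set \<Rightarrow> nat \<Rightarrow> (nat \<Rightarrow> 'a) measure" where
  "tuple_measure B m = distr (density (count_space (tuples m) \<Otimes>\<^sub>M M)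
       (indicator {(\<tau>, \<omega>). indices B \<omega> = \<tau> ` {..<m}}))
     (Pi\<^sub>M {..<m} (\<lambda>_. borel)) (\<lambda>(\<tau>, \<omega>). tuple_points X m \<tau> \<omega>)"

lemma sets_tuple_measure[simp, measurable_cong]: "sets (tuple_measure B m) = sets (Pi\<^sub>M {..<m} (\<lambda>_. borel))"
  by (simp add: tuple_measure_def)

lemma tuple_points_measurable[measurable]: "tuple_points X m \<tau> \<in> measurable M (Pi\<^sub>M {..<m} (\<lambda>_. borel))"
  unfolding tuple_points_def[abs_def] by measurable

lemma pred_labels_in_eq[measurable]:
  assumes [measurable]: "B \<in> sets borel"
  shows "Measurable.pred M (\<lambda>\<omega>. indices B \<omega> = S)"
  unfolding set_eq_iff by measurable

lemma
  assumes B[measurable]: "B \<in> sets borel" and h[measurable]: "h \<in> borel_measurable (Pi\<^sub>M {..<m} (\<lambda>_. borel))"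
  shows nn_integral_tuple_measure: "(\<integral>\<^sup>+x. h x \<partial>tuple_measure B m) =
      (\<integral>\<^sup>+\<tau>. (\<integral>\<^sup>+\<omega>. indicator {\<omega>. indices B \<omega> = \<tau> ` {..<m}} \<omega> * h (tuple_points X m \<tau> \<omega>) \<partial>M) \<partial>count_space (tuples m))"
    (is ?A)
    and nn_integral_tuple_measure': "(\<integral>\<^sup>+x. h x \<partial>tuple_measure B m) =
      (\<integral>\<^sup>+\<omega>. (\<integral>\<^sup>+\<tau>. indicator {\<omega>. indices B \<omega> = \<tau> ` {..<m}} \<omega> * h (tuple_points X m \<tau> \<omega>) \<partial>count_space (tuples m)) \<partial>M)"
    (is ?B)
proof -
  interpret T: sigma_finite_measure "count_space (tuples m)"
    by (rule sigma_finite_measure_count_space_countable[OF countable_tuples])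
  interpret TM: pair_sigma_finite "count_space (tuples m)" M ..
  have [measurable]: "(\<lambda>(\<tau>, \<omega>). tuple_points X m \<tau> \<omega>) \<in> measurable (count_space (tuples m) \<Otimes>\<^sub>M M) (Pi\<^sub>M {..<m} (\<lambda>_. borel))"
    by (rule measurable_pair_measure_countable1[OF countable_tuples]) simp
  have ind: "(indicator {(\<tau>, \<omega>). indices B \<omega> = \<tau> ` {..<m}} :: _ \<Rightarrow> ennreal) \<in> borel_measurable (count_space (tuples m) \<Otimes>\<^sub>M M)"
  proof (rule measurable_pair_measure_countable1[OF countable_tuples])
    fix \<tau> :: "nat \<Rightarrow> nat"
    have "(\<lambda>\<omega>. indicator {\<omega>. indices B \<omega> = \<tau> ` {..<m}} \<omega> :: ennreal) \<in> borel_measurable M" by measurable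
    then show "(\<lambda>\<omega>. indicator {(\<tau>, \<omega>). indices B \<omega> = \<tau> ` {..<m}} (\<tau>, \<omega>) :: ennreal) \<in> borel_measurable M"
      by (simp add: indicator_def)
  qed
  note ind[measurable]
  have "(\<integral>\<^sup>+x. h x \<partial>tuple_measure B m) = (\<integral>\<^sup>+p. indicator {(\<tau>, \<omega>). indices B \<omega> = \<tau> ` {..<m}} p *
      h (case p of (\<tau>, \<omega>) \<Rightarrow> tuple_points X m \<tau> \<omega>) \<partial>(count_space (tuples m) \<Otimes>\<^sub>M M))"
    unfolding tuple_measure_def by (subst nn_integral_distr, simp, simp) (subst nn_integral_density, simp_all)
  note eq = this
  have meas: "(\<lambda>p. indicator {(\<tau>, \<omega>). indices B \<omega> = \<tau> ` {..<m}} p *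
      h (case p of (\<tau>, \<omega>) \<Rightarrow> tuple_points X m \<tau> \<omega>)) \<in> borel_measurable (count_space (tuples m) \<Otimes>\<^sub>M M)"
    by measurable
  show ?A unfolding eq by (subst nn_integral_fst[OF meas, symmetric]) (auto intro!: nn_integral_cong simp: indicator_def)
  show ?B unfolding eq by (subst TM.nn_integral_snd[OF meas, symmetric]) (auto intro!: nn_integral_cong simp: indicator_def)
qed

text \<open>
If \<open>k\<^sub>l\<close> of the prescribed cells are equal to the \<open>l\<close>-th cell of the partition, then the points can be
listed accordingly only if the \<open>l\<close>-th cell contains exactly \<open>k\<^sub>l\<close> points for every \<open>l\<close>, and then in
\<open>\<Prod>\<^sub>l k\<^sub>l!\<close> ways. These factorials cancel those of the independent Poisson counts.
\<close>

lemma tuple_measure_cell: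
  fixes s :: "'a \<Rightarrow> nat"
  assumes B[measurable]: "B \<in> sets borel" and fin: "emeasure lam B < \<infinity>"
    and s[measurable]: "s \<in> measurable borel (count_space UNIV)" and sr: "\<And>x. s x < r"
    and c: "\<And>j. j < m \<Longrightarrow> c j < r"
  shows "emeasure (tuple_measure B m) {x\<in>space (Pi\<^sub>M {..<m} (\<lambda>_. borel)). \<forall>j<m. s (x j) = c j} =
    ennreal (exp (- (t * measure lam B)) * t ^ m * (\<Prod>j<m. measure lam (B \<inter> s -` {c j})))"
proof -
  let ?C = "{x\<in>space (Pi\<^sub>M {..<m} (\<lambda>_. borel)). \<forall>j<m. s (x j) = c j}"
  define D where "D l = B \<inter> s -` {l}" for l
  define k where "k l = card {j\<in>{..<m}. c j = l}" for l
  let ?E = "{\<omega>\<in>space M. \<forall>l<r. finite (indices (D l) \<omega>) \<and> card (indices (D l) \<omega>) = k l}"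
  have D[measurable]: "D l \<in> sets borel" for l
    unfolding D_def using measurable_sets[OF s, of "{l}"] by auto
  have Dfin: "emeasure lam (D l) < \<infinity>" for l
    using emeasure_mono[of "D l" B lam] fin sets_lam B by (auto simp: D_def top.not_eq_extremum le_less_trans)
  have C[measurable]: "?C \<in> sets (Pi\<^sub>M {..<m} (\<lambda>_. borel))" by measurable
  have count: "(\<integral>\<^sup>+\<tau>. indicator {\<omega>. indices B \<omega> = \<tau> ` {..<m}} \<omega> * indicator ?C (tuple_points X m \<tau> \<omega>) \<partial>count_space (tuples m))
      = ennreal (\<Prod>l<r. fact (k l)) * indicator ?E \<omega>" if \<omega>: "\<omega> \<in> space M" for \<omega>
  proof -
    let ?J = "indices B \<omega>"
    let ?K = "coloured_bijections {..<m} ?J (\<lambda>i. s (X i \<omega>)) c"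
    have "tuple_points X m \<tau> \<omega> \<in> ?C \<longleftrightarrow> (\<forall>j<m. s (X (\<tau> j) \<omega>) = c j)" for \<tau>
      by (auto simp: tuple_points_def space_PiM)
    then have K: "{\<tau>\<in>tuples m. ?J = \<tau> ` {..<m} \<and> tuple_points X m \<tau> \<omega> \<in> ?C} = ?K"
      unfolding coloured_bijections_def tuples_def bij_betw_def by (auto simp: PiE_def)
    have "(\<integral>\<^sup>+\<tau>. indicator {\<omega>. indices B \<omega> = \<tau> ` {..<m}} \<omega> * indicator ?C (tuple_points X m \<tau> \<omega>) \<partial>count_space (tuples m))
        = (\<integral>\<^sup>+\<tau>. indicator ?K \<tau> \<partial>count_space (tuples m))"
      unfolding K[symmetric] by (intro nn_integral_cong) (auto simp: indicator_def)
    also have "\<dots> = emeasure (count_space (tuples m)) ?K"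
      using K by (intro nn_integral_indicator) auto
    finally have 1: "(\<integral>\<^sup>+\<tau>. indicator {\<omega>. indices B \<omega> = \<tau> ` {..<m}} \<omega> * indicator ?C (tuple_points X m \<tau> \<omega>) \<partial>count_space (tuples m))
        = emeasure (count_space (tuples m)) ?K" .
    have Jl: "{i\<in>?J. s (X i \<omega>) = l} = indices (D l) \<omega>" for l by (auto simp: labels_in_def D_def)
    have JU: "?J = (\<Union>l<r. indices (D l) \<omega>)" using sr by (auto simp: labels_in_def D_def)
    show ?thesis
    proof (cases "\<omega> \<in> ?E")
      case True
      then have J: "finite ?J" unfolding JU by auto
      have "card ?K = (\<Prod>l<r. fact (card {j\<in>{..<m}. c j = l}))"
      proof (rule card_coloured_bijections[OF _ _ _ J])
        show "c ` {..<m} \<subseteq> {..<r}" using c by auto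
        fix l
        show "card {i\<in>?J. s (X i \<omega>) = l} = card {j\<in>{..<m}. c j = l}"
        proof (cases "l < r")
          case True
          then show ?thesis using \<open>\<omega> \<in> ?E\<close> unfolding Jl k_def by auto
        next
          case False
          then have "{i\<in>?J. s (X i \<omega>) = l} = {}" "{j\<in>{..<m}. c j = l} = {}" using sr c by fastforce+
          then show ?thesis by (simp only: card.empty)
        qed
      qed auto
      moreover have "?K \<subseteq> tuples m" using K by blast
      ultimately show ?thesis
        unfolding 1 using True finite_coloured_bijections[OF _ J, of "{..<m}"]
        by (simp add: emeasure_count_space k_def ennreal_of_nat_eq_real_of_nat)
    next
      case False
      have "?K = {}"
      proof (rule equals0I)
        fix \<tau> assume \<tau>: "\<tau> \<in> ?K"
        then have J: "finite ?J" unfolding coloured_bijections_def by (auto dest: bij_betw_finite)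
        then have "finite (indices (D l) \<omega>)" for l
          by (rule finite_subset[rotated]) (auto simp: labels_in_def D_def)
        then have "\<omega> \<in> ?E" using \<omega> coloured_bijections_fibres[OF \<tau>] by (auto simp: Jl k_def)
        then show False using False by simp
      qed
      then show ?thesis unfolding 1 using False by simp
    qed
  qed
  have "emeasure (tuple_measure B m) ?C = (\<integral>\<^sup>+x. indicator ?C x \<partial>tuple_measure B m)"
    by (intro nn_integral_indicator[symmetric]) simp
  also have "\<dots> = (\<integral>\<^sup>+\<omega>. ennreal (\<Prod>l<r. fact (k l)) * indicator ?E \<omega> \<partial>M)"
    by (subst nn_integral_tuple_measure'[OF B]) (auto intro!: nn_integral_cong count)
  also have "\<dots> = ennreal (\<Prod>l<r. fact (k l)) * ennreal (prob ?E)"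
    by (subst nn_integral_cmult_indicator) (auto simp: emeasure_eq_measure)
  also have "prob ?E = (\<Prod>l<r. exp (- (t * measure lam (D l))) * (t * measure lam (D l)) ^ k l / fact (k l))"
  proof (rule prob_counts)
    show "disjoint_family_on D {..<r}" by (auto simp: disjoint_family_on_def D_def)
  qed (rule D Dfin)+
  also have "ennreal (\<Prod>l<r. fact (k l)) * ennreal \<dots> = ennreal (\<Prod>l<r. exp (- (t * measure lam (D l))) * (t * measure lam (D l)) ^ k l)"
    using t by (subst ennreal_mult[symmetric]) (auto intro!: prod_nonneg simp: prod.distrib[symmetric])
  also have "(\<Prod>l<r. exp (- (t * measure lam (D l))) * (t * measure lam (D l)) ^ k l) =
      exp (- (t * (\<Sum>l<r. measure lam (D l)))) * (\<Prod>l<r. (t * measure lam (D l)) ^ k l)"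
    by (simp add: prod.distrib exp_sum sum_distrib_left sum_negf[symmetric])
  also have "(\<Sum>l<r. measure lam (D l)) = measure lam B"
  proof -
    have "measure lam B = measure lam (\<Union>l\<in>{..<r}. D l)" using sr by (intro arg_cong[where f="measure lam"]) (auto simp: D_def)
    also have "\<dots> = (\<Sum>l<r. measure lam (D l))"
    proof (rule measure_finite_Union)
      show "D ` {..<r} \<subseteq> sets lam" unfolding sets_lam using D by blast
      show "disjoint_family_on D {..<r}" by (auto simp: disjoint_family_on_def D_def)
      show "emeasure lam (D l) \<noteq> \<infinity>" for l by (rule less_imp_neq[OF Dfin])
    qed (rule finite_lessThan)
    finally show ?thesis by simp
  qed
  also have "(\<Prod>l<r. (t * measure lam (D l)) ^ k l) = (\<Prod>j<m. t * measure lam (D (c j)))"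
  proof -
    have "(\<Prod>j<m. t * measure lam (D (c j))) = (\<Prod>l<r. \<Prod>j\<in>{j. j \<in> {..<m} \<and> c j = l}. t * measure lam (D (c j)))"
      by (rule prod.group[symmetric]) (use c in auto)
    also have "\<dots> = (\<Prod>l<r. (t * measure lam (D l)) ^ k l)" by (intro prod.cong refl) (simp add: k_def)
    finally show ?thesis by simp
  qed
  also have "exp (- (t * measure lam B)) * (\<Prod>j<m. t * measure lam (D (c j))) =
     exp (- (t * measure lam B)) * t ^ m * (\<Prod>j<m. measure lam (B \<inter> s -` {c j}))"
    by (simp add: D_def prod.distrib)
  finally show ?thesis .
qed

text \<open>
A product set with sides \<open>A\<^sub>j\<close> is a finite disjoint union of products of cells of the partition that
is generated by the sides. A cell is encoded by the set of those \<open>j\<close> whose \<open>A\<^sub>j\<close> contains it.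
\<close>

lemma tuple_measure_eq:
  assumes B[measurable]: "B \<in> sets borel" and fin: "emeasure lam B < \<infinity>"
  shows "tuple_measure B m = scale_measure (ennreal (exp (- (t * measure lam B)) * t ^ m))
    (power_on lam B m)"
proof -
  interpret R: finite_measure "measure_on lam B"
    using finite_measure_measure_on[OF _ fin] by (simp add: sets_lam)
  interpret P: product_sigma_finite "\<lambda>_::nat. measure_on lam B" ..
  let ?Q = "scale_measure (ennreal (exp (- (t * measure lam B)) * t ^ m)) (power_on lam B m)"
  have sets_eq: "sets (power_on lam B m) = sets (Pi\<^sub>M {..<m} (\<lambda>_. borel))"
    by (intro sets_PiM_cong) (auto simp: sets_lam)
  have cell: "emeasure (tuple_measure B m) {x\<in>space (Pi\<^sub>M {..<m} (\<lambda>_. borel)). \<forall>j<m. s (x j) = c j} =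
      emeasure ?Q {x\<in>space (Pi\<^sub>M {..<m} (\<lambda>_. borel)). \<forall>j<m. s (x j) = c j}"
    if s[measurable]: "s \<in> measurable borel (count_space UNIV)" and sr: "\<And>x. s x < r"
    and c: "\<And>j. j < m \<Longrightarrow> c j < r" for s :: "'a \<Rightarrow> nat" and r c
  proof -
    have sm: "s -` {l} \<in> sets borel" for l using measurable_sets[OF s, of "{l}"] by simp
    have "{x\<in>space (Pi\<^sub>M {..<m} (\<lambda>_. borel :: 'a measure)). \<forall>j<m. s (x j) = c j} = Pi\<^sub>E {..<m} (\<lambda>j. s -` {c j})"
      by (auto simp: space_PiM PiE_def Pi_def)
    then have "emeasure (power_on lam B m) {x\<in>space (Pi\<^sub>M {..<m} (\<lambda>_. borel)). \<forall>j<m. s (x j) = c j}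
        = (\<Prod>j<m. emeasure (measure_on lam B) (s -` {c j}))"
      using sm by (simp add: P.emeasure_PiM sets_lam)
    also have "\<dots> = (\<Prod>j<m. ennreal (measure lam (B \<inter> s -` {c j})))"
    proof (rule prod.cong[OF refl])
      fix j
      have "emeasure lam (B \<inter> s -` {c j}) < \<infinity>"
        using emeasure_mono[of "B \<inter> s -` {c j}" B lam] fin sets_lam B by (auto intro: le_less_trans)
      then show "emeasure (measure_on lam B) (s -` {c j}) = ennreal (measure lam (B \<inter> s -` {c j}))"
        using sm by (subst emeasure_measure_on) (auto simp: sets_lam Int_commute emeasure_eq_ennreal_measure less_top)
    qed
    also have "\<dots> = ennreal (\<Prod>j<m. measure lam (B \<inter> s -` {c j}))"
      by (simp add: prod_ennreal)
    finally have "emeasure ?Q {x\<in>space (Pi\<^sub>M {..<m} (\<lambda>_. borel)). \<forall>j<m. s (x j) = c j} =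
        ennreal (exp (- (t * measure lam B)) * t ^ m) * ennreal (\<Prod>j<m. measure lam (B \<inter> s -` {c j}))"
      by simp
    also have "\<dots> = ennreal (exp (- (t * measure lam B)) * t ^ m * (\<Prod>j<m. measure lam (B \<inter> s -` {c j})))"
      using t by (intro ennreal_mult[symmetric] prod_nonneg) auto
    finally show ?thesis
      by (subst tuple_measure_cell[OF B fin s, of r]) (use sr c in auto)
  qed
  show ?thesis
  proof (rule measure_eqI_PiM_finite[where I="{..<m}" and M="\<lambda>_. borel"])
    show "sets ?Q = sets (Pi\<^sub>M {..<m} (\<lambda>_. borel))" using sets_eq by simp
    have rect: "emeasure (tuple_measure B m) (Pi\<^sub>E {..<m} A) = emeasure ?Q (Pi\<^sub>E {..<m} A)"
      if A: "\<And>i. i \<in> {..<m} \<Longrightarrow> A i \<in> sets borel" for A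
    proof -
      define s where "s x = set_encode {j\<in>{..<m}. x \<in> A j}" for x
      define r where "r = Suc (set_encode {..<m})"
      define Cs where "Cs = {..<m} \<rightarrow>\<^sub>E {..<r}"
      \<comment> \<open>The products of cells that are contained in the given product set.\<close>
      define good where "good c \<longleftrightarrow> (\<forall>j<m. j \<in> set_decode (c j))" for c
      let ?cell = "\<lambda>c. {x\<in>space (Pi\<^sub>M {..<m} (\<lambda>_. borel)). \<forall>j<m. s (x j) = c j}"
      have sr: "s x < r" for x
        unfolding s_def r_def by (intro le_imp_less_Suc subset_decode_imp_le) auto
      have "s x = (\<Sum>j<m. if x \<in> A j then 2 ^ j else 0)" for x
        unfolding s_def set_encode_def by (rule sum.inter_filter) simp
      moreover have "(\<lambda>x. \<Sum>j<m. if x \<in> A j then 2 ^ j else 0 :: nat) \<in> measurable borel (count_space UNIV)"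
        using A by (intro measurable_sum_nat measurable_If measurable_const) auto
      ultimately have s: "s \<in> measurable borel (count_space UNIV)" by (simp add: s_def[abs_def])
      have cell_sets: "?cell c \<in> sets (Pi\<^sub>M {..<m} (\<lambda>_. borel))" for c using s by measurable
      have dec: "j \<in> set_decode (s x) \<longleftrightarrow> x \<in> A j" if "j < m" for j x
        unfolding s_def using that by (subst set_encode_inverse) auto
      have finCs: "finite {c\<in>Cs. good c}" unfolding Cs_def by (intro finite_subset[OF _ finite_PiE[of "{..<m}" "\<lambda>_. {..<r}"]]) auto
      have U: "Pi\<^sub>E {..<m} A = (\<Union>c\<in>{c\<in>Cs. good c}. ?cell c)"
      proof (intro set_eqI iffI)
        fix x assume x: "x \<in> Pi\<^sub>E {..<m} A"
        let ?c = "\<lambda>j\<in>{..<m}. s (x j)"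
        have "?c \<in> Cs" using sr by (auto simp: Cs_def)
        moreover have "good ?c" using x dec by (auto simp: good_def)
        moreover have "x \<in> ?cell ?c" using x by (auto simp: space_PiM PiE_def)
        ultimately show "x \<in> (\<Union>c\<in>{c\<in>Cs. good c}. ?cell c)" by blast
      next
        fix x assume "x \<in> (\<Union>c\<in>{c\<in>Cs. good c}. ?cell c)"
        then obtain c where "good c" and x: "x \<in> ?cell c" by auto
        then have "x j \<in> A j" if "j < m" for j using that dec[of j "x j"] by (auto simp: good_def)
        then show "x \<in> Pi\<^sub>E {..<m} A" using x by (auto simp: space_PiM PiE_def)
      qed
      have disj: "disjoint_family_on ?cell {c\<in>Cs. good c}"
        unfolding disjoint_family_on_def Cs_def by (auto simp: PiE_def extensional_def fun_eq_iff) metis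
      have cell_sub: "?cell ` {c\<in>Cs. good c} \<subseteq> sets (Pi\<^sub>M {..<m} (\<lambda>_. borel))"
        by (rule image_subsetI) (rule cell_sets)
      have "emeasure (tuple_measure B m) (Pi\<^sub>E {..<m} A) = (\<Sum>c\<in>{c\<in>Cs. good c}. emeasure (tuple_measure B m) (?cell c))"
        unfolding U by (rule sum_emeasure[OF _ disj finCs, symmetric])
          (simp only: sets_tuple_measure cell_sub)
      also have "\<dots> = (\<Sum>c\<in>{c\<in>Cs. good c}. emeasure ?Q (?cell c))"
        by (intro sum.cong refl cell[OF s sr]) (auto simp: Cs_def)
      also have "\<dots> = emeasure ?Q (Pi\<^sub>E {..<m} A)"
        unfolding U by (rule sum_emeasure[OF _ disj finCs]) (simp only: sets_scale_measure sets_eq cell_sub)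
      finally show ?thesis .
    qed
    show "emeasure (tuple_measure B m) (Pi\<^sub>E {..<m} A) = emeasure ?Q (Pi\<^sub>E {..<m} A)"
      if "\<And>i. i \<in> {..<m} \<Longrightarrow> A i \<in> sets borel" for A by (rule rect[OF that])
    show "range (\<lambda>_::nat. Pi\<^sub>E {..<m} (\<lambda>_. UNIV)) \<subseteq> prod_algebra {..<m} (\<lambda>_. borel)"
      by (auto intro!: prod_algebraI_finite)
    have "emeasure ?Q (Pi\<^sub>E {..<m} (\<lambda>_. UNIV)) \<noteq> \<infinity>"
      using R.emeasure_finite by (simp add: P.emeasure_PiM sets_lam ennreal_mult_eq_top_iff power_eq_top_ennreal)
    then show "emeasure (tuple_measure B m) (Pi\<^sub>E {..<m} (\<lambda>_. UNIV)) \<noteq> \<infinity>" by (subst rect) auto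
  qed (auto simp: space_PiM)
qed

end

section \<open>Components and independent edges\<close>

definition component :: "'v set \<Rightarrow> ('v \<Rightarrow> 'v \<Rightarrow> bool) \<Rightarrow> 'v \<Rightarrow> 'v set" where
  "component V e r = {j. (r, j) \<in> {(i, j). i \<in> V \<and> j \<in> V \<and> e i j}\<^sup>*}"

lemma root_in_component[simp]: "r \<in> component V e r"
  by (simp add: component_def)

lemma component_step: "i \<in> component V e r \<Longrightarrow> i \<in> V \<Longrightarrow> j \<in> V \<Longrightarrow> e i j \<Longrightarrow> j \<in> component V e r"
  unfolding component_def by (auto intro: rtrancl_into_rtrancl)

lemma component_induct[consumes 1, case_names root step]:
  assumes "j \<in> component V e r" "P r"
    and "\<And>i j. i \<in> component V e r \<Longrightarrow> P i \<Longrightarrow> i \<in> V \<Longrightarrow> j \<in> V \<Longrightarrow> e i j \<Longrightarrow> P j"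
  shows "P j"
proof -
  have "(r, j) \<in> {(i, j). i \<in> V \<and> j \<in> V \<and> e i j}\<^sup>*" using assms(1) by (simp add: component_def)
  then show ?thesis
    by (induction rule: rtrancl_induct) (auto intro: assms(2,3) simp: component_def)
qed

lemma component_subset: "r \<in> V \<Longrightarrow> component V e r \<subseteq> V"
proof
  fix j assume "j \<in> component V e r" "r \<in> V"
  then show "j \<in> V" by (induction rule: component_induct) auto
qed

lemma component_mono: "V \<subseteq> W \<Longrightarrow> component V e r \<subseteq> component W e r"
proof
  fix j assume "j \<in> component V e r" "V \<subseteq> W"
  then show "j \<in> component W e r"
    by (induction rule: component_induct) (auto intro: component_step)
qed

lemma component_cong:
  assumes "\<And>i j. i \<in> V \<Longrightarrow> j \<in> V \<Longrightarrow> e i j = e' i j"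
  shows "component V e r = component V e' r"
  unfolding component_def by (intro Collect_cong arg_cong2[where f="(\<in>)"] refl arg_cong[where f=rtrancl]) (use assms in auto)

text \<open>
This separates the two conditions for a cluster: it is connected by its own edges, and it has no edge to
the outside. The two conditions concern disjoint sets of edges.
\<close>

lemma component_eq_iff:
  assumes "r \<in> I" "I \<subseteq> V"
  shows "component V e r = I \<longleftrightarrow> component I e r = I \<and> (\<forall>i\<in>I. \<forall>j\<in>V - I. \<not> e i j)"
proof
  assume L: "component V e r = I"
  have "j \<in> component I e r" if "j \<in> component V e r" for j
    using that by (induction rule: component_induct) (use L in \<open>auto intro: component_step\<close>)
  then have "component I e r = I" using L component_subset[OF assms(1), of e] by blast
  moreover have "\<forall>i\<in>I. \<forall>j\<in>V - I. \<not> e i j"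
    using L assms component_step[of _ V e r] by blast
  ultimately show "component I e r = I \<and> (\<forall>i\<in>I. \<forall>j\<in>V - I. \<not> e i j)" by blast
next
  assume R: "component I e r = I \<and> (\<forall>i\<in>I. \<forall>j\<in>V - I. \<not> e i j)"
  have "j \<in> I" if "j \<in> component V e r" for j
    using that by (induction rule: component_induct) (use R assms in auto)
  then show "component V e r = I" using R component_mono[OF assms(2), of e r] by blast
qed

lemma component_image:
  assumes "r \<in> V"
  shows "component (f ` V) e (f r) = f ` component V (\<lambda>i j. e (f i) (f j)) r"
proof (intro set_eqI iffI)
  fix j assume "j \<in> component (f ` V) e (f r)"
  then show "j \<in> f ` component V (\<lambda>i j. e (f i) (f j)) r"
  proof (induction rule: component_induct)
    case (step i j)
    then obtain i' j' where i': "i' \<in> component V (\<lambda>i j. e (f i) (f j)) r" "i = f i'"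
      and j': "j' \<in> V" "j = f j'" by auto
    have "i' \<in> V" using i' component_subset[OF assms] by blast
    then have "j' \<in> component V (\<lambda>i j. e (f i) (f j)) r"
      using component_step[OF i'(1) _ j'(1)] step.hyps(4) unfolding i'(2) j'(2) by blast
    then show ?case using j' by blast
  qed auto
next
  fix j assume "j \<in> f ` component V (\<lambda>i j. e (f i) (f j)) r"
  then obtain k where k: "k \<in> component V (\<lambda>i j. e (f i) (f j)) r" "j = f k" by auto
  from k(1) have "f k \<in> component (f ` V) e (f r)"
    by (induction rule: component_induct) (auto intro: component_step)
  then show "j \<in> component (f ` V) e (f r)" using k by simp
qed

lemma component_image_eq_iff:
  assumes "inj_on f V" "r \<in> V"
  shows "component (f ` V) e (f r) = f ` V \<longleftrightarrow> component V (\<lambda>i j. e (f i) (f j)) r = V"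
  unfolding component_image[OF assms(2)]
  using inj_on_image_eq_iff[OF assms(1) component_subset[OF assms(2)] order_refl] by blast

lemma pred_rtrancl:
  fixes R :: "'w \<Rightarrow> (nat \<times> nat) set"
  assumes R: "\<And>i j. Measurable.pred M (\<lambda>x. (i, j) \<in> R x)"
  shows "Measurable.pred M (\<lambda>x. (a, b) \<in> (R x)\<^sup>*)"
proof -
  have pow: "Measurable.pred M (\<lambda>x. (a, b) \<in> (R x) ^^ k)" for k b
  proof (induction k arbitrary: b)
    case (Suc k)
    note Suc[measurable] R[measurable]
    have "(\<lambda>x. (a, b) \<in> (R x) ^^ Suc k) = (\<lambda>x. \<exists>c. (a, c) \<in> (R x) ^^ k \<and> (c, b) \<in> R x)"
      by (auto simp: fun_eq_iff)
    then show ?case by simp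
  qed simp
  note pow[measurable]
  have "(\<lambda>x. (a, b) \<in> (R x)\<^sup>*) = (\<lambda>x. \<exists>k. (a, b) \<in> (R x) ^^ k)"
    by (auto simp: fun_eq_iff rtrancl_power)
  then show ?thesis by simp
qed

lemma pred_component:
  fixes V :: "'w \<Rightarrow> nat set"
  assumes [measurable]: "\<And>i. Measurable.pred M (\<lambda>x. i \<in> V x)"
    and e: "\<And>i j. Measurable.pred M (\<lambda>x. i \<in> V x \<and> j \<in> V x \<and> e x i j)"
  shows "Measurable.pred M (\<lambda>x. j \<in> component (V x) (e x) r)"
  unfolding component_def mem_Collect_eq by (intro pred_rtrancl) (simp add: e)

text \<open>
An edge \<open>{i, j}\<close> of the relabelled graph carries the mark at \<open>(min i j, max i j)\<close>, so that the marks
form a product measure over a finite set of pairs.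
\<close>

definition ordered_pairs :: "nat \<Rightarrow> (nat \<times> nat) set" where
  "ordered_pairs n = {(i, j). i < j \<and> j \<le> n}"

lemma finite_ordered_pairs[simp]: "finite (ordered_pairs n)"
  by (rule finite_subset[of _ "{..n} \<times> {..n}"]) (auto simp: ordered_pairs_def)

definition edge :: "('a \<Rightarrow> 'a \<Rightarrow> real) \<Rightarrow> (nat \<Rightarrow> 'a) \<Rightarrow> (nat \<times> nat \<Rightarrow> real) \<Rightarrow> nat \<Rightarrow> nat \<Rightarrow> bool" where
  "edge \<phi> y u i j \<longleftrightarrow> i \<noteq> j \<and> u (min i j, max i j) \<le> \<phi> (y i) (y j)"

abbreviation unif :: "real measure" where "unif \<equiv> uniform_measure lborel {0..1}"

lemma prob_space_unif: "prob_space unif" by (rule prob_space_uniform_measure) auto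

lemma unif_component:
  assumes "p \<in> I" shows "(\<lambda>u. u p) \<in> borel_measurable (Pi\<^sub>M I (\<lambda>_. unif))"
proof -
  have "(\<lambda>u. u p) \<in> measurable (Pi\<^sub>M I (\<lambda>_. unif)) unif"
    using assms by (rule measurable_component_singleton)
  also have "measurable (Pi\<^sub>M I (\<lambda>_. unif)) unif = borel_measurable (Pi\<^sub>M I (\<lambda>_. unif))"
    by (intro measurable_cong_sets) auto
  finally show ?thesis .
qed

lemma emeasure_unif_greater:
  assumes "0 \<le> a" "a \<le> 1" shows "emeasure unif {a<..} = ennreal (1 - a)"
proof -
  have "{0..1} \<inter> {a<..} = {a<..1}" using assms by auto
  then show ?thesis using assms by (simp add: divide_ennreal_def)
qed

text \<open>
The probability that the random graph on the points \<open>y 0, \<dots>, y n\<close> is connected.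
\<close>

definition connection_prob :: "('a::{metric_space, second_countable_topology} \<Rightarrow> 'a \<Rightarrow> real) \<Rightarrow> nat \<Rightarrow> (nat \<Rightarrow> 'a) \<Rightarrow> ennreal" where
  "connection_prob \<phi> n y = (\<integral>\<^sup>+u. indicator {u. component {..n} (edge \<phi> y u) 0 = {..n}} u \<partial>Pi\<^sub>M (ordered_pairs n) (\<lambda>_. unif))"

definition avoid_prob :: "('a \<Rightarrow> 'a \<Rightarrow> real) \<Rightarrow> nat \<Rightarrow> (nat \<Rightarrow> 'a) \<Rightarrow> 'a \<Rightarrow> ennreal" where
  "avoid_prob \<phi> n y z = (\<Prod>i\<le>n. ennreal (1 - \<phi> (y i) z))"

locale connection =
  fixes \<phi> :: "'a::{metric_space, second_countable_topology} \<Rightarrow> 'a \<Rightarrow> real"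
  assumes phi: "(\<lambda>(x, z). \<phi> x z) \<in> borel_measurable borel"
    and phi_range: "\<And>x z. 0 \<le> \<phi> x z \<and> \<phi> x z \<le> 1"
begin

lemma phi_comp[measurable (raw)]:
  assumes [measurable]: "f \<in> borel_measurable N" "g \<in> borel_measurable N"
  shows "(\<lambda>x. \<phi> (f x) (g x)) \<in> borel_measurable N"
proof -
  have p[measurable]: "(\<lambda>(x, z). \<phi> x z) \<in> borel_measurable (borel \<Otimes>\<^sub>M borel)"
    using phi by (simp add: borel_prod)
  have "(\<lambda>x. (\<lambda>(x, z). \<phi> x z) (f x, g x)) \<in> borel_measurable N" by measurable
  then show ?thesis by simp
qed

lemma pred_connected:
  assumes y: "\<And>i. i \<le> n \<Longrightarrow> (\<lambda>x. y x i) \<in> borel_measurable N"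
    and u: "\<And>p. p \<in> ordered_pairs n \<Longrightarrow> (\<lambda>x. u x p) \<in> borel_measurable N"
  shows "Measurable.pred N (\<lambda>x. component {..n} (edge \<phi> (y x) (u x)) 0 = {..n})"
proof -
  have edge: "Measurable.pred N (\<lambda>x. i \<in> {..n} \<and> j \<in> {..n} \<and> edge \<phi> (y x) (u x) i j)" for i j
  proof (cases "i \<le> n \<and> j \<le> n \<and> i \<noteq> j")
    case True
    then have p: "(min i j, max i j) \<in> ordered_pairs n" by (auto simp: ordered_pairs_def)
    have [measurable]: "(\<lambda>x. y x i) \<in> borel_measurable N" "(\<lambda>x. y x j) \<in> borel_measurable N"
      using y True by auto
    note u[OF p, measurable]
    show ?thesis unfolding edge_def by measurable
  next
    case False
    then have "(\<lambda>x. i \<in> {..n} \<and> j \<in> {..n} \<and> edge \<phi> (y x) (u x) i j) = (\<lambda>_. False)"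
      by (auto simp: edge_def)
    then show ?thesis by simp
  qed
  have [measurable]: "Measurable.pred N (\<lambda>x. j \<in> component {..n} (edge \<phi> (y x) (u x)) 0)" for j
    by (rule pred_component[OF _ edge]) simp
  show ?thesis unfolding set_eq_iff by measurable
qed

lemma connection_prob_measurable:
  assumes y: "\<And>i. i \<le> n \<Longrightarrow> (\<lambda>x. y x i) \<in> borel_measurable N"
  shows "(\<lambda>x. connection_prob \<phi> n (y x)) \<in> borel_measurable N"
proof -
  interpret U: prob_space "Pi\<^sub>M (ordered_pairs n) (\<lambda>_. unif)" by (intro prob_space_PiM prob_space_unif)
  have "Measurable.pred (N \<Otimes>\<^sub>M Pi\<^sub>M (ordered_pairs n) (\<lambda>_. unif))
      (\<lambda>p. component {..n} (edge \<phi> (y (fst p)) (snd p)) 0 = {..n})"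
    by (rule pred_connected) (auto intro!: measurable_compose[OF measurable_fst y])
  then have "(\<lambda>(x, u). indicator {u. component {..n} (edge \<phi> (y x) u) 0 = {..n}} u :: ennreal)
      \<in> borel_measurable (N \<Otimes>\<^sub>M Pi\<^sub>M (ordered_pairs n) (\<lambda>_. unif))"
    by (simp add: indicator_def split_beta')
  then show ?thesis unfolding connection_prob_def by (rule U.borel_measurable_nn_integral)
qed

lemma connection_prob_le_1: "connection_prob \<phi> n y \<le> 1"
proof -
  interpret U: prob_space "Pi\<^sub>M (ordered_pairs n) (\<lambda>_. unif)" by (intro prob_space_PiM prob_space_unif)
  have "connection_prob \<phi> n y \<le> (\<integral>\<^sup>+u. 1 \<partial>Pi\<^sub>M (ordered_pairs n) (\<lambda>_. unif))"
    unfolding connection_prob_def by (intro nn_integral_mono) (auto simp: indicator_def)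
  also have "\<dots> = 1" by (simp add: U.emeasure_space_1)
  finally show ?thesis .
qed

lemma avoid_prob_measurable:
  assumes y: "\<And>i. i \<le> n \<Longrightarrow> (\<lambda>x. y x i) \<in> borel_measurable N" and [measurable]: "z \<in> borel_measurable N"
  shows "(\<lambda>x. avoid_prob \<phi> n (y x) (z x)) \<in> borel_measurable N"
proof -
  have "(\<lambda>x. ennreal (1 - \<phi> (y x i) (z x))) \<in> borel_measurable N" if "i \<in> {..n}" for i
  proof -
    have [measurable]: "(\<lambda>x. y x i) \<in> borel_measurable N" using y that by simp
    show ?thesis by measurable
  qed
  then show ?thesis unfolding avoid_prob_def by (intro borel_measurable_prod_ennreal)
qed

lemma avoid_prob_le_1: "avoid_prob \<phi> n y z \<le> 1"
  unfolding avoid_prob_def by (intro prod_le_1) (use phi_range in \<open>auto simp: ennreal_le_1\<close>)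

definition isolated_edges :: "nat \<Rightarrow> nat \<Rightarrow> (nat \<times> nat) set" where
  "isolated_edges n m = {..n} \<times> {n<..m}"

text \<open>
The event that \<open>y 0, \<dots>, y n\<close> are the cluster of \<open>y 0\<close> among \<open>y 0, \<dots>, y m\<close>. It is determined by the
marks of the pairs with at least one index in \<open>0, \<dots>, n\<close>.
\<close>

definition cluster_indicator :: "nat \<Rightarrow> nat \<Rightarrow> (nat \<Rightarrow> 'a) \<Rightarrow> (nat \<times> nat \<Rightarrow> real) \<Rightarrow> ennreal" where
  "cluster_indicator n m y u = indicator {u. component {..n} (edge \<phi> y u) 0 = {..n}} u *
    (\<Prod>(i, j)\<in>isolated_edges n m. indicator {\<phi> (y i) (y j)<..} (u (i, j)))"

text \<open>
The edges inside the cluster and the edges that leave it carry different marks, so the two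
conditions are independent.
\<close>

lemma nn_integral_cluster_indicator:
  "(\<integral>\<^sup>+u. cluster_indicator n m y u \<partial>Pi\<^sub>M (ordered_pairs n \<union> isolated_edges n m) (\<lambda>_. unif)) =
    connection_prob \<phi> n y * (\<Prod>j\<in>{n<..m}. avoid_prob \<phi> n y (y j))"
proof -
  interpret P: prob_space unif by (rule prob_space_unif)
  interpret P: product_sigma_finite "\<lambda>_::nat \<times> nat. unif" ..
  let ?O = "ordered_pairs n" and ?C = "isolated_edges n m"
  have disj: "?O \<inter> ?C = {}" by (auto simp: ordered_pairs_def isolated_edges_def)
  have fin: "finite ?C" by (simp add: isolated_edges_def)
  have conn_meas: "Measurable.pred (Pi\<^sub>M (?O \<union> ?C) (\<lambda>_. unif)) (\<lambda>u. component {..n} (edge \<phi> y u) 0 = {..n})"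
    by (rule pred_connected) (auto intro!: unif_component)
  have "(\<lambda>u. indicator {\<phi> (y i) (y j)<..} (u (i, j)) :: ennreal) \<in> borel_measurable (Pi\<^sub>M (?O \<union> ?C) (\<lambda>_. unif))"
    if "(i, j) \<in> ?C" for i j
  proof -
    have [measurable]: "(\<lambda>u. u (i, j)) \<in> borel_measurable (Pi\<^sub>M (?O \<union> ?C) (\<lambda>_. unif))"
      using that by (intro unif_component) auto
    show ?thesis by measurable
  qed
  then have "(\<lambda>u. \<Prod>(i, j)\<in>?C. indicator {\<phi> (y i) (y j)<..} (u (i, j)) :: ennreal)
      \<in> borel_measurable (Pi\<^sub>M (?O \<union> ?C) (\<lambda>_. unif))"
    by (intro borel_measurable_prod_ennreal) (auto simp: split_beta)
  then have meas: "cluster_indicator n m y \<in> borel_measurable (Pi\<^sub>M (?O \<union> ?C) (\<lambda>_. unif))"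
    unfolding cluster_indicator_def[abs_def] using conn_meas
    by (intro borel_measurable_times_ennreal) (auto simp: indicator_def)
  have split: "cluster_indicator n m y (merge ?O ?C (u, w)) =
      indicator {u. component {..n} (edge \<phi> y u) 0 = {..n}} u *
      (\<Prod>p\<in>?C. indicator {\<phi> (y (fst p)) (y (snd p))<..} (w p))" for u w
  proof -
    have "component {..n} (edge \<phi> y (merge ?O ?C (u, w))) 0 = component {..n} (edge \<phi> y u) 0"
      by (rule component_cong) (auto simp: edge_def merge_def ordered_pairs_def)
    moreover have "(\<Prod>(i, j)\<in>?C. indicator {\<phi> (y i) (y j)<..} (merge ?O ?C (u, w) (i, j)) :: ennreal)
        = (\<Prod>p\<in>?C. indicator {\<phi> (y (fst p)) (y (snd p))<..} (w p))"
      using disj by (intro prod.cong refl) (auto simp: merge_def)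
    ultimately show ?thesis unfolding cluster_indicator_def by (simp add: indicator_def)
  qed
  have rest: "(\<integral>\<^sup>+w. (\<Prod>p\<in>?C. indicator {\<phi> (y (fst p)) (y (snd p))<..} (w p)) \<partial>Pi\<^sub>M ?C (\<lambda>_. unif))
      = (\<Prod>j\<in>{n<..m}. avoid_prob \<phi> n y (y j))"
  proof -
    have "(\<integral>\<^sup>+w. (\<Prod>p\<in>?C. indicator {\<phi> (y (fst p)) (y (snd p))<..} (w p)) \<partial>Pi\<^sub>M ?C (\<lambda>_. unif))
        = (\<Prod>p\<in>?C. \<integral>\<^sup>+r. indicator {\<phi> (y (fst p)) (y (snd p))<..} r \<partial>unif)"
      by (rule P.product_nn_integral_prod[OF fin]) simp
    also have "\<dots> = (\<Prod>p\<in>?C. ennreal (1 - \<phi> (y (fst p)) (y (snd p))))"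
    proof (intro prod.cong refl)
      fix p
      have "(\<integral>\<^sup>+r. indicator {\<phi> (y (fst p)) (y (snd p))<..} r \<partial>unif) = emeasure unif {\<phi> (y (fst p)) (y (snd p))<..}"
        by (intro nn_integral_indicator) simp
      then show "(\<integral>\<^sup>+r. indicator {\<phi> (y (fst p)) (y (snd p))<..} r \<partial>unif) = ennreal (1 - \<phi> (y (fst p)) (y (snd p)))"
        using phi_range emeasure_unif_greater by metis
    qed
    also have "\<dots> = (\<Prod>i\<le>n. \<Prod>j\<in>{n<..m}. ennreal (1 - \<phi> (y i) (y j)))"
      unfolding isolated_edges_def by (subst prod.cartesian_product) (simp add: split_beta)
    also have "\<dots> = (\<Prod>j\<in>{n<..m}. \<Prod>i\<le>n. ennreal (1 - \<phi> (y i) (y j)))" by (rule prod.swap)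
    finally show ?thesis unfolding avoid_prob_def .
  qed
  have "(\<integral>\<^sup>+u. cluster_indicator n m y u \<partial>Pi\<^sub>M (?O \<union> ?C) (\<lambda>_. unif)) =
      (\<integral>\<^sup>+u. \<integral>\<^sup>+w. cluster_indicator n m y (merge ?O ?C (u, w)) \<partial>Pi\<^sub>M ?C (\<lambda>_. unif) \<partial>Pi\<^sub>M ?O (\<lambda>_. unif))"
    by (rule P.product_nn_integral_fold[OF disj _ fin meas]) simp
  also have "\<dots> = (\<integral>\<^sup>+u. indicator {u. component {..n} (edge \<phi> y u) 0 = {..n}} u * (\<Prod>j\<in>{n<..m}. avoid_prob \<phi> n y (y j)) \<partial>Pi\<^sub>M ?O (\<lambda>_. unif))"
    unfolding split rest[symmetric]
  proof (intro nn_integral_cong nn_integral_cmult borel_measurable_prod_ennreal)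
    fix p assume p: "p \<in> ?C"
    have [measurable]: "(\<lambda>w. w p) \<in> borel_measurable (Pi\<^sub>M ?C (\<lambda>_. unif))"
      using p by (rule unif_component)
    show "(\<lambda>w. indicator {\<phi> (y (fst p)) (y (snd p))<..} (w p)) \<in> borel_measurable (Pi\<^sub>M ?C (\<lambda>_. unif))"
      by measurable
  qed
  also have "\<dots> = connection_prob \<phi> n y * (\<Prod>j\<in>{n<..m}. avoid_prob \<phi> n y (y j))"
  proof -
    have "Measurable.pred (Pi\<^sub>M ?O (\<lambda>_. unif)) (\<lambda>u. component {..n} (edge \<phi> y u) 0 = {..n})"
      by (rule pred_connected) (auto intro!: unif_component)
    then show ?thesis unfolding connection_prob_def by (intro nn_integral_multc) (simp add: indicator_def)
  qed
  finally show ?thesis .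
qed

end

section \<open>The law of the truncated cluster size\<close>

lemma (in connection) cluster_indicator_measurable:
  assumes nm: "n \<le> m" and y: "\<And>i. i \<le> m \<Longrightarrow> (\<lambda>x. y x i) \<in> borel_measurable N"
    and u: "\<And>p. p \<in> ordered_pairs n \<union> isolated_edges n m \<Longrightarrow> (\<lambda>x. u x p) \<in> borel_measurable N"
  shows "(\<lambda>x. cluster_indicator n m (y x) (u x)) \<in> borel_measurable N"
proof -
  have "Measurable.pred N (\<lambda>x. component {..n} (edge \<phi> (y x) (u x)) 0 = {..n})"
    by (rule pred_connected) (use y u nm in auto)
  then have 1: "(\<lambda>x. indicator {u. component {..n} (edge \<phi> (y x) u) 0 = {..n}} (u x) :: ennreal) \<in> borel_measurable N"
    by (simp add: indicator_def)
  have "(\<lambda>x. indicator {\<phi> (y x i) (y x j)<..} (u x (i, j)) :: ennreal) \<in> borel_measurable N"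
    if "(i, j) \<in> isolated_edges n m" for i j
  proof -
    have "i \<le> m" "j \<le> m" using that nm by (auto simp: isolated_edges_def)
    note [measurable] = y[OF this(1)] y[OF this(2)]
    have [measurable]: "(\<lambda>x. u x (i, j)) \<in> borel_measurable N" using u that by simp
    show ?thesis unfolding indicator_def greaterThan_iff by measurable
  qed
  then have "(\<lambda>x. \<Prod>(i, j)\<in>isolated_edges n m. indicator {\<phi> (y x i) (y x j)<..} (u x (i, j)) :: ennreal) \<in> borel_measurable N"
    by (intro borel_measurable_prod_ennreal) (auto simp: split_beta)
  with 1 show ?thesis unfolding cluster_indicator_def by (rule borel_measurable_times_ennreal)
qed

lemma prod_indicator_greaterThan:
  fixes a u :: "'i \<Rightarrow> real"
  shows "finite A \<Longrightarrow> (\<Prod>p\<in>A. indicator {a p<..} (u p) :: ennreal) = of_bool (\<forall>p\<in>A. a p < u p)"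
  by (induction A rule: finite_induct) (auto simp: indicator_def)

text \<open>
The measure of \<open>B\<close> thinned by the probability of avoiding the cluster \<open>y 0, \<dots>, y n\<close>; its complement
\<open>exposed_measure\<close> is the quantity \<open>a\<close> in the exponent of the cluster size law.
\<close>

definition free_measure :: "('a::{metric_space, second_countable_topology} \<Rightarrow> 'a \<Rightarrow> real) \<Rightarrow> 'a measure \<Rightarrow> 'a set \<Rightarrow> nat \<Rightarrow> (nat \<Rightarrow> 'a) \<Rightarrow> ennreal" where
  "free_measure \<phi> lam B n y = (\<integral>\<^sup>+z. avoid_prob \<phi> n y z \<partial>measure_on lam B)"

definition exposed_measure :: "('a::{metric_space, second_countable_topology} \<Rightarrow> 'a \<Rightarrow> real) \<Rightarrow> 'a measure \<Rightarrow> 'a set \<Rightarrow> nat \<Rightarrow> (nat \<Rightarrow> 'a) \<Rightarrow> real" where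
  "exposed_measure \<phi> lam B n y = measure lam B - enn2real (free_measure \<phi> lam B n y)"

context connection begin

lemma free_measure_le:
  assumes lam: "sets lam = sets borel" and B: "B \<in> sets borel"
  shows "free_measure \<phi> lam B n y \<le> emeasure lam B"
proof -
  have "free_measure \<phi> lam B n y \<le> (\<integral>\<^sup>+z. 1 \<partial>measure_on lam B)"
    unfolding free_measure_def by (intro nn_integral_mono avoid_prob_le_1)
  also have "\<dots> = emeasure lam B"
    using B lam sets_eq_imp_space_eq[OF lam] by (simp add: emeasure_measure_on)
  finally show ?thesis .
qed

lemma exposed_measure_bounds:
  assumes lam: "sets lam = sets borel" and B: "B \<in> sets borel" and fin: "emeasure lam B < \<infinity>"
  shows "0 \<le> exposed_measure \<phi> lam B n y" "exposed_measure \<phi> lam B n y \<le> measure lam B"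
proof -
  have "enn2real (free_measure \<phi> lam B n y) \<le> enn2real (emeasure lam B)"
    using fin by (intro enn2real_mono free_measure_le lam B) auto
  then show "0 \<le> exposed_measure \<phi> lam B n y" by (simp add: exposed_measure_def measure_def)
qed (simp add: exposed_measure_def)

lemma free_measure_measurable:
  assumes lam: "sets lam = sets borel" and fin: "finite_measure (measure_on lam B)"
    and y: "\<And>i. i \<le> n \<Longrightarrow> (\<lambda>x. y x i) \<in> borel_measurable N"
  shows "(\<lambda>x. free_measure \<phi> lam B n (y x)) \<in> borel_measurable N"
proof -
  interpret R: finite_measure "measure_on lam B" by fact
  have "(\<lambda>p. avoid_prob \<phi> n (y (fst p)) (snd p)) \<in> borel_measurable (N \<Otimes>\<^sub>M measure_on lam B)"
  proof (rule avoid_prob_measurable)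
    show "(\<lambda>p. y (fst p) i) \<in> borel_measurable (N \<Otimes>\<^sub>M measure_on lam B)" if "i \<le> n" for i
      by (rule measurable_compose[OF measurable_fst y[OF that]])
    have "snd \<in> measurable (N \<Otimes>\<^sub>M measure_on lam B) (measure_on lam B)" by simp
    then show "snd \<in> borel_measurable (N \<Otimes>\<^sub>M measure_on lam B)"
      by (simp cong: measurable_cong_sets add: lam)
  qed
  then show ?thesis unfolding free_measure_def by (intro R.borel_measurable_nn_integral) (simp add: split_beta')
qed

end

locale rcm = poisson_input M \<kappa> X lam t + connection \<phi>
  for M :: "'w measure" and \<kappa> and X :: "nat \<Rightarrow> 'w \<Rightarrow> 'a::{metric_space, second_countable_topology}"
    and lam t and \<phi> :: "'a \<Rightarrow> 'a \<Rightarrow> real" +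
  fixes U :: "nat set \<Rightarrow> 'w \<Rightarrow> real"
  assumes U_meas: "\<And>e. e \<in> label_pairs \<Longrightarrow> U e \<in> borel_measurable M"
    and U_unif: "\<And>e. e \<in> label_pairs \<Longrightarrow> distr M borel (U e) = unif"
    and U_indep: "indep_vars (\<lambda>_. borel) U label_pairs"
    and joint: "distr M ((count_space UNIV \<Otimes>\<^sub>M Pi\<^sub>M UNIV (\<lambda>_. borel)) \<Otimes>\<^sub>M Pi\<^sub>M label_pairs (\<lambda>_. borel))
        (\<lambda>\<omega>. ((\<kappa> \<omega>, \<lambda>n. X n \<omega>), \<lambda>e\<in>label_pairs. U e \<omega>)) =
      distr M (count_space UNIV \<Otimes>\<^sub>M Pi\<^sub>M UNIV (\<lambda>_. borel)) (\<lambda>\<omega>. (\<kappa> \<omega>, \<lambda>n. X n \<omega>)) \<Otimes>\<^sub>M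
      distr M (Pi\<^sub>M label_pairs (\<lambda>_. borel)) (\<lambda>\<omega>. \<lambda>e\<in>label_pairs. U e \<omega>)"
begin

abbreviation "S \<equiv> count_space UNIV \<Otimes>\<^sub>M Pi\<^sub>M UNIV (\<lambda>_. borel) :: (enat \<times> (nat \<Rightarrow> 'a)) measure"
abbreviation "T \<equiv> Pi\<^sub>M label_pairs (\<lambda>_. borel) :: (nat set \<Rightarrow> real) measure"
abbreviation "marks \<omega> \<equiv> (\<lambda>e\<in>label_pairs. U e \<omega>)"
abbreviation "pts \<omega> \<equiv> (\<kappa> \<omega>, \<lambda>n. X n \<omega>)"

lemma pts_measurable[measurable]: "(\<lambda>\<omega>. pts \<omega>) \<in> measurable M S"
  by (intro measurable_Pair kappa measurable_PiM_single') auto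

lemma marks_measurable[measurable]: "(\<lambda>\<omega>. marks \<omega>) \<in> measurable M T"
  by (intro measurable_restrict U_meas)

text \<open>
Points and marks are independent, so the marks can be averaged for fixed points.
\<close>

lemma decouple:
  assumes H[measurable]: "H \<in> borel_measurable (S \<Otimes>\<^sub>M T)"
  shows "(\<integral>\<^sup>+\<omega>. H (pts \<omega>, marks \<omega>) \<partial>M) = (\<integral>\<^sup>+\<omega>. \<integral>\<^sup>+\<omega>'. H (pts \<omega>, marks \<omega>') \<partial>M \<partial>M)"
proof -
  interpret DT: prob_space "distr M T (\<lambda>\<omega>. marks \<omega>)" by (rule prob_space_distr) simp
  have H': "H \<in> borel_measurable (distr M S (\<lambda>\<omega>. pts \<omega>) \<Otimes>\<^sub>M distr M T (\<lambda>\<omega>. marks \<omega>))"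
    by simp
  have "(\<integral>\<^sup>+\<omega>. H (pts \<omega>, marks \<omega>) \<partial>M) = (\<integral>\<^sup>+z. H z \<partial>distr M (S \<Otimes>\<^sub>M T) (\<lambda>\<omega>. (pts \<omega>, marks \<omega>)))"
    by (subst nn_integral_distr) auto
  also have "\<dots> = (\<integral>\<^sup>+s. \<integral>\<^sup>+u. H (s, u) \<partial>distr M T (\<lambda>\<omega>. marks \<omega>) \<partial>distr M S (\<lambda>\<omega>. pts \<omega>))"
    unfolding joint by (rule DT.nn_integral_fst[OF H', symmetric])
  also have "\<dots> = (\<integral>\<^sup>+s. \<integral>\<^sup>+\<omega>'. H (s, marks \<omega>') \<partial>M \<partial>distr M S (\<lambda>\<omega>. pts \<omega>))"
    by (intro nn_integral_cong, subst nn_integral_distr) (auto intro!: measurable_compose[OF _ H])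
  also have "\<dots> = (\<integral>\<^sup>+\<omega>. \<integral>\<^sup>+\<omega>'. H (pts \<omega>, marks \<omega>') \<partial>M \<partial>M)"
    by (subst nn_integral_distr) auto
  finally show ?thesis .
qed

lemma distr_marks: "distr M T (\<lambda>\<omega>. marks \<omega>) = Pi\<^sub>M label_pairs (\<lambda>_. unif)"
proof -
  have "{0, 1} \<in> label_pairs" by (simp add: label_pairs_def)
  then have "label_pairs \<noteq> {}" by blast
  then have "distr M T (\<lambda>\<omega>. marks \<omega>) = Pi\<^sub>M label_pairs (\<lambda>e. distr M borel (U e))"
    using U_indep by (subst (asm) indep_vars_iff_distr_eq_PiM'[OF _ U_meas]) auto
  also have "\<dots> = Pi\<^sub>M label_pairs (\<lambda>_. unif)" by (intro PiM_cong refl U_unif)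
  finally show ?thesis .
qed

text \<open>
Distinct pairs of indices correspond to distinct pairs of labels, so the relabelled marks are again
independent and uniform. This removes the dependence on the labels of the points.
\<close>

lemma nn_integral_relabelled_marks:
  fixes \<sigma> :: "nat \<Rightarrow> nat"
  assumes \<sigma>: "inj_on \<sigma> {..m}" and I: "\<And>i j. (i, j) \<in> I \<Longrightarrow> i < j \<and> j \<le> m"
    and F[measurable]: "F \<in> borel_measurable (Pi\<^sub>M I (\<lambda>_. unif))"
  shows "(\<integral>\<^sup>+\<omega>. F (\<lambda>p\<in>I. marks \<omega> {\<sigma> (fst p), \<sigma> (snd p)}) \<partial>M) = (\<integral>\<^sup>+u. F u \<partial>Pi\<^sub>M I (\<lambda>_. unif))"
proof -
  let ?f = "\<lambda>p. {\<sigma> (fst p), \<sigma> (snd p)}"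
  have f: "?f \<in> I \<rightarrow> label_pairs"
  proof
    fix p assume "p \<in> I"
    then have "fst p < snd p" "snd p \<le> m" using I[of "fst p" "snd p"] by auto
    then have "fst p \<in> {..m}" "snd p \<in> {..m}" "fst p \<noteq> snd p" by auto
    then have "\<sigma> (fst p) \<noteq> \<sigma> (snd p)" using inj_on_eq_iff[OF \<sigma>] by blast
    then show "?f p \<in> label_pairs" by (simp add: label_pairs_def)
  qed
  have inj: "inj_on ?f I"
  proof (rule inj_onI)
    fix p q assume pq: "p \<in> I" "q \<in> I" "?f p = ?f q"
    obtain a b c d where p: "p = (a, b)" and q: "q = (c, d)" by (cases p, cases q) auto
    have o: "a < b" "b \<le> m" "c < d" "d \<le> m" using I pq p q by auto
    have in_m: "a \<in> {..m}" "b \<in> {..m}" "c \<in> {..m}" "d \<in> {..m}" using o by auto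
    have "(\<sigma> a = \<sigma> c \<and> \<sigma> b = \<sigma> d) \<or> (\<sigma> a = \<sigma> d \<and> \<sigma> b = \<sigma> c)"
      using pq(3) by (simp add: p q doubleton_eq_iff)
    then have "(a = c \<and> b = d) \<or> (a = d \<and> b = c)"
      using inj_on_eq_iff[OF \<sigma>] in_m by metis
    then show "p = q" using o p q by auto
  qed
  have sets_T: "sets (Pi\<^sub>M label_pairs (\<lambda>_. unif)) = sets T" by (intro sets_PiM_cong) auto
  have restr: "(\<lambda>w. \<lambda>p\<in>I. w (?f p)) \<in> measurable (Pi\<^sub>M label_pairs (\<lambda>_. unif)) (Pi\<^sub>M I (\<lambda>_. unif))"
    by (intro measurable_restrict measurable_component_singleton) (use f in auto)
  have "(\<integral>\<^sup>+u. F u \<partial>Pi\<^sub>M I (\<lambda>_. unif)) = (\<integral>\<^sup>+u. F u \<partial>distr (Pi\<^sub>M label_pairs (\<lambda>_. unif)) (Pi\<^sub>M I (\<lambda>_. unif)) (\<lambda>w. \<lambda>p\<in>I. w (?f p)))"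
    by (subst distr_PiM_reindex[OF _ inj f]) (auto intro: prob_space_unif)
  also have "\<dots> = (\<integral>\<^sup>+w. F (\<lambda>p\<in>I. w (?f p)) \<partial>Pi\<^sub>M label_pairs (\<lambda>_. unif))"
    by (rule nn_integral_distr[OF restr]) simp
  also have "\<dots> = (\<integral>\<^sup>+w. F (\<lambda>p\<in>I. w (?f p)) \<partial>distr M T (\<lambda>\<omega>. marks \<omega>))" unfolding distr_marks ..
  also have "\<dots> = (\<integral>\<^sup>+\<omega>. F (\<lambda>p\<in>I. marks \<omega> (?f p)) \<partial>M)"
  proof (rule nn_integral_distr)
    have "(\<lambda>w. F (\<lambda>p\<in>I. w (?f p))) \<in> borel_measurable (Pi\<^sub>M label_pairs (\<lambda>_. unif))"
      by (rule measurable_compose[OF restr F])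
    then show "(\<lambda>w. F (\<lambda>p\<in>I. w (?f p))) \<in> borel_measurable (distr M T (\<lambda>\<omega>. marks \<omega>))"
      by (simp cong: measurable_cong_sets add: sets_T)
  qed simp
  finally show ?thesis by simp
qed

definition label_edge :: "'a \<Rightarrow> 'w \<Rightarrow> nat \<Rightarrow> nat \<Rightarrow> bool" where
  "label_edge v \<omega> i j \<longleftrightarrow> i \<noteq> j \<and> U {i, j} \<omega> \<le> \<phi> (vertex v X \<omega> i) (vertex v X \<omega> j)"

definition cluster_labels :: "'a set \<Rightarrow> 'a \<Rightarrow> 'w \<Rightarrow> nat set" where
  "cluster_labels B v \<omega> = component (insert 0 (Suc ` indices B \<omega>)) (label_edge v \<omega>) 0"

lemma vertex_measurable[measurable]: "(\<lambda>\<omega>. vertex v X \<omega> i) \<in> borel_measurable M"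
  by (cases i) (simp_all add: vertex_def)

lemma pred_cluster_labels[measurable]:
  assumes B[measurable]: "B \<in> sets borel"
  shows "Measurable.pred M (\<lambda>\<omega>. i \<in> cluster_labels B v \<omega>)"
  unfolding cluster_labels_def
proof (rule pred_component)
  have V[measurable]: "Measurable.pred M (\<lambda>\<omega>. i \<in> insert 0 (Suc ` indices B \<omega>))" for i
    by (cases i) (simp_all add: image_iff)
  then show "Measurable.pred M (\<lambda>\<omega>. i \<in> insert 0 (Suc ` indices B \<omega>))" for i .
  show "Measurable.pred M (\<lambda>\<omega>. i \<in> insert 0 (Suc ` indices B \<omega>) \<and>
      j \<in> insert 0 (Suc ` indices B \<omega>) \<and> label_edge v \<omega> i j)" for i j
  proof (cases "i = j")
    case False
    then have [measurable]: "U {i, j} \<in> borel_measurable M" by (intro U_meas) (simp add: label_pairs_def)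
    show ?thesis unfolding label_edge_def by measurable
  qed (simp add: label_edge_def)
qed

text \<open>
On the event that \<open>\<tau>\<close> lists the points in \<open>B\<close>, the map \<open>\<sigma>\<close> is an isomorphism from the graph on the
indices \<open>0, \<dots>, m\<close> to the graph on the labels; it sends \<open>0\<close> to the label \<open>0\<close> of the root.
\<close>

lemma cluster_indicator_eq:
  fixes \<tau> :: "nat \<Rightarrow> nat"
  defines "\<sigma> \<equiv> case_nat 0 (\<lambda>j. Suc (\<tau> j))"
  assumes \<tau>: "\<tau> \<in> tuples m" and nm: "n \<le> m" and lab: "indices B \<omega> = \<tau> ` {..<m}"
  shows "cluster_indicator n m (case_nat v (tuple_points X m \<tau> \<omega>))
      (\<lambda>p\<in>ordered_pairs n \<union> isolated_edges n m. marks \<omega> {\<sigma> (fst p), \<sigma> (snd p)}) =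
    indicator {\<omega>. cluster_labels B v \<omega> = \<sigma> ` {..n}} \<omega>"
    (is "cluster_indicator n m ?y ?u = _")
proof -
  let ?e = "label_edge v \<omega>"
  have inj: "inj_on \<sigma> {..m}"
    using \<tau> by (auto simp: tuples_def inj_on_def \<sigma>_def split: nat.splits)
  have \<sigma>0: "\<sigma> 0 = 0" by (simp add: \<sigma>_def)
  have img: "\<sigma> ` {..k} = insert 0 (Suc ` \<tau> ` {..<k})" for k
    by (simp add: atMost_nat_numeral \<sigma>_def lessThan_Suc_atMost[symmetric] lessThan_Suc_eq_insert_0 image_image)
  have y: "?y i = vertex v X \<omega> (\<sigma> i)" if "i \<le> m" for i
    using that by (cases i) (auto simp: vertex_def \<sigma>_def tuple_points_def)
  have ne: "\<sigma> i \<noteq> \<sigma> j" if "i \<le> m" "j \<le> m" "i \<noteq> j" for i j using inj that by (auto simp: inj_on_def)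
  have u: "?u (i, j) = U {\<sigma> i, \<sigma> j} \<omega>" if "(i, j) \<in> ordered_pairs n \<union> isolated_edges n m" for i j
  proof -
    have "i \<le> m" "j \<le> m" "i \<noteq> j" using that nm by (auto simp: ordered_pairs_def isolated_edges_def)
    then have "{\<sigma> i, \<sigma> j} \<in> label_pairs" using ne by (simp add: label_pairs_def)
    then show ?thesis using that by simp
  qed
  have edge: "edge \<phi> ?y ?u i j = ?e (\<sigma> i) (\<sigma> j)" if "i \<le> n" "j \<le> n" for i j
  proof (cases "i = j")
    case False
    have "(min i j, max i j) \<in> ordered_pairs n" using that False by (auto simp: ordered_pairs_def)
    then have "?u (min i j, max i j) = U {\<sigma> (min i j), \<sigma> (max i j)} \<omega>" by (intro u) auto
    also have "{\<sigma> (min i j), \<sigma> (max i j)} = {\<sigma> i, \<sigma> j}" by (auto simp: min_def max_def)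
    finally show ?thesis using False ne[of i j] that nm y[of i] y[of j] by (simp add: edge_def label_edge_def)
  qed (simp add: edge_def label_edge_def)
  have cross: "(\<phi> (?y i) (?y j) < ?u (i, j)) = (\<not> ?e (\<sigma> i) (\<sigma> j))" if "(i, j) \<in> isolated_edges n m" for i j
  proof -
    have ij: "i \<le> m" "j \<le> m" "i \<noteq> j" using that nm by (auto simp: isolated_edges_def)
    have "?u (i, j) = U {\<sigma> i, \<sigma> j} \<omega>" using that by (intro u) auto
    then show ?thesis using ne[OF ij] y[OF ij(1)] y[OF ij(2)] by (simp add: label_edge_def not_le)
  qed
  have V: "insert 0 (Suc ` indices B \<omega>) = \<sigma> ` {..m}" unfolding lab img ..
  have "cluster_labels B v \<omega> = \<sigma> ` {..n} \<longleftrightarrow>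
      component (\<sigma> ` {..n}) ?e 0 = \<sigma> ` {..n} \<and> (\<forall>i\<in>\<sigma> ` {..n}. \<forall>j\<in>\<sigma> ` {..m} - \<sigma> ` {..n}. \<not> ?e i j)"
    unfolding cluster_labels_def V
    by (rule component_eq_iff) (use nm in \<open>auto simp: img\<close>)
  also have "component (\<sigma> ` {..n}) ?e 0 = \<sigma> ` {..n} \<longleftrightarrow> component {..n} (\<lambda>i j. ?e (\<sigma> i) (\<sigma> j)) 0 = {..n}"
    using component_image_eq_iff[of \<sigma> "{..n}" 0 ?e] inj_on_subset[OF inj, of "{..n}"] nm \<sigma>0 by simp
  also have "component {..n} (\<lambda>i j. ?e (\<sigma> i) (\<sigma> j)) 0 = component {..n} (edge \<phi> ?y ?u) 0"
    by (rule component_cong, rule edge[symmetric]) auto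
  also have "\<sigma> ` {..m} - \<sigma> ` {..n} = \<sigma> ` {n<..m}"
  proof -
    have "\<sigma> ` ({..m} - {..n}) = \<sigma> ` {..m} - \<sigma> ` {..n}" by (rule inj_on_image_set_diff[OF inj]) (use nm in auto)
    moreover have "{..m} - {..n} = {n<..m}" by auto
    ultimately show ?thesis by simp
  qed
  also have "(\<forall>i\<in>\<sigma> ` {..n}. \<forall>j\<in>\<sigma> ` {n<..m}. \<not> ?e i j) \<longleftrightarrow> (\<forall>p\<in>isolated_edges n m. \<phi> (?y (fst p)) (?y (snd p)) < ?u p)"
    using cross by (force simp: isolated_edges_def)
  finally have iff: "cluster_labels B v \<omega> = \<sigma> ` {..n} \<longleftrightarrow> component {..n} (edge \<phi> ?y ?u) 0 = {..n} \<and>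
      (\<forall>p\<in>isolated_edges n m. \<phi> (?y (fst p)) (?y (snd p)) < ?u p)" .
  have fin: "finite (isolated_edges n m)" by (simp add: isolated_edges_def)
  have prod: "(\<Prod>(i, j)\<in>isolated_edges n m. indicator {\<phi> (?y i) (?y j)<..} (?u (i, j)) :: ennreal) =
      of_bool (\<forall>p\<in>isolated_edges n m. \<phi> (?y (fst p)) (?y (snd p)) < ?u p)"
  proof -
    have "(\<Prod>(i, j)\<in>isolated_edges n m. indicator {\<phi> (?y i) (?y j)<..} (?u (i, j)) :: ennreal) =
        (\<Prod>p\<in>isolated_edges n m. indicator {\<phi> (?y (fst p)) (?y (snd p))<..} (?u p))"
      by (intro prod.cong refl) (simp only: split_beta prod.collapse)
    then show ?thesis unfolding prod_indicator_greaterThan[OF fin] .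
  qed
  show ?thesis unfolding cluster_indicator_def prod using iff by (simp add: indicator_def del: restrict_apply)
qed

text \<open>
For fixed points the marks are averaged: by \<open>decouple\<close> they may be taken independent of the points, and
by \<open>nn_integral_relabelled_marks\<close> their labels are irrelevant.
\<close>

lemma cluster_tuple_prob:
  fixes \<tau> :: "nat \<Rightarrow> nat"
  defines "\<sigma> \<equiv> case_nat 0 (\<lambda>j. Suc (\<tau> j))"
  assumes B[measurable]: "B \<in> sets borel" and \<tau>: "\<tau> \<in> tuples m" and nm: "n \<le> m"
  shows "(\<integral>\<^sup>+\<omega>. indicator {\<omega>. indices B \<omega> = \<tau> ` {..<m}} \<omega> *
      indicator {\<omega>. cluster_labels B v \<omega> = \<sigma> ` {..n}} \<omega> \<partial>M) =
    (\<integral>\<^sup>+\<omega>. indicator {\<omega>. indices B \<omega> = \<tau> ` {..<m}} \<omega> *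
      (connection_prob \<phi> n (case_nat v (tuple_points X m \<tau> \<omega>)) *
       (\<Prod>j\<in>{n<..m}. avoid_prob \<phi> n (case_nat v (tuple_points X m \<tau> \<omega>)) (case_nat v (tuple_points X m \<tau> \<omega>) j))) \<partial>M)"
proof -
  let ?I = "ordered_pairs n \<union> isolated_edges n m"
  define y where "y s = case_nat v (\<lambda>j\<in>{..<m}. snd s (\<tau> j))" for s :: "enat \<times> (nat \<Rightarrow> 'a)"
  define u where "u w = (\<lambda>p\<in>?I. w {\<sigma> (fst p), \<sigma> (snd p)})" for w :: "nat set \<Rightarrow> real"
  define lab where "lab s \<longleftrightarrow> (\<forall>n. (enat n < fst s \<and> snd s n \<in> B) \<longleftrightarrow> n \<in> \<tau> ` {..<m})" for s :: "enat \<times> (nat \<Rightarrow> 'a)"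
  define H where "H p = of_bool (lab (fst p)) * cluster_indicator n m (y (fst p)) (u (snd p))" for p
  have inj: "inj_on \<sigma> {..m}"
    using \<tau> by (auto simp: tuples_def inj_on_def \<sigma>_def split: nat.splits)
  have I: "i < j \<and> j \<le> m" if "(i, j) \<in> ?I" for i j
    using that nm by (auto simp: ordered_pairs_def isolated_edges_def)
  have lab_eq: "lab (pts \<omega>) \<longleftrightarrow> indices B \<omega> = \<tau> ` {..<m}" for \<omega>
    by (auto simp: lab_def labels_in_def set_eq_iff)
  have y_eq: "y (pts \<omega>) = case_nat v (tuple_points X m \<tau> \<omega>)" for \<omega>
    by (simp add: y_def tuple_points_def)
  have y_meas: "(\<lambda>s. y s i) \<in> borel_measurable S" if "i \<le> m" for i
    using that by (cases i) (auto simp: y_def)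
  have u_meas: "(\<lambda>w. u w p) \<in> borel_measurable T" if "p \<in> ?I" for p
  proof -
    have "fst p < snd p" "snd p \<le> m" using I[of "fst p" "snd p"] that by auto
    then have "fst p \<in> {..m}" "snd p \<in> {..m}" "fst p \<noteq> snd p" by auto
    then have "\<sigma> (fst p) \<noteq> \<sigma> (snd p)" using inj_on_eq_iff[OF inj] by blast
    then have "{\<sigma> (fst p), \<sigma> (snd p)} \<in> label_pairs" by (simp add: label_pairs_def)
    then show ?thesis unfolding u_def using that by (simp add: measurable_component_singleton)
  qed
  have [measurable]: "Measurable.pred S lab" unfolding lab_def by measurable
  have "(\<lambda>p. cluster_indicator n m (y (fst p)) (u (snd p))) \<in> borel_measurable (S \<Otimes>\<^sub>M T)"
    by (intro cluster_indicator_measurable nm)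
       (auto intro!: measurable_compose[OF measurable_fst y_meas] measurable_compose[OF measurable_snd u_meas])
  then have H: "H \<in> borel_measurable (S \<Otimes>\<^sub>M T)" unfolding H_def[abs_def] by measurable
  have "(\<integral>\<^sup>+\<omega>. indicator {\<omega>. indices B \<omega> = \<tau> ` {..<m}} \<omega> *
      indicator {\<omega>. cluster_labels B v \<omega> = \<sigma> ` {..n}} \<omega> \<partial>M) = (\<integral>\<^sup>+\<omega>. H (pts \<omega>, marks \<omega>) \<partial>M)"
  proof (intro nn_integral_cong)
    fix \<omega>
    show "indicator {\<omega>. indices B \<omega> = \<tau> ` {..<m}} \<omega> *
      indicator {\<omega>. cluster_labels B v \<omega> = \<sigma> ` {..n}} \<omega> = H (pts \<omega>, marks \<omega>)"
    proof (cases "indices B \<omega> = \<tau> ` {..<m}")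
      case True
      show ?thesis using cluster_indicator_eq[OF \<tau> nm True, of v]
        unfolding H_def fst_conv snd_conv lab_eq y_eq u_def \<sigma>_def[symmetric] by (simp add: True del: restrict_apply)
    qed (simp add: H_def lab_eq)
  qed
  also have "\<dots> = (\<integral>\<^sup>+\<omega>. \<integral>\<^sup>+\<omega>'. H (pts \<omega>, marks \<omega>') \<partial>M \<partial>M)" by (rule decouple[OF H])
  also have "\<dots> = (\<integral>\<^sup>+\<omega>. indicator {\<omega>. indices B \<omega> = \<tau> ` {..<m}} \<omega> *
      (connection_prob \<phi> n (y (pts \<omega>)) * (\<Prod>j\<in>{n<..m}. avoid_prob \<phi> n (y (pts \<omega>)) (y (pts \<omega>) j))) \<partial>M)"
  proof (rule nn_integral_cong)
    fix \<omega>
    have ci: "cluster_indicator n m (y (pts \<omega>)) \<in> borel_measurable (Pi\<^sub>M ?I (\<lambda>_. unif))"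
      by (rule cluster_indicator_measurable[OF nm]) (auto intro!: unif_component)
    have "(\<integral>\<^sup>+\<omega>'. H (pts \<omega>, marks \<omega>') \<partial>M) =
        (\<integral>\<^sup>+\<omega>'. (\<lambda>u. of_bool (lab (pts \<omega>)) * cluster_indicator n m (y (pts \<omega>)) u) (\<lambda>p\<in>?I. marks \<omega>' {\<sigma> (fst p), \<sigma> (snd p)}) \<partial>M)"
      by (simp add: H_def u_def del: restrict_apply)
    also have "\<dots> = (\<integral>\<^sup>+u. of_bool (lab (pts \<omega>)) * cluster_indicator n m (y (pts \<omega>)) u \<partial>Pi\<^sub>M ?I (\<lambda>_. unif))"
      by (rule nn_integral_relabelled_marks[OF inj I]) (use ci in auto)
    also have "\<dots> = of_bool (lab (pts \<omega>)) * (\<integral>\<^sup>+u. cluster_indicator n m (y (pts \<omega>)) u \<partial>Pi\<^sub>M ?I (\<lambda>_. unif))"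
      by (rule nn_integral_cmult[OF ci])
    finally show "(\<integral>\<^sup>+\<omega>'. H (pts \<omega>, marks \<omega>') \<partial>M) = indicator {\<omega>. indices B \<omega> = \<tau> ` {..<m}} \<omega> *
      (connection_prob \<phi> n (y (pts \<omega>)) * (\<Prod>j\<in>{n<..m}. avoid_prob \<phi> n (y (pts \<omega>)) (y (pts \<omega>) j)))"
      unfolding nn_integral_cluster_indicator lab_eq by (simp add: indicator_def)
  qed
  finally show ?thesis unfolding y_eq .
qed

text \<open>
If the cluster has \<open>n + 1\<close> points, then the orderings that list its \<open>n\<close> Poisson points first consist of
an ordering of these and an ordering of the other \<open>m - n\<close> points.
\<close>

lemma card_cluster_tuples:
  assumes lab: "finite (indices B \<omega>)" "card (indices B \<omega>) = m" and nm: "n \<le> m"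
  shows "card {\<tau>\<in>tuples m. indices B \<omega> = \<tau> ` {..<m} \<and>
      cluster_labels B v \<omega> = case_nat 0 (\<lambda>j. Suc (\<tau> j)) ` {..n}} =
    (if card (cluster_labels B v \<omega>) = Suc n then fact n * fact (m - n) else 0)"
    (is "card ?K = _")
proof -
  let ?J = "indices B \<omega>"
  let ?C = "cluster_labels B v \<omega>"
  have img: "case_nat 0 (\<lambda>j. Suc (\<tau> j)) ` {..n} = insert 0 (Suc ` \<tau> ` {..<n})" for \<tau> :: "nat \<Rightarrow> nat"
    by (simp add: lessThan_Suc_atMost[symmetric] lessThan_Suc_eq_insert_0 image_image)
  have sub: "?C \<subseteq> insert 0 (Suc ` ?J)" and zero: "0 \<in> ?C"
    unfolding cluster_labels_def by (rule component_subset) auto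
  define I where "I = {i. Suc i \<in> ?C}"
  have IJ: "I \<subseteq> ?J" using sub by (auto simp: I_def)
  have C: "?C = insert 0 (Suc ` I)"
  proof (intro set_eqI iffI)
    fix i assume "i \<in> ?C" then show "i \<in> insert 0 (Suc ` I)" by (cases i) (auto simp: I_def)
  next
    fix i assume "i \<in> insert 0 (Suc ` I)" then show "i \<in> ?C" using zero by (auto simp: I_def)
  qed
  have "finite I" using IJ lab finite_subset by blast
  then have cardC: "card ?C = Suc (card I)" unfolding C by (simp add: card_image)
  have CI: "?C = case_nat 0 (\<lambda>j. Suc (\<tau> j)) ` {..n} \<longleftrightarrow> \<tau> ` {..<n} = I" for \<tau> :: "nat \<Rightarrow> nat"
  proof -
    have "Suc ` I = Suc ` \<tau> ` {..<n} \<longleftrightarrow> I = \<tau> ` {..<n}" by (rule inj_image_eq_iff) simp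
    moreover have "insert 0 (Suc ` I) = insert 0 (Suc ` \<tau> ` {..<n}) \<longleftrightarrow> Suc ` I = Suc ` \<tau> ` {..<n}"
      by (rule insert_ident) auto
    ultimately show ?thesis unfolding C img by auto
  qed
  have K: "?K = {\<tau> \<in> {..<m} \<rightarrow>\<^sub>E ?J. bij_betw \<tau> {..<m} ?J \<and> \<tau> ` {..<n} = I}"
    unfolding CI tuples_def bij_betw_def by (auto simp: PiE_def)
  show ?thesis
  proof (cases "card I = n")
    case True
    then show ?thesis unfolding K using card_bijections_onto_prefix[OF lab IJ True] cardC by simp
  next
    case False
    have K0: "?K = {}"
    proof (rule equals0I)
      fix \<tau> assume "\<tau> \<in> ?K"
      then have "inj_on \<tau> {..<m}" "\<tau> ` {..<n} = I" unfolding K by (auto simp: bij_betw_def)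
      then have "card I = n" using nm card_image[OF inj_on_subset[of \<tau> "{..<m}" "{..<n}"]] by auto
      then show False using False by simp
    qed
    show ?thesis unfolding K0 using False cardC by simp
  qed
qed

text \<open>
Summing over the orderings that list the cluster first turns the probability into an integral
with respect to \<open>tuple_measure\<close>, hence to a product measure. The points outside the cluster are
integrated out one by one, each contributing the factor \<open>free_measure\<close>.
\<close>

lemma cluster_card_prob_given_count:
  assumes B[measurable]: "B \<in> sets borel" and fin: "emeasure lam B < \<infinity>" and nm: "n \<le> m"
  shows "of_nat (fact n * fact (m - n)) * emeasure M {\<omega>\<in>space M. finite (indices B \<omega>) \<and>
      card (indices B \<omega>) = m \<and> card (cluster_labels B v \<omega>) = Suc n} =
    ennreal (exp (- (t * measure lam B)) * t ^ m) *
    (\<integral>\<^sup>+x. connection_prob \<phi> n (case_nat v x) * free_measure \<phi> lam B n (case_nat v x) ^ (m - n)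
      \<partial>power_on lam B n)"
proof -
  interpret R: finite_measure "measure_on lam B"
    using finite_measure_measure_on[OF _ fin] by (simp add: sets_lam)
  interpret P: product_sigma_finite "\<lambda>_::nat. measure_on lam B" ..
  interpret Tp: sigma_finite_measure "count_space (tuples m)"
    by (rule sigma_finite_measure_count_space_countable[OF countable_tuples])
  interpret TM: pair_sigma_finite "count_space (tuples m)" M ..
  let ?E = "{\<omega>\<in>space M. finite (indices B \<omega>) \<and>
      card (indices B \<omega>) = m \<and> card (cluster_labels B v \<omega>) = Suc n}"
  let ?g = "\<lambda>\<tau> \<omega>. indicator {\<omega>. indices B \<omega> = \<tau> ` {..<m}} \<omega> *
      indicator {\<omega>. cluster_labels B v \<omega> = case_nat 0 (\<lambda>j. Suc (\<tau> j)) ` {..n}} \<omega> :: ennreal"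
  let ?y = "\<lambda>x. case_nat v x"
  let ?h = "\<lambda>x. connection_prob \<phi> n (?y x) * (\<Prod>j\<in>{n<..m}. avoid_prob \<phi> n (?y x) (?y x j))"
  have E[measurable]: "?E \<in> sets M" by measurable
  have count: "(\<integral>\<^sup>+\<tau>. ?g \<tau> \<omega> \<partial>count_space (tuples m)) = of_nat (fact n * fact (m - n)) * indicator ?E \<omega>"
    if \<omega>: "\<omega> \<in> space M" for \<omega>
  proof -
    let ?K = "{\<tau>\<in>tuples m. indices B \<omega> = \<tau> ` {..<m} \<and>
      cluster_labels B v \<omega> = case_nat 0 (\<lambda>j. Suc (\<tau> j)) ` {..n}}"
    have "(\<integral>\<^sup>+\<tau>. ?g \<tau> \<omega> \<partial>count_space (tuples m)) = (\<integral>\<^sup>+\<tau>. indicator ?K \<tau> \<partial>count_space (tuples m))"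
      by (intro nn_integral_cong) (auto simp: indicator_def)
    also have "\<dots> = emeasure (count_space (tuples m)) ?K" by (intro nn_integral_indicator) auto
    finally have int: "(\<integral>\<^sup>+\<tau>. ?g \<tau> \<omega> \<partial>count_space (tuples m)) = emeasure (count_space (tuples m)) ?K" .
    show ?thesis
    proof (cases "finite (indices B \<omega>) \<and> card (indices B \<omega>) = m")
      case True
      have "?K \<subseteq> {..<m} \<rightarrow>\<^sub>E indices B \<omega>" by (auto simp: tuples_def PiE_def)
      then have "finite ?K" by (rule finite_subset) (use True in \<open>simp add: finite_PiE\<close>)
      then have "emeasure (count_space (tuples m)) ?K = of_nat (card ?K)"
        by (subst emeasure_count_space) auto
      then show ?thesis
        unfolding int using card_cluster_tuples[of B \<omega> m n v] True nm \<omega> by simp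
    next
      case False
      have "\<tau> \<notin> ?K" for \<tau> using False by (auto simp: tuples_def card_image)
      then have K0: "?K = {}" by blast
      show ?thesis unfolding int K0 using False by auto
    qed
  qed
  have gm: "(\<lambda>(\<tau>, \<omega>). ?g \<tau> \<omega>) \<in> borel_measurable (count_space (tuples m) \<Otimes>\<^sub>M M)"
  proof (rule measurable_pair_measure_countable1[OF countable_tuples])
    fix \<tau> :: "nat \<Rightarrow> nat"
    have [measurable]: "Measurable.pred M (\<lambda>\<omega>. cluster_labels B v \<omega> = S)" for S
      unfolding set_eq_iff by measurable
    have "(\<lambda>\<omega>. ?g \<tau> \<omega>) \<in> borel_measurable M" by measurable
    then show "(\<lambda>\<omega>. case (\<tau>, \<omega>) of (\<tau>, \<omega>) \<Rightarrow> ?g \<tau> \<omega>) \<in> borel_measurable M" by simp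
  qed
  have y_meas: "(\<lambda>x. ?y x i) \<in> borel_measurable (Pi\<^sub>M {..<k} (\<lambda>_. borel))" if "i \<le> k" for i k
    using that by (cases i) (auto intro: measurable_component_singleton)
  have h[measurable]: "?h \<in> borel_measurable (Pi\<^sub>M {..<m} (\<lambda>_. borel))"
    using nm by (intro borel_measurable_times_ennreal connection_prob_measurable borel_measurable_prod_ennreal
        avoid_prob_measurable y_meas) auto
  have sets_eq: "sets (Pi\<^sub>M J (\<lambda>_. measure_on lam B)) = sets (Pi\<^sub>M J (\<lambda>_. borel))" for J :: "nat set"
    by (intro sets_PiM_cong) (auto simp: sets_lam)
  have "of_nat (fact n * fact (m - n)) * emeasure M ?E = (\<integral>\<^sup>+\<omega>. of_nat (fact n * fact (m - n)) * indicator ?E \<omega> \<partial>M)"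
    by (rule nn_integral_cmult_indicator[symmetric]) (rule E)
  also have "\<dots> = (\<integral>\<^sup>+\<omega>. \<integral>\<^sup>+\<tau>. ?g \<tau> \<omega> \<partial>count_space (tuples m) \<partial>M)"
    by (intro nn_integral_cong) (simp only: count)
  also have "\<dots> = (\<integral>\<^sup>+\<tau>. \<integral>\<^sup>+\<omega>. ?g \<tau> \<omega> \<partial>M \<partial>count_space (tuples m))"
    by (rule TM.Fubini'[OF gm])
  also have "\<dots> = (\<integral>\<^sup>+\<tau>. \<integral>\<^sup>+\<omega>. indicator {\<omega>. indices B \<omega> = \<tau> ` {..<m}} \<omega> * ?h (tuple_points X m \<tau> \<omega>) \<partial>M \<partial>count_space (tuples m))"
    by (intro nn_integral_cong cluster_tuple_prob[OF B _ nm]) simp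
  also have "\<dots> = (\<integral>\<^sup>+x. ?h x \<partial>tuple_measure B m)"
    by (rule nn_integral_tuple_measure[OF B h, symmetric])
  also have "\<dots> = ennreal (exp (- (t * measure lam B)) * t ^ m) * (\<integral>\<^sup>+x. ?h x \<partial>power_on lam B m)"
    unfolding tuple_measure_eq[OF B fin] using h
    by (intro nn_integral_scale_measure) (simp cong: measurable_cong_sets add: sets_eq)
  also have "(\<integral>\<^sup>+x. ?h x \<partial>power_on lam B m) =
      (\<integral>\<^sup>+x. \<integral>\<^sup>+z. ?h (merge {..<n} {n..<m} (x, z)) \<partial>Pi\<^sub>M {n..<m} (\<lambda>_. measure_on lam B) \<partial>power_on lam B n)"
  proof -
    have U: "{..<m} = {..<n} \<union> {n..<m}" using nm by auto
    have "?h \<in> borel_measurable (Pi\<^sub>M ({..<n} \<union> {n..<m}) (\<lambda>_. measure_on lam B))"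
      using h unfolding U[symmetric] by (simp cong: measurable_cong_sets add: sets_eq)
    then show ?thesis unfolding U by (intro P.product_nn_integral_fold) auto
  qed
  also have "\<dots> = (\<integral>\<^sup>+x. connection_prob \<phi> n (?y x) * free_measure \<phi> lam B n (?y x) ^ (m - n)
      \<partial>power_on lam B n)"
  proof (rule nn_integral_cong)
    fix x :: "nat \<Rightarrow> 'a"
    have hm: "?h (merge {..<n} {n..<m} (x, z)) = connection_prob \<phi> n (?y x) * (\<Prod>j\<in>{n..<m}. avoid_prob \<phi> n (?y x) (z j))" for z
    proof -
      let ?w = "?y (merge {..<n} {n..<m} (x, z))"
      have w: "?w i = ?y x i" if "i \<le> n" for i using that by (cases i) (auto simp: merge_def)
      have "component {..n} (edge \<phi> ?w u) 0 = component {..n} (edge \<phi> (?y x) u) 0" for u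
        by (rule component_cong) (use w in \<open>auto simp: edge_def\<close>)
      then have "connection_prob \<phi> n ?w = connection_prob \<phi> n (?y x)" unfolding connection_prob_def by simp
      moreover have "avoid_prob \<phi> n ?w a = avoid_prob \<phi> n (?y x) a" for a
        unfolding avoid_prob_def by (intro prod.cong refl) (use w in auto)
      moreover have "(\<Prod>j\<in>{n<..m}. avoid_prob \<phi> n (?y x) (?w j)) = (\<Prod>j\<in>{n..<m}. avoid_prob \<phi> n (?y x) (?w (Suc j)))"
      proof -
        have eq: "{n<..m} = Suc ` {n..<m}" by (auto simp: image_Suc_atLeastLessThan)
        have "(\<Prod>j\<in>Suc ` {n..<m}. g j) = (\<Prod>j\<in>{n..<m}. g (Suc j))" for g :: "nat \<Rightarrow> ennreal"
          by (subst prod.reindex) auto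
        then show ?thesis unfolding eq .
      qed
      moreover have "\<dots> = (\<Prod>j\<in>{n..<m}. avoid_prob \<phi> n (?y x) (z j))"
        by (intro prod.cong refl) (auto simp: merge_def)
      ultimately show ?thesis by simp
    qed
    have am: "(\<lambda>a. avoid_prob \<phi> n (?y x) a) \<in> borel_measurable (measure_on lam B)"
      by (intro avoid_prob_measurable) (auto simp: sets_lam cong: measurable_cong_sets)
    have "(\<integral>\<^sup>+z. ?h (merge {..<n} {n..<m} (x, z)) \<partial>Pi\<^sub>M {n..<m} (\<lambda>_. measure_on lam B)) =
        connection_prob \<phi> n (?y x) * (\<integral>\<^sup>+z. (\<Prod>j\<in>{n..<m}. avoid_prob \<phi> n (?y x) (z j)) \<partial>Pi\<^sub>M {n..<m} (\<lambda>_. measure_on lam B))"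
      unfolding hm
    proof (intro nn_integral_cmult borel_measurable_prod_ennreal)
      fix j assume "j \<in> {n..<m}"
      then have "(\<lambda>z. z j) \<in> measurable (Pi\<^sub>M {n..<m} (\<lambda>_. measure_on lam B)) (measure_on lam B)"
        by (rule measurable_component_singleton)
      then show "(\<lambda>z. avoid_prob \<phi> n (?y x) (z j)) \<in> borel_measurable (Pi\<^sub>M {n..<m} (\<lambda>_. measure_on lam B))"
        by (rule measurable_compose[OF _ am])
    qed
    also have "(\<integral>\<^sup>+z. (\<Prod>j\<in>{n..<m}. avoid_prob \<phi> n (?y x) (z j)) \<partial>Pi\<^sub>M {n..<m} (\<lambda>_. measure_on lam B)) =
        (\<Prod>j\<in>{n..<m}. free_measure \<phi> lam B n (?y x))"
      unfolding free_measure_def by (rule P.product_nn_integral_prod) (use am in auto)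
    finally show "(\<integral>\<^sup>+z. ?h (merge {..<n} {n..<m} (x, z)) \<partial>Pi\<^sub>M {n..<m} (\<lambda>_. measure_on lam B)) =
        connection_prob \<phi> n (?y x) * free_measure \<phi> lam B n (?y x) ^ (m - n)" by simp
  qed
  finally show ?thesis .
qed

text \<open>
Summation over the number of points outside the cluster produces an exponential series, which turns
\<open>exp (- t \<lambda>(B))\<close> into \<open>exp (- t a)\<close>.
\<close>

lemma cluster_card_prob:
  assumes B[measurable]: "B \<in> sets borel" and fin: "emeasure lam B < \<infinity>"
  shows "emeasure M {\<omega>\<in>space M. finite (indices B \<omega>) \<and> card (cluster_labels B v \<omega>) = Suc n} =
    ennreal (t ^ n) * (\<integral>\<^sup>+x. (ennreal (1 / fact n) * connection_prob \<phi> n (case_nat v x)) *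
      ennreal (exp (- (t * exposed_measure \<phi> lam B n (case_nat v x)))) \<partial>power_on lam B n)"
proof -
  interpret R: finite_measure "measure_on lam B"
    using finite_measure_measure_on[OF _ fin] by (simp add: sets_lam)
  define \<Lambda> where "\<Lambda> = measure lam B"
  let ?N = "power_on lam B n"
  let ?c = "\<lambda>x. connection_prob \<phi> n (case_nat v x)"
  let ?W = "\<lambda>x. free_measure \<phi> lam B n (case_nat v x)"
  define E where "E m = {\<omega>\<in>space M. finite (indices B \<omega>) \<and>
      card (indices B \<omega>) = m \<and> card (cluster_labels B v \<omega>) = Suc n}" for m
  have E[measurable]: "E m \<in> sets M" for m unfolding E_def by measurable
  define a where "a j = exp (- (t * \<Lambda>)) * t ^ (n + j) / (fact n * fact j)" for j
  have a0: "a j \<ge> 0" for j unfolding a_def using t by simp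
  have Ej: "emeasure M (E (n + j)) = ennreal (a j) * (\<integral>\<^sup>+x. ?c x * ?W x ^ j \<partial>?N)" for j
  proof -
    let ?I = "\<integral>\<^sup>+x. ?c x * ?W x ^ j \<partial>?N"
    have eq: "of_nat (fact n * fact j) * emeasure M (E (n + j)) = ennreal (exp (- (t * \<Lambda>)) * t ^ (n + j)) * ?I"
      using cluster_card_prob_given_count[OF B fin, of n "n + j" v] by (simp add: E_def \<Lambda>_def)
    have inv: "ennreal (1 / (fact n * fact j)) * of_nat (fact n * fact j) = 1"
      by (simp add: ennreal_of_nat_eq_real_of_nat ennreal_mult[symmetric])
    have "emeasure M (E (n + j)) = ennreal (1 / (fact n * fact j)) * (of_nat (fact n * fact j) * emeasure M (E (n + j)))"
      unfolding mult.assoc[symmetric] inv by simp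
    also have "\<dots> = ennreal (1 / (fact n * fact j)) * ennreal (exp (- (t * \<Lambda>)) * t ^ (n + j)) * ?I"
      unfolding eq mult.assoc ..
    also have "ennreal (1 / (fact n * fact j)) * ennreal (exp (- (t * \<Lambda>)) * t ^ (n + j)) = ennreal (a j)"
      unfolding a_def using t by (subst ennreal_mult[symmetric]) auto
    finally show ?thesis .
  qed
  have sub: "card (cluster_labels B v \<omega>) \<le> Suc (card (indices B \<omega>))" if "finite (indices B \<omega>)" for \<omega>
  proof -
    have "cluster_labels B v \<omega> \<subseteq> insert 0 (Suc ` indices B \<omega>)"
      unfolding cluster_labels_def by (rule component_subset) auto
    then have "card (cluster_labels B v \<omega>) \<le> card (insert 0 (Suc ` indices B \<omega>))"
      using that by (intro card_mono) auto
    also have "\<dots> = Suc (card (indices B \<omega>))" using that by (subst card_insert_disjoint) (auto simp: card_image)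
    finally show ?thesis .
  qed
  have U: "{\<omega>\<in>space M. finite (indices B \<omega>) \<and> card (cluster_labels B v \<omega>) = Suc n} = (\<Union>j. E (n + j))"
  proof (intro set_eqI iffI)
    fix \<omega> assume \<omega>: "\<omega> \<in> {\<omega>\<in>space M. finite (indices B \<omega>) \<and> card (cluster_labels B v \<omega>) = Suc n}"
    then have "n \<le> card (indices B \<omega>)" using sub[of \<omega>] by auto
    then have "\<omega> \<in> E (n + (card (indices B \<omega>) - n))" using \<omega> by (auto simp: E_def)
    then show "\<omega> \<in> (\<Union>j. E (n + j))" by blast
  qed (auto simp: E_def)
  have y_meas: "(\<lambda>x. case_nat v x i) \<in> borel_measurable ?N" if "i \<le> n" for i
  proof (cases i)
    case (Suc j)
    have "(\<lambda>x. x j) \<in> measurable ?N (measure_on lam B)" using Suc that by (intro measurable_component_singleton) auto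
    then show ?thesis using Suc by (simp cong: measurable_cong_sets add: sets_lam)
  qed simp
  have c_meas[measurable]: "?c \<in> borel_measurable ?N" by (intro connection_prob_measurable y_meas)
  have W_meas[measurable]: "?W \<in> borel_measurable ?N"
    by (rule free_measure_measurable[OF sets_lam R.finite_measure_axioms y_meas])
  have pointwise: "(\<Sum>j. ennreal (a j) * (?c x * ?W x ^ j)) = ennreal (t ^ n) * ((ennreal (1 / fact n) * ?c x) *
      ennreal (exp (- (t * exposed_measure \<phi> lam B n (case_nat v x)))))" for x
  proof -
    define w where "w = enn2real (?W x)"
    have "?W x < \<infinity>" using free_measure_le[OF sets_lam B] fin le_less_trans by blast
    then have w: "?W x = ennreal w" unfolding w_def by (simp add: less_top)
    have w0: "w \<ge> 0" by (simp add: w_def)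
    have s1: "(\<lambda>j. exp (- (t * \<Lambda>)) * t ^ n / fact n * ((t * w) ^ j /\<^sub>R fact j)) sums (exp (- (t * \<Lambda>)) * t ^ n / fact n * exp (t * w))"
      by (intro sums_mult exp_converges)
    have s2: "exp (- (t * \<Lambda>)) * t ^ n / fact n * ((t * w) ^ j /\<^sub>R fact j) = a j * w ^ j" for j
      by (simp add: a_def power_add power_mult_distrib divide_inverse mult_ac)
    have s3: "exp (- (t * \<Lambda>)) * t ^ n / fact n * exp (t * w) = t ^ n * (1 / fact n * exp (- (t * (\<Lambda> - w))))"
    proof -
      have "exp (- (t * \<Lambda>)) * exp (t * w) = exp (- (t * (\<Lambda> - w)))"
        unfolding exp_add[symmetric] by (simp add: algebra_simps)
      then show ?thesis by simp
    qed
    have sums: "(\<lambda>j. a j * w ^ j) sums (t ^ n * (1 / fact n * exp (- (t * (\<Lambda> - w)))))"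
      using s1 unfolding s2 s3 .
    have "(\<Sum>j. ennreal (a j) * (?c x * ?W x ^ j)) = (\<Sum>j. ?c x * ennreal (a j * w ^ j))"
      unfolding w using a0 w0 by (simp add: ennreal_mult ennreal_power mult_ac)
    also have "\<dots> = ?c x * (\<Sum>j. ennreal (a j * w ^ j))" by (rule ennreal_suminf_cmult)
    also have "(\<Sum>j. ennreal (a j * w ^ j)) = ennreal (t ^ n * (1 / fact n * exp (- (t * (\<Lambda> - w)))))"
      using sums a0 w0 by (subst suminf_ennreal2) (auto simp: sums_iff)
    also have "\<dots> = ennreal (t ^ n) * (ennreal (1 / fact n) * ennreal (exp (- (t * (\<Lambda> - w)))))"
    proof -
      have mul: "ennreal (b * (c * d)) = ennreal b * (ennreal c * ennreal d)" if "b \<ge> 0" "c \<ge> 0" "d \<ge> 0" for b c d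
        using that by (simp add: ennreal_mult)
      show ?thesis by (rule mul) (use t in auto)
    qed
    finally show ?thesis by (simp only: exposed_measure_def \<Lambda>_def w_def mult_ac)
  qed
  have W_meas': "(\<lambda>x. ?c x * ?W x ^ j) \<in> borel_measurable ?N" for j by measurable
  have "emeasure M (\<Union>j. E (n + j)) = (\<Sum>j. emeasure M (E (n + j)))"
    by (rule suminf_emeasure[symmetric]) (auto simp: disjoint_family_on_def E_def)
  also have "\<dots> = (\<Sum>j. \<integral>\<^sup>+x. ennreal (a j) * (?c x * ?W x ^ j) \<partial>?N)"
    unfolding Ej by (intro suminf_cong nn_integral_cmult[symmetric] W_meas')
  also have "\<dots> = (\<integral>\<^sup>+x. (\<Sum>j. ennreal (a j) * (?c x * ?W x ^ j)) \<partial>?N)"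
    by (rule nn_integral_suminf[symmetric]) measurable
  also have "\<dots> = (\<integral>\<^sup>+x. ennreal (t ^ n) * ((ennreal (1 / fact n) * ?c x) *
      ennreal (exp (- (t * exposed_measure \<phi> lam B n (case_nat v x))))) \<partial>?N)"
    unfolding pointwise ..
  also have "\<dots> = ennreal (t ^ n) * (\<integral>\<^sup>+x. (ennreal (1 / fact n) * ?c x) *
      ennreal (exp (- (t * exposed_measure \<phi> lam B n (case_nat v x)))) \<partial>?N)"
    unfolding exposed_measure_def by (intro nn_integral_cmult) measurable
  finally show ?thesis unfolding U .
qed

end

section \<open>Distinct points and exhaustion of the cluster\<close>

lemma pred_eq_borel[measurable (raw)]:
  fixes f g :: "'w \<Rightarrow> 'a::{metric_space, second_countable_topology}"
  assumes [measurable]: "f \<in> borel_measurable M" "g \<in> borel_measurable M"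
  shows "Measurable.pred M (\<lambda>x. f x = g x)"
proof -
  have "Measurable.pred M (\<lambda>x. dist (f x) (g x) = 0)" by measurable
  then show ?thesis by simp
qed

text \<open>
If \<open>g\<close> does not depend on the coordinate \<open>a\<close>, then integrating over this coordinate first leaves
the measure of a single point.
\<close>

lemma (in product_sigma_finite) AE_PiM_coordinate_neq:
  assumes I: "finite I" "a \<in> I"
    and null: "\<And>z. emeasure (M a) {z} = 0" and sing: "\<And>z. {z} \<in> sets (M a)"
    and meas: "{x\<in>space (Pi\<^sub>M I M). x a = g x} \<in> sets (Pi\<^sub>M I M)"
    and g: "\<And>x z. g (x(a := z)) = g x"
  shows "AE x in Pi\<^sub>M I M. x a \<noteq> g x"
proof -
  let ?D = "{x\<in>space (Pi\<^sub>M I M). x a = g x}"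
  have I': "insert a (I - {a}) = I" using I by auto
  have "emeasure (Pi\<^sub>M I M) ?D = (\<integral>\<^sup>+x. indicator ?D x \<partial>Pi\<^sub>M (insert a (I - {a})) M)"
    unfolding I' using meas by simp
  also have "\<dots> = (\<integral>\<^sup>+x. \<integral>\<^sup>+z. indicator ?D (x(a := z)) \<partial>M a \<partial>Pi\<^sub>M (I - {a}) M)"
  proof (rule product_nn_integral_insert)
    show "(\<lambda>x. indicator ?D x :: ennreal) \<in> borel_measurable (Pi\<^sub>M (insert a (I - {a})) M)"
      unfolding I' using meas by simp
  qed (use I in auto)
  also have "\<dots> \<le> (\<integral>\<^sup>+x. 0 \<partial>Pi\<^sub>M (I - {a}) M)"
  proof (rule nn_integral_mono)
    fix x
    have "(\<integral>\<^sup>+z. indicator ?D (x(a := z)) \<partial>M a) \<le> (\<integral>\<^sup>+z. indicator {g x} z \<partial>M a)"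
      by (intro nn_integral_mono) (auto simp: indicator_def g)
    also have "\<dots> = 0" using sing null by simp
    finally show "(\<integral>\<^sup>+z. indicator ?D (x(a := z)) \<partial>M a) \<le> 0" .
  qed
  finally have "emeasure (Pi\<^sub>M I M) ?D = 0" by simp
  then show ?thesis by (intro AE_I[OF _ _ meas]) auto
qed

context poisson_input begin

text \<open>
Since the restriction of \<open>\<lambda>\<close> to \<open>B\<close> is diffuse, its powers do not charge the diagonals, and by
\<open>tuple_measure_eq\<close> neither does the measure of the ordered configurations.
\<close>

lemma AE_distinct_points_in:
  assumes B[measurable]: "B \<in> sets borel" and fin: "emeasure lam B < \<infinity>"
    and diffuse: "\<And>x. emeasure lam {x} = 0"
  shows "AE \<omega> in M. \<forall>i\<in>indices B \<omega>. X i \<omega> \<noteq> v \<and> (\<forall>j\<in>indices B \<omega>. i \<noteq> j \<longrightarrow> X i \<omega> \<noteq> X j \<omega>)"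
proof -
  interpret R: finite_measure "measure_on lam B"
    using finite_measure_measure_on[OF _ fin] by (simp add: sets_lam)
  interpret P: product_sigma_finite "\<lambda>_::nat. measure_on lam B" ..
  define bad where "bad m x \<longleftrightarrow> (\<exists>a<m. x a = v \<or> (\<exists>b<m. a \<noteq> b \<and> x a = x b))" for m and x :: "nat \<Rightarrow> 'a"
  have null: "emeasure (measure_on lam B) {z} = 0" for z
    using emeasure_mono[of "{z} \<inter> B" "{z}" lam] diffuse[of z] by (simp add: emeasure_measure_on sets_lam)
  have comp[measurable]: "(\<lambda>x. x a) \<in> borel_measurable (power_on lam B m)" if "a < m" for a m
  proof -
    have "(\<lambda>x. x a) \<in> measurable (power_on lam B m) (measure_on lam B)"
      using that by (intro measurable_component_singleton) auto
    then show ?thesis by (simp cong: measurable_cong_sets add: sets_lam)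
  qed
  have ae_bad: "AE x in power_on lam B m. \<not> bad m x" for m
  proof -
    have 1: "AE x in power_on lam B m. x a \<noteq> v" if "a \<in> {..<m}" for a
    proof (rule P.AE_PiM_coordinate_neq)
      have "Measurable.pred (power_on lam B m) (\<lambda>x. x a = v)"
        using comp[of a m] that by (intro pred_eq_borel) auto
      then show "{x \<in> space (power_on lam B m). x a = v} \<in> sets (power_on lam B m)"
        by (simp add: pred_def)
    qed (use that null in \<open>auto simp: sets_lam\<close>)
    have 2: "AE x in power_on lam B m. x a \<noteq> x b" if "(a, b) \<in> {(a, b). a < m \<and> b < m \<and> a \<noteq> b}" for a b
    proof (rule P.AE_PiM_coordinate_neq)
      have "Measurable.pred (power_on lam B m) (\<lambda>x. x a = x b)"
        using comp[of a m] comp[of b m] that by (intro pred_eq_borel) auto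
      then show "{x \<in> space (power_on lam B m). x a = x b} \<in> sets (power_on lam B m)"
        by (simp add: pred_def)
    qed (use that null in \<open>auto simp: sets_lam\<close>)
    have "AE x in power_on lam B m. \<forall>a\<in>{..<m}. x a \<noteq> v"
      using 1 by (intro AE_ball_countable[THEN iffD2]) auto
    moreover have "AE x in power_on lam B m. \<forall>p\<in>{(a, b). a < m \<and> b < m \<and> a \<noteq> b}. x (fst p) \<noteq> x (snd p)"
      using 2 by (intro AE_ball_countable[THEN iffD2]) auto
    ultimately show ?thesis by eventually_elim (auto simp: bad_def)
  qed
  have badm[measurable]: "Measurable.pred (Pi\<^sub>M {..<m} (\<lambda>_. borel)) (bad m)" for m
  proof -
    have "Measurable.pred (Pi\<^sub>M {..<m} (\<lambda>_. borel)) (\<lambda>x. \<exists>a\<in>{..<m}. x a = v \<or> (\<exists>b\<in>{..<m}. a \<noteq> b \<and> x a = x b))"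
      by measurable
    moreover have "bad m = (\<lambda>x. \<exists>a\<in>{..<m}. x a = v \<or> (\<exists>b\<in>{..<m}. a \<noteq> b \<and> x a = x b))"
      by (auto simp: bad_def fun_eq_iff)
    ultimately show ?thesis by simp
  qed
  have ind[measurable]: "(\<lambda>x. indicator {x. bad m x} x :: ennreal) \<in> borel_measurable (Pi\<^sub>M {..<m} (\<lambda>_. borel))" for m
    using badm[of m] by (simp add: indicator_def)
  have tuple: "AE \<omega> in M. \<not> (indices B \<omega> = \<tau> ` {..<m} \<and> bad m (tuple_points X m \<tau> \<omega>))"
    if \<tau>: "\<tau> \<in> tuples m" for m \<tau>
  proof -
    have sets_eq: "sets (power_on lam B m) = sets (Pi\<^sub>M {..<m} (\<lambda>_. borel))"
      by (intro sets_PiM_cong) (auto simp: sets_lam)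
    have "(\<integral>\<^sup>+x. indicator {x. bad m x} x \<partial>power_on lam B m) = (\<integral>\<^sup>+x. 0 \<partial>power_on lam B m)"
      using ae_bad[of m] by (intro nn_integral_cong_AE) (auto simp: indicator_def)
    moreover have "(\<integral>\<^sup>+x. indicator {x. bad m x} x \<partial>tuple_measure B m) =
        ennreal (exp (- (t * measure lam B)) * t ^ m) * (\<integral>\<^sup>+x. indicator {x. bad m x} x \<partial>power_on lam B m)"
      unfolding tuple_measure_eq[OF B fin] using ind[of m]
      by (intro nn_integral_scale_measure) (simp cong: measurable_cong_sets add: sets_eq)
    ultimately have "(\<integral>\<^sup>+x. indicator {x. bad m x} x \<partial>tuple_measure B m) = 0" by simp
    then have "(\<integral>\<^sup>+\<tau>. (\<integral>\<^sup>+\<omega>. indicator {\<omega>. indices B \<omega> = \<tau> ` {..<m}} \<omega> *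
        indicator {x. bad m x} (tuple_points X m \<tau> \<omega>) \<partial>M) \<partial>count_space (tuples m)) = 0"
      unfolding nn_integral_tuple_measure[OF B ind] .
    then have "(\<integral>\<^sup>+\<omega>. indicator {\<omega>. indices B \<omega> = \<tau> ` {..<m}} \<omega> *
        indicator {x. bad m x} (tuple_points X m \<tau> \<omega>) \<partial>M) = 0"
      using \<tau> by (subst (asm) nn_integral_0_iff_AE) (auto simp: AE_count_space)
    then have "AE \<omega> in M. indicator {\<omega>. indices B \<omega> = \<tau> ` {..<m}} \<omega> *
        indicator {x. bad m x} (tuple_points X m \<tau> \<omega>) = (0 :: ennreal)"
      by (subst (asm) nn_integral_0_iff_AE) auto
    then show ?thesis by eventually_elim (auto simp: indicator_def split: if_splits)
  qed
  have "AE \<omega> in M. \<forall>m. \<forall>\<tau>\<in>tuples m. \<not> (indices B \<omega> = \<tau> ` {..<m} \<and> bad m (tuple_points X m \<tau> \<omega>))"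
    using tuple by (intro AE_all_countable[THEN iffD2] allI AE_ball_countable[OF countable_tuples, THEN iffD2]) auto
  with AE_finite_labels_in[OF B fin] show ?thesis
  proof eventually_elim
    case (elim \<omega>)
    let ?J = "indices B \<omega>" let ?m = "card ?J"
    obtain h where h: "bij_betw h {0..<?m} ?J" using ex_bij_betw_nat_finite[OF elim(1)] by auto
    define \<tau> where "\<tau> = restrict h {..<?m}"
    have bij: "bij_betw \<tau> {..<?m} ?J"
      using h unfolding \<tau>_def by (subst bij_betw_cong[of _ _ h]) (auto simp: lessThan_atLeast0)
    then have \<tau>: "\<tau> \<in> tuples ?m" by (auto simp: tuples_def bij_betw_def \<tau>_def)
    have "?J = \<tau> ` {..<?m}" using bij by (simp add: bij_betw_def)
    with elim(2) \<tau> have nb: "\<not> bad ?m (tuple_points X ?m \<tau> \<omega>)" by blast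
    have tp: "tuple_points X ?m \<tau> \<omega> a = X (\<tau> a) \<omega>" if "a < ?m" for a using that by (simp add: tuple_points_def)
    show ?case
    proof (intro ballI conjI impI)
      fix i assume "i \<in> ?J"
      then obtain a where a: "a < ?m" "i = \<tau> a" using bij by (auto simp: bij_betw_def)
      then show "X i \<omega> \<noteq> v" using nb tp[of a] by (auto simp: bad_def)
      fix j assume "j \<in> ?J" "i \<noteq> j"
      then obtain b where b: "b < ?m" "j = \<tau> b" using bij by (auto simp: bij_betw_def)
      then have "a \<noteq> b" using a \<open>i \<noteq> j\<close> by auto
      have "tuple_points X ?m \<tau> \<omega> a \<noteq> tuple_points X ?m \<tau> \<omega> b"
        using nb a(1) b(1) \<open>a \<noteq> b\<close> unfolding bad_def by blast
      then show "X i \<omega> \<noteq> X j \<omega>" unfolding tp[OF a(1)] tp[OF b(1)] a(2) b(2) .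
    qed
  qed
qed

end

text \<open>
The cluster is a set of points and may be the image of several sets of labels. Selecting the least label
of every point expresses its cardinality through a random set of labels, for which measurability is a
countable matter. Measurability concerns all outcomes, including those where points coincide.
\<close>

definition first_representatives :: "(nat \<Rightarrow> 'b) \<Rightarrow> nat set \<Rightarrow> nat set" where
  "first_representatives f C = {i\<in>C. \<forall>j\<in>C. j < i \<longrightarrow> f j \<noteq> f i}"

lemma ecard_image_first_representatives: "ecard (f ` C) = ecard (first_representatives f C)"
proof -
  let ?D = "first_representatives f C"
  have inj: "inj_on f ?D"
  proof (rule inj_onI)
    fix i j assume "i \<in> ?D" "j \<in> ?D" "f i = f j"
    then show "i = j" by (cases i j rule: linorder_cases) (auto simp: first_representatives_def)
  qed
  have "f ` C = f ` ?D"
  proof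
    show "f ` C \<subseteq> f ` ?D"
    proof
      fix x assume "x \<in> f ` C"
      then obtain i where i: "i \<in> C \<and> f i = x" by auto
      define l where "l = (LEAST i. i \<in> C \<and> f i = x)"
      have l: "l \<in> C \<and> f l = x" unfolding l_def by (rule LeastI[of "\<lambda>i. i \<in> C \<and> f i = x", OF i])
      have "f j \<noteq> f l" if "j \<in> C" "j < l" for j
        using not_less_Least[of j "\<lambda>i. i \<in> C \<and> f i = x"] that l unfolding l_def[symmetric] by auto
      then show "x \<in> f ` ?D" using l by (auto simp: first_representatives_def)
    qed
  qed (auto simp: first_representatives_def)
  then show ?thesis using inj by (simp add: ecard_def card_image finite_image_iff)
qed

lemma ecard_image_inj: "inj_on f C \<Longrightarrow> ecard (f ` C) = ecard C"
  by (simp add: ecard_def card_image finite_image_iff)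

lemma extend_zero_ecard: "extend_zero f (ecard A) = (if finite A then f (card A) else 0)"
  by (simp add: extend_zero_def ecard_def)

context rcm begin

lemma labels_eq: "labels \<kappa> \<omega> = insert 0 (Suc ` indices UNIV \<omega>)"
  by (simp add: labels_def labels_in_def)

text \<open>
The edges are defined in terms of points, so a path of points lifts to a path of labels, even where
several labels share a point.
\<close>

lemma cluster_eq_image:
  "cluster \<phi> \<kappa> X U v \<omega> = vertex v X \<omega> `
    component (labels \<kappa> \<omega>) (\<lambda>i j. (vertex v X \<omega> i, vertex v X \<omega> j) \<in> rcm_edges \<phi> \<kappa> X U v \<omega>) 0"
proof -
  let ?f = "vertex v X \<omega>" and ?V = "labels \<kappa> \<omega>"
  have "rcm_edges \<phi> \<kappa> X U v \<omega> = {(x, z). x \<in> ?f ` ?V \<and> z \<in> ?f ` ?V \<and> (x, z) \<in> rcm_edges \<phi> \<kappa> X U v \<omega>}"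
    by (auto simp: rcm_edges_def)
  then have "cluster \<phi> \<kappa> X U v \<omega> = component (?f ` ?V) (\<lambda>x z. (x, z) \<in> rcm_edges \<phi> \<kappa> X U v \<omega>) (?f 0)"
    unfolding cluster_def component_def by (simp add: vertex_def)
  also have "\<dots> = ?f ` component ?V (\<lambda>i j. (?f i, ?f j) \<in> rcm_edges \<phi> \<kappa> X U v \<omega>) 0"
    by (rule component_image) (simp add: labels_def)
  finally show ?thesis .
qed

lemma cluster_size_measurable:
  "(\<lambda>\<omega>. extend_zero f (ecard (cluster \<phi> \<kappa> X U v \<omega>))) \<in> borel_measurable M"
proof -
  have lab[measurable]: "Measurable.pred M (\<lambda>\<omega>. i \<in> labels \<kappa> \<omega>)" for i
    unfolding labels_eq by (cases i) (simp_all add: image_iff)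
  have edge: "Measurable.pred M (\<lambda>\<omega>. (vertex v X \<omega> i, vertex v X \<omega> j) \<in> rcm_edges \<phi> \<kappa> X U v \<omega>)" for i j
  proof -
    let ?f = "\<lambda>\<omega>. vertex v X \<omega>"
    define close where "close i' j' \<omega> \<longleftrightarrow> i' \<noteq> j' \<and> U {i', j'} \<omega> \<le> \<phi> (?f \<omega> i') (?f \<omega> j')" for i' j' \<omega>
    have close[measurable]: "Measurable.pred M (close i' j')" for i' j'
    proof (cases "i' = j'")
      case False
      then have [measurable]: "U {i', j'} \<in> borel_measurable M" by (intro U_meas) (simp add: label_pairs_def)
      show ?thesis unfolding close_def[abs_def] by measurable
    qed (simp add: close_def[abs_def])
    have "Measurable.pred M (\<lambda>\<omega>. \<exists>i' j'. ?f \<omega> i = ?f \<omega> i' \<and> ?f \<omega> j = ?f \<omega> j' \<and> i' \<in> labels \<kappa> \<omega> \<and> j' \<in> labels \<kappa> \<omega> \<and>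
        \<not> ?f \<omega> i' = ?f \<omega> j' \<and> close i' j' \<omega>)"
      by measurable
    moreover have "(?f \<omega> i, ?f \<omega> j) \<in> rcm_edges \<phi> \<kappa> X U v \<omega> \<longleftrightarrow>
        (\<exists>i' j'. ?f \<omega> i = ?f \<omega> i' \<and> ?f \<omega> j = ?f \<omega> j' \<and> i' \<in> labels \<kappa> \<omega> \<and> j' \<in> labels \<kappa> \<omega> \<and>
        \<not> ?f \<omega> i' = ?f \<omega> j' \<and> close i' j' \<omega>)" for \<omega>
      unfolding rcm_edges_def close_def by auto
    ultimately show ?thesis by simp
  qed
  define C where "C \<omega> = component (labels \<kappa> \<omega>) (\<lambda>i j. (vertex v X \<omega> i, vertex v X \<omega> j) \<in> rcm_edges \<phi> \<kappa> X U v \<omega>) 0" for \<omega>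
  have C[measurable]: "Measurable.pred M (\<lambda>\<omega>. i \<in> C \<omega>)" for i
    unfolding C_def
  proof (rule pred_component[OF lab])
    note edge[measurable]
    show "Measurable.pred M (\<lambda>\<omega>. i \<in> labels \<kappa> \<omega> \<and> j \<in> labels \<kappa> \<omega> \<and>
        (vertex v X \<omega> i, vertex v X \<omega> j) \<in> rcm_edges \<phi> \<kappa> X U v \<omega>)" for i j
      by measurable
  qed
  define D where "D \<omega> = first_representatives (vertex v X \<omega>) (C \<omega>)" for \<omega>
  have D[measurable]: "Measurable.pred M (\<lambda>\<omega>. i \<in> D \<omega>)" for i
  proof -
    have "Measurable.pred M (\<lambda>\<omega>. i \<in> C \<omega> \<and> (\<forall>j. j \<in> C \<omega> \<longrightarrow> j < i \<longrightarrow> \<not> vertex v X \<omega> j = vertex v X \<omega> i))"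
      by measurable
    then show ?thesis by (simp add: D_def first_representatives_def Ball_def)
  qed
  have D': "{\<omega>\<in>space M. i \<in> D \<omega>} \<in> sets M" for i using D[of i] by (simp add: pred_def)
  have "Measurable.pred M (\<lambda>\<omega>. finite (D \<omega>))" "(\<lambda>\<omega>. card (D \<omega>)) \<in> measurable M (count_space UNIV)"
    using D' by (intro measurable_finite measurable_card; simp)+
  then have "(\<lambda>\<omega>. if finite (D \<omega>) then f (card (D \<omega>)) else 0) \<in> borel_measurable M"
    by (intro measurable_If) (auto simp: pred_def)
  moreover have "extend_zero f (ecard (cluster \<phi> \<kappa> X U v \<omega>)) = (if finite (D \<omega>) then f (card (D \<omega>)) else 0)" for \<omega>
    unfolding cluster_eq_image C_def[symmetric] ecard_image_first_representatives D_def[symmetric] extend_zero_ecard ..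
  ultimately show ?thesis by simp
qed

lemma ecard_cluster_eq:
  assumes "\<And>i. i \<in> indices UNIV \<omega> \<Longrightarrow> X i \<omega> \<noteq> v"
    and "\<And>i j. i \<in> indices UNIV \<omega> \<Longrightarrow> j \<in> indices UNIV \<omega> \<Longrightarrow> i \<noteq> j \<Longrightarrow> X i \<omega> \<noteq> X j \<omega>"
  shows "ecard (cluster \<phi> \<kappa> X U v \<omega>) = ecard (cluster_labels UNIV v \<omega>)"
proof -
  let ?f = "vertex v X \<omega>" and ?V = "labels \<kappa> \<omega>"
  have ne: "?f i \<noteq> ?f j" if ij: "i \<in> ?V" "j \<in> ?V" "i \<noteq> j" for i j
  proof (cases i)
    case 0
    then obtain b where "j = Suc b" "b \<in> indices UNIV \<omega>" using ij unfolding labels_eq by auto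
    then show ?thesis using 0 assms(1)[of b] by (auto simp: vertex_def)
  next
    case (Suc a)
    then have a: "a \<in> indices UNIV \<omega>" using ij unfolding labels_eq by auto
    show ?thesis
    proof (cases j)
      case 0 then show ?thesis using Suc assms(1)[OF a] by (simp add: vertex_def)
    next
      case (Suc b)
      then have "b \<in> indices UNIV \<omega>" "a \<noteq> b" using ij \<open>i = Suc a\<close> unfolding labels_eq by auto
      then show ?thesis using Suc \<open>i = Suc a\<close> assms(2)[OF a, of b] by (simp add: vertex_def)
    qed
  qed
  have inj: "inj_on ?f ?V" using ne by (auto simp: inj_on_def)
  have "component ?V (\<lambda>i j. (?f i, ?f j) \<in> rcm_edges \<phi> \<kappa> X U v \<omega>) 0 = component ?V (label_edge v \<omega>) 0"
  proof (rule component_cong)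
    fix i j assume ij: "i \<in> ?V" "j \<in> ?V"
    show "(?f i, ?f j) \<in> rcm_edges \<phi> \<kappa> X U v \<omega> \<longleftrightarrow> label_edge v \<omega> i j"
    proof
      assume "(?f i, ?f j) \<in> rcm_edges \<phi> \<kappa> X U v \<omega>"
      then obtain i' j' where "?f i = ?f i'" "?f j = ?f j'" "i' \<in> ?V" "j' \<in> ?V" "?f i' \<noteq> ?f j'"
        "U {i', j'} \<omega> \<le> \<phi> (?f i') (?f j')" unfolding rcm_edges_def by auto
      moreover from this have "i = i'" "j = j'" using ij inj by (auto simp: inj_on_def)
      ultimately show "label_edge v \<omega> i j" by (auto simp: label_edge_def)
    next
      assume "label_edge v \<omega> i j"
      then show "(?f i, ?f j) \<in> rcm_edges \<phi> \<kappa> X U v \<omega>"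
        using ij ne by (auto simp: label_edge_def rcm_edges_def)
    qed
  qed
  then have "cluster \<phi> \<kappa> X U v \<omega> = ?f ` cluster_labels UNIV v \<omega>"
    unfolding cluster_eq_image cluster_labels_def labels_eq by simp
  moreover have "cluster_labels UNIV v \<omega> \<subseteq> ?V"
    unfolding cluster_labels_def labels_eq by (rule component_subset) simp
  ultimately show ?thesis using ecard_image_inj[OF inj_on_subset[OF inj]] by simp
qed

lemma cluster_labels_mono: "B \<subseteq> B' \<Longrightarrow> cluster_labels B v \<omega> \<subseteq> cluster_labels B' v \<omega>"
  unfolding cluster_labels_def by (rule component_mono) (auto simp: labels_in_def)

text \<open>
A path in the full graph has finitely many vertices and therefore lies in one of the sets \<open>B k\<close>.
\<close>

lemma cluster_labels_exhaust:
  fixes B :: "nat \<Rightarrow> 'a set"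
  assumes mono: "\<And>k l. k \<le> l \<Longrightarrow> B k \<subseteq> B l" and cover: "(\<Union>k. B k) = UNIV"
  shows "cluster_labels UNIV v \<omega> = (\<Union>k. cluster_labels (B k) v \<omega>)"
proof
  show "(\<Union>k. cluster_labels (B k) v \<omega>) \<subseteq> cluster_labels UNIV v \<omega>"
    using cluster_labels_mono[of _ UNIV] by blast
  have V: "\<exists>k. i \<in> insert 0 (Suc ` indices (B k) \<omega>)" if "i \<in> insert 0 (Suc ` indices UNIV \<omega>)" for i
  proof (cases i)
    case (Suc n)
    then have "enat n < \<kappa> \<omega>" using that by (auto simp: labels_in_def)
    moreover obtain k where "X n \<omega> \<in> B k" using cover by blast
    ultimately show ?thesis using Suc by (auto simp: labels_in_def)
  qed auto
  have Vm: "insert 0 (Suc ` indices (B k) \<omega>) \<subseteq> insert 0 (Suc ` indices (B l) \<omega>)" if "k \<le> l" for k l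
    using mono[OF that] by (auto simp: labels_in_def)
  show "cluster_labels UNIV v \<omega> \<subseteq> (\<Union>k. cluster_labels (B k) v \<omega>)"
  proof
    fix i assume "i \<in> cluster_labels UNIV v \<omega>"
    then show "i \<in> (\<Union>k. cluster_labels (B k) v \<omega>)"
      unfolding cluster_labels_def[of UNIV]
    proof (induction rule: component_induct)
      case root then show ?case by (simp add: cluster_labels_def)
    next
      case (step i j)
      obtain k1 where k1: "i \<in> cluster_labels (B k1) v \<omega>" using step by auto
      obtain k2 k3 where k2: "i \<in> insert 0 (Suc ` indices (B k2) \<omega>)"
        and k3: "j \<in> insert 0 (Suc ` indices (B k3) \<omega>)" using V step by meson
      define k where "k = max k1 (max k2 k3)"
      have le: "k1 \<le> k" "k2 \<le> k" "k3 \<le> k" by (auto simp: k_def)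
      have ik: "i \<in> cluster_labels (B k) v \<omega>"
        by (rule subsetD[OF cluster_labels_mono[OF mono[OF le(1)]] k1])
      have "j \<in> cluster_labels (B k) v \<omega>"
        using component_step[OF ik[unfolded cluster_labels_def] subsetD[OF Vm[OF le(2)] k2]
            subsetD[OF Vm[OF le(3)] k3] \<open>label_edge v \<omega> i j\<close>] unfolding cluster_labels_def .
      then show ?case by blast
    qed
  qed
qed

end

text \<open>
The restriction to \<open>card (C k) \<le> k\<close> matches the partial sums of length \<open>k\<close>. If the union is infinite,
the cardinalities tend to infinity and the assumption on \<open>f\<close> agrees with the convention \<open>f \<infinity> = 0\<close>.
\<close>

lemma tendsto_card_exhaustion:
  fixes C :: "nat \<Rightarrow> nat set" and f :: "nat \<Rightarrow> real"
  assumes mono: "\<And>k l. k \<le> l \<Longrightarrow> C k \<subseteq> C l" and fin: "\<And>k. finite (C k)" and f: "f \<longlonglongrightarrow> 0"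
  shows "(\<lambda>k. if card (C k) \<le> k then f (card (C k)) else 0) \<longlonglongrightarrow> extend_zero f (ecard (\<Union>k. C k))"
proof -
  have contains: "\<exists>K. \<forall>k\<ge>K. A \<subseteq> C k" if "finite A" "A \<subseteq> (\<Union>k. C k)" for A
    using that
  proof (induction A rule: finite_induct)
    case (insert x A)
    then obtain K L where "\<forall>k\<ge>K. A \<subseteq> C k" "x \<in> C L" by auto
    then have "\<forall>k\<ge>max K L. insert x A \<subseteq> C k" using mono[of L] by fastforce
    then show ?case by blast
  qed auto
  show ?thesis
  proof (cases "finite (\<Union>k. C k)")
    case True
    then obtain K where K: "\<And>k. k \<ge> K \<Longrightarrow> (\<Union>k. C k) \<subseteq> C k" using contains[OF True] by blast
    have "eventually (\<lambda>k. (if card (C k) \<le> k then f (card (C k)) else 0) = extend_zero f (ecard (\<Union>k. C k))) sequentially"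
    proof (rule eventually_sequentiallyI)
      fix k assume k: "max K (card (\<Union>k. C k)) \<le> k"
      then have "C k = (\<Union>k. C k)" using K[of k] by auto
      then show "(if card (C k) \<le> k then f (card (C k)) else 0) = extend_zero f (ecard (\<Union>k. C k))"
        using True k by (simp add: extend_zero_ecard)
    qed
    then show ?thesis by (rule tendsto_eventually)
  next
    case False
    have "(\<lambda>k. if card (C k) \<le> k then f (card (C k)) else 0) \<longlonglongrightarrow> 0"
    proof (rule LIMSEQ_I)
      fix e :: real assume e: "e > 0"
      obtain N where N: "\<And>n. n \<ge> N \<Longrightarrow> \<bar>f n\<bar> < e" using LIMSEQ_D[OF f e] by auto
      obtain A where A: "A \<subseteq> (\<Union>k. C k)" "finite A" "card A = N"
        using infinite_arbitrarily_large[OF False] by metis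
      obtain K where K: "\<And>k. k \<ge> K \<Longrightarrow> A \<subseteq> C k" using contains[OF A(2,1)] by blast
      show "\<exists>no. \<forall>k\<ge>no. norm ((if card (C k) \<le> k then f (card (C k)) else 0) - 0) < e"
      proof (intro exI[of _ K] allI impI)
        fix k assume "K \<le> k"
        then have "N \<le> card (C k)" using card_mono[OF fin K] A by auto
        then show "norm ((if card (C k) \<le> k then f (card (C k)) else 0) - 0) < e" using N e by simp
      qed
    qed
    then show ?thesis using False by (simp add: extend_zero_ecard)
  qed
qed

context rcm begin

definition truncated_prob :: "'a set \<Rightarrow> nat \<Rightarrow> 'a \<Rightarrow> real" where
  "truncated_prob B n v = prob {\<omega>\<in>space M. finite (indices B \<omega>) \<and> card (cluster_labels B v \<omega>) = Suc n}"

lemma sum_truncated_prob_le_1: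
  assumes [measurable]: "B \<in> sets borel"
  shows "(\<Sum>n<k. truncated_prob B n v) \<le> 1"
proof -
  let ?E = "\<lambda>n. {\<omega>\<in>space M. finite (indices B \<omega>) \<and> card (cluster_labels B v \<omega>) = Suc n}"
  have "(\<Sum>n<k. truncated_prob B n v) = prob (\<Union>n\<in>{..<k}. ?E n)"
    unfolding truncated_prob_def
    by (rule finite_measure_finite_Union[symmetric]) (auto simp: disjoint_family_on_def)
  also have "\<dots> \<le> 1" by (rule prob_le_1)
  finally show ?thesis .
qed

text \<open>
Almost surely the points are distinct and finitely many in every \<open>B k\<close>, so that the truncated
clusters are finite and increase to the cluster; dominated convergence applies because \<open>f\<close> is bounded.
\<close>

lemma expectation_cluster_size_limit:
  fixes B :: "nat \<Rightarrow> 'a set"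
  assumes B[measurable]: "\<And>k. B k \<in> sets borel" and fin: "\<And>k. emeasure lam (B k) < \<infinity>"
    and mono: "\<And>k l. k \<le> l \<Longrightarrow> B k \<subseteq> B l" and cover: "(\<Union>k. B k) = UNIV"
    and diffuse: "\<And>x. emeasure lam {x} = 0" and f: "f \<longlonglongrightarrow> 0"
  shows "(\<lambda>k. \<Sum>n<k. f (Suc n) * truncated_prob (B k) n v) \<longlonglongrightarrow>
    expectation (\<lambda>\<omega>. extend_zero f (ecard (cluster \<phi> \<kappa> X U v \<omega>)))"
proof -
  let ?C = "\<lambda>k. cluster_labels (B k) v"
  let ?E = "\<lambda>k n. {\<omega>\<in>space M. finite (indices (B k) \<omega>) \<and> card (?C k \<omega>) = Suc n}"
  define h where "h k \<omega> = (\<Sum>n<k. f (Suc n) * indicator (?E k n) \<omega>)" for k \<omega>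
  have E[measurable]: "?E k n \<in> sets M" for k n by measurable
  have h_meas[measurable]: "h k \<in> borel_measurable M" for k unfolding h_def[abs_def] by measurable
  have h_eq: "h k \<omega> = (if finite (indices (B k) \<omega>) \<and> card (?C k \<omega>) \<noteq> 0 \<and> card (?C k \<omega>) \<le> k then f (card (?C k \<omega>)) else 0)"
    if \<omega>: "\<omega> \<in> space M" for k \<omega>
  proof (cases "card (?C k \<omega>)")
    case 0 then show ?thesis by (simp add: h_def)
  next
    case (Suc m)
    have "h k \<omega> = (\<Sum>n<k. if m = n then (if finite (indices (B k) \<omega>) then f (Suc n) else 0) else 0)"
      unfolding h_def using \<omega> Suc by (intro sum.cong refl) (auto simp: indicator_def)
    also have "\<dots> = (if m < k then (if finite (indices (B k) \<omega>) then f (Suc m) else 0) else 0)"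
      by (subst sum.delta') auto
    finally show ?thesis using Suc by auto
  qed
  obtain F where F: "\<And>n. \<bar>f n\<bar> \<le> F"
    using convergent_imp_Bseq[OF convergentI[OF f]] unfolding Bseq_def by auto
  have F0: "F \<ge> 0" using F[of 0] by linarith
  have int: "expectation (h k) = (\<Sum>n<k. f (Suc n) * truncated_prob (B k) n v)" for k
  proof -
    have intE: "integrable M (indicat_real (?E k n))" for n
      using E emeasure_finite by (intro integrable_real_indicator) (auto simp: less_top[symmetric])
    then have "expectation (h k) = (\<Sum>n<k. expectation (\<lambda>\<omega>. f (Suc n) * indicat_real (?E k n) \<omega>))"
      unfolding h_def[abs_def] by (intro Bochner_Integration.integral_sum integrable_mult_right)
    also have "\<dots> = (\<Sum>n<k. f (Suc n) * truncated_prob (B k) n v)"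
      unfolding truncated_prob_def by (intro sum.cong refl) (simp add: Int_absorb2)
    finally show ?thesis .
  qed
  have "AE \<omega> in M. \<forall>k. finite (indices (B k) \<omega>)"
    using AE_finite_labels_in[OF B fin] by (simp add: AE_all_countable)
  moreover have "AE \<omega> in M. \<forall>k. \<forall>i\<in>indices (B k) \<omega>. X i \<omega> \<noteq> v \<and> (\<forall>j\<in>indices (B k) \<omega>. i \<noteq> j \<longrightarrow> X i \<omega> \<noteq> X j \<omega>)"
    using AE_distinct_points_in[OF B fin diffuse] by (simp add: AE_all_countable)
  ultimately have lim: "AE \<omega> in M. (\<lambda>k. h k \<omega>) \<longlonglongrightarrow> extend_zero f (ecard (cluster \<phi> \<kappa> X U v \<omega>))"
    using AE_space
  proof eventually_elim
    case (elim \<omega>)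
    have cover': "\<exists>k. i \<in> indices (B k) \<omega>" if "i \<in> indices UNIV \<omega>" for i
    proof -
      obtain k where "X i \<omega> \<in> B k" using cover by blast
      then show ?thesis using that by (auto simp: labels_in_def)
    qed
    have lm: "indices (B k) \<omega> \<subseteq> indices (B l) \<omega>" if "k \<le> l" for k l
      using mono[OF that] by (auto simp: labels_in_def)
    have "ecard (cluster \<phi> \<kappa> X U v \<omega>) = ecard (cluster_labels UNIV v \<omega>)"
    proof (rule ecard_cluster_eq)
      fix i j assume i: "i \<in> indices UNIV \<omega>" and j: "j \<in> indices UNIV \<omega>" and ij: "i \<noteq> j"
      obtain k l where "i \<in> indices (B k) \<omega>" "j \<in> indices (B l) \<omega>" using cover' i j by meson
      then have "i \<in> indices (B (max k l)) \<omega>" "j \<in> indices (B (max k l)) \<omega>"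
        using lm[of k "max k l"] lm[of l "max k l"] by auto
      then show "X i \<omega> \<noteq> X j \<omega>" using elim(2) ij by blast
    next
      fix i assume "i \<in> indices UNIV \<omega>"
      then show "X i \<omega> \<noteq> v" using cover' elim(2) by blast
    qed
    also have "cluster_labels UNIV v \<omega> = (\<Union>k. ?C k \<omega>)" by (rule cluster_labels_exhaust[OF mono cover])
    finally have size: "ecard (cluster \<phi> \<kappa> X U v \<omega>) = ecard (\<Union>k. ?C k \<omega>)" .
    have finC: "finite (?C k \<omega>)" for k
    proof -
      have "?C k \<omega> \<subseteq> insert 0 (Suc ` indices (B k) \<omega>)"
        unfolding cluster_labels_def by (rule component_subset) auto
      then show ?thesis using elim(1) by (auto intro: finite_subset)
    qed
    have "0 \<in> ?C k \<omega>" for k by (simp add: cluster_labels_def)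
    then have "card (?C k \<omega>) \<noteq> 0" for k using finC by (metis card_eq_0_iff empty_iff)
    then have "h k \<omega> = (if card (?C k \<omega>) \<le> k then f (card (?C k \<omega>)) else 0)" for k
      using h_eq[of \<omega> k] elim by simp
    then show ?case
      unfolding size using tendsto_card_exhaustion[OF cluster_labels_mono[OF mono] finC f] by simp
  qed
  have "(\<lambda>k. expectation (h k)) \<longlonglongrightarrow> expectation (\<lambda>\<omega>. extend_zero f (ecard (cluster \<phi> \<kappa> X U v \<omega>)))"
  proof (rule integral_dominated_convergence[where w="\<lambda>_. F"])
    show "AE \<omega> in M. norm (h k \<omega>) \<le> F" for k
      using F F0 by (intro AE_I2) (auto simp: h_eq)
  qed (auto intro: cluster_size_measurable lim)
  then show ?thesis unfolding int .
qed

end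

lemma rcm_of_input:
  fixes lam :: "'a::{metric_space, second_countable_topology} measure"
  assumes input: "rcm_input M (scale_measure (ennreal t) lam) \<kappa> X U" and t: "t > 0"
    and lam: "sets lam = sets borel" and phi: "connection \<phi>"
  shows "rcm M \<kappa> X lam t \<phi> U"
proof -
  have M: "prob_space M" using input by (auto simp: rcm_input_def poisson_process_def)
  show ?thesis
    using input M t lam phi unfolding rcm_input_def Let_def
    by (intro rcm.intro poisson_input.intro poisson_input_axioms.intro rcm_axioms.intro) auto
qed

section \<open>Random roots and the conclusion\<close>

text \<open>
This is the measure \<open>\<mu>\<^sub>n\<close>: the root \<open>v q\<close> is random, and the factor \<open>1 / n!\<close> accounts for the orderings
of the other \<open>n\<close> points of the cluster.
\<close>

definition cluster_measure ::
  "('a::{metric_space, second_countable_topology} \<Rightarrow> 'a \<Rightarrow> real) \<Rightarrow> 'a measure \<Rightarrow> 'a set \<Rightarrow> nat \<Rightarrow>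
   'q measure \<Rightarrow> ('q \<Rightarrow> 'a) \<Rightarrow> ('q \<times> (nat \<Rightarrow> 'a)) measure" where
  "cluster_measure \<phi> lam B n Q v = density (Q \<Otimes>\<^sub>M power_on lam B n)
     (\<lambda>p. ennreal (1 / fact n) * connection_prob \<phi> n (case_nat (v (fst p)) (snd p)))"

definition exposure ::
  "('a::{metric_space, second_countable_topology} \<Rightarrow> 'a \<Rightarrow> real) \<Rightarrow> 'a measure \<Rightarrow> 'a set \<Rightarrow> nat \<Rightarrow>
   ('q \<Rightarrow> 'a) \<Rightarrow> 'q \<times> (nat \<Rightarrow> 'a) \<Rightarrow> real" where
  "exposure \<phi> lam B n v p = exposed_measure \<phi> lam B n (case_nat (v (fst p)) (snd p))"

context connection begin

context
  fixes lam :: "'a measure" and B :: "'a set" and Q :: "'q measure" and v :: "'q \<Rightarrow> 'a"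
  assumes lam: "sets lam = sets borel" and B: "B \<in> sets borel" and fin: "emeasure lam B < \<infinity>"
    and Q: "finite_measure Q" and v: "v \<in> borel_measurable Q"
begin

lemma finite_measure_on: "finite_measure (measure_on lam B)"
  using finite_measure_measure_on[OF _ fin] B lam by simp

lemma coordinate_measurable:
  assumes "i \<le> n"
  shows "(\<lambda>p. case_nat (v (fst p)) (snd p) i) \<in> borel_measurable (Q \<Otimes>\<^sub>M power_on lam B n)"
proof (cases i)
  case 0
  then show ?thesis using measurable_compose[OF measurable_fst v] by simp
next
  case (Suc j)
  have "(\<lambda>x. x j) \<in> measurable (power_on lam B n) (measure_on lam B)"
    using Suc assms by (intro measurable_component_singleton) auto
  then have "(\<lambda>x. x j) \<in> borel_measurable (power_on lam B n)"
    by (simp cong: measurable_cong_sets add: lam)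
  then show ?thesis using Suc measurable_compose[OF measurable_snd] by simp
qed

lemma connection_density_measurable:
  "(\<lambda>p. ennreal (1 / fact n) * connection_prob \<phi> n (case_nat (v (fst p)) (snd p)))
    \<in> borel_measurable (Q \<Otimes>\<^sub>M power_on lam B n)"
  by (intro borel_measurable_times_ennreal connection_prob_measurable coordinate_measurable) auto

lemma exposure_measurable:
  "exposure \<phi> lam B n v \<in> borel_measurable (Q \<Otimes>\<^sub>M power_on lam B n)"
proof -
  have "(\<lambda>p. free_measure \<phi> lam B n (case_nat (v (fst p)) (snd p))) \<in> borel_measurable (Q \<Otimes>\<^sub>M power_on lam B n)"
    by (intro free_measure_measurable lam finite_measure_on coordinate_measurable)
  then show ?thesis unfolding exposure_def[abs_def] exposed_measure_def by measurable
qed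

lemma bounded_laplace_cluster_measure:
  "bounded_laplace (cluster_measure \<phi> lam B n Q v) (exposure \<phi> lam B n v) (measure lam B)"
proof -
  interpret R: finite_measure "measure_on lam B" by (rule finite_measure_on)
  interpret Q: finite_measure Q by (rule Q)
  interpret P: product_sigma_finite "\<lambda>_::nat. measure_on lam B" ..
  interpret PF: finite_product_sigma_finite "\<lambda>_::nat. measure_on lam B" "{..<n}" by standard auto
  let ?N = "Q \<Otimes>\<^sub>M power_on lam B n"
  have one: "ennreal (1 / fact n) * connection_prob \<phi> n y \<le> 1" for y
    using mult_mono[of "ennreal (1 / fact n)" 1 "connection_prob \<phi> n y" 1] connection_prob_le_1
    by (simp add: ennreal_le_1)
  have "emeasure (cluster_measure \<phi> lam B n Q v) (space ?N) = (\<integral>\<^sup>+p. (ennreal (1 / fact n) *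
      connection_prob \<phi> n (case_nat (v (fst p)) (snd p))) * indicator (space ?N) p \<partial>?N)"
    unfolding cluster_measure_def by (rule emeasure_density[OF connection_density_measurable sets.top])
  also have "\<dots> \<le> (\<integral>\<^sup>+p. 1 \<partial>?N)"
    by (rule nn_integral_mono) (simp add: one indicator_def)
  also have "\<dots> = emeasure Q (space Q) * emeasure (power_on lam B n) (space (power_on lam B n))"
    by (simp add: space_pair_measure PF.emeasure_pair_measure_Times)
  also have "\<dots> < \<infinity>"
  proof -
    have "emeasure (power_on lam B n) (space (power_on lam B n)) =
        (\<Prod>i<n. emeasure (measure_on lam B) (space (measure_on lam B)))"
      unfolding space_PiM by (intro P.emeasure_PiM) auto
    also have "\<dots> < \<infinity>" using R.emeasure_finite by (simp add: less_top[symmetric] power_eq_top_ennreal)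
    finally show ?thesis using Q.emeasure_finite[of "space Q"]
      by (simp add: ennreal_mult_eq_top_iff less_top[symmetric])
  qed
  finally have "emeasure (cluster_measure \<phi> lam B n Q v) (space (cluster_measure \<phi> lam B n Q v)) \<noteq> \<infinity>"
    by (simp add: cluster_measure_def)
  then interpret C: finite_measure "cluster_measure \<phi> lam B n Q v" by (rule finite_measureI)
  show ?thesis
  proof unfold_locales
    show "exposure \<phi> lam B n v \<in> borel_measurable (cluster_measure \<phi> lam B n Q v)"
      unfolding cluster_measure_def using exposure_measurable by simp
  qed (auto simp: exposure_def exposed_measure_bounds[OF lam B fin])
qed

end

end

text \<open>
By Fubini's theorem, a random root only replaces \<open>\<mu>\<^sub>n\<close> by a mixture. As neither \<open>cluster_measure\<close>
nor \<open>exposure\<close> involves the intensity \<open>t\<close>, the analytic estimates apply.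
\<close>

lemma (in rcm) truncated_prob_mixture:
  assumes B: "B \<in> sets borel" and fin: "emeasure lam B < \<infinity>"
    and Q: "finite_measure Q" and v: "v \<in> borel_measurable Q"
  shows "(\<lambda>q. truncated_prob B n (v q)) \<in> borel_measurable Q"
    and "(\<integral>q. truncated_prob B n (v q) \<partial>Q) =
      t ^ n * (\<integral>p. exp (- (t * exposure \<phi> lam B n v p)) \<partial>cluster_measure \<phi> lam B n Q v)"
proof -
  interpret R: finite_measure "measure_on lam B" by (rule finite_measure_on[OF sets_lam B fin Q v])
  interpret P: product_sigma_finite "\<lambda>_::nat. measure_on lam B" ..
  interpret PF: finite_product_sigma_finite "\<lambda>_::nat. measure_on lam B" "{..<n}" by standard auto
  let ?P = "power_on lam B n"
  let ?d = "\<lambda>p. ennreal (1 / fact n) * connection_prob \<phi> n (case_nat (v (fst p)) (snd p))"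
  let ?e = "\<lambda>p. ennreal (exp (- (t * exposure \<phi> lam B n v p)))"
  note d[measurable] = connection_density_measurable[OF sets_lam B fin Q v]
  note a[measurable] = exposure_measurable[OF sets_lam B fin Q v]
  have de[measurable]: "(\<lambda>p. ?d p * ?e p) \<in> borel_measurable (Q \<Otimes>\<^sub>M ?P)" by measurable
  have eq: "ennreal (truncated_prob B n (v q)) = ennreal (t ^ n) * (\<integral>\<^sup>+x. ?d (q, x) * ?e (q, x) \<partial>?P)" for q
    unfolding truncated_prob_def emeasure_eq_measure[symmetric] cluster_card_prob[OF B fin]
    by (simp add: exposure_def)
  have inner: "(\<lambda>q. \<integral>\<^sup>+x. ?d (q, x) * ?e (q, x) \<partial>?P) \<in> borel_measurable Q"
    by (rule PF.borel_measurable_nn_integral_fst[OF de])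
  have nonneg: "truncated_prob B n (v q) \<ge> 0" for q by (simp add: truncated_prob_def)
  have "(\<lambda>q. ennreal (truncated_prob B n (v q))) \<in> borel_measurable Q"
    unfolding eq using inner by measurable
  then have "(\<lambda>q. enn2real (ennreal (truncated_prob B n (v q)))) \<in> borel_measurable Q" by measurable
  then show meas: "(\<lambda>q. truncated_prob B n (v q)) \<in> borel_measurable Q" using nonneg by simp
  have "(\<integral>q. truncated_prob B n (v q) \<partial>Q) = enn2real (\<integral>\<^sup>+q. ennreal (truncated_prob B n (v q)) \<partial>Q)"
    by (rule integral_eq_nn_integral[OF meas]) (simp add: nonneg)
  also have "(\<integral>\<^sup>+q. ennreal (truncated_prob B n (v q)) \<partial>Q) = ennreal (t ^ n) * (\<integral>\<^sup>+q. \<integral>\<^sup>+x. ?d (q, x) * ?e (q, x) \<partial>?P \<partial>Q)"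
    unfolding eq by (rule nn_integral_cmult[OF inner])
  also have "(\<integral>\<^sup>+q. \<integral>\<^sup>+x. ?d (q, x) * ?e (q, x) \<partial>?P \<partial>Q) = (\<integral>\<^sup>+p. ?d p * ?e p \<partial>(Q \<Otimes>\<^sub>M ?P))"
    by (rule PF.nn_integral_fst[OF de])
  also have "\<dots> = (\<integral>\<^sup>+p. ?e p \<partial>cluster_measure \<phi> lam B n Q v)"
    unfolding cluster_measure_def by (rule nn_integral_density[symmetric]) measurable
  also have "enn2real (ennreal (t ^ n) * (\<integral>\<^sup>+p. ?e p \<partial>cluster_measure \<phi> lam B n Q v)) =
      t ^ n * enn2real (\<integral>\<^sup>+p. ?e p \<partial>cluster_measure \<phi> lam B n Q v)"
    using t by (simp add: enn2real_mult)
  also have "enn2real (\<integral>\<^sup>+p. ?e p \<partial>cluster_measure \<phi> lam B n Q v) =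
      (\<integral>p. exp (- (t * exposure \<phi> lam B n v p)) \<partial>cluster_measure \<phi> lam B n Q v)"
  proof (rule integral_eq_nn_integral[symmetric])
    show "(\<lambda>p. exp (- (t * exposure \<phi> lam B n v p))) \<in> borel_measurable (cluster_measure \<phi> lam B n Q v)"
      using a unfolding cluster_measure_def by simp
  qed simp
  finally show "(\<integral>q. truncated_prob B n (v q) \<partial>Q) =
      t ^ n * (\<integral>p. exp (- (t * exposure \<phi> lam B n v p)) \<partial>cluster_measure \<phi> lam B n Q v)" .
qed

text \<open>
The shift is due to the root: a cluster of size \<open>n + 1\<close> contains \<open>n\<close> Poisson points.
\<close>

lemma log_weight_decay:
  fixes f :: "nat \<Rightarrow> real"
  assumes lim: "(\<lambda>n. f n * sqrt (real n * ln (real n))) \<longlonglongrightarrow> 0"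
  shows "f \<longlonglongrightarrow> 0" and "(\<lambda>n. f (Suc n) * sqrt (real n * ln (real n))) \<longlonglongrightarrow> 0"
proof -
  have w1: "sqrt (real n * ln (real n)) \<ge> 1" if "n \<ge> 3" for n
  proof -
    have "exp 1 \<le> (3::real)" by (rule exp_le)
    then have "ln (real n) \<ge> 1" using that by (subst ln_ge_iff) auto
    then have "1 * 1 \<le> real n * ln (real n)" using that by (intro mult_mono) auto
    then show ?thesis by simp
  qed
  have "eventually (\<lambda>n. norm (f n) \<le> norm (f n * sqrt (real n * ln (real n)))) sequentially"
  proof (rule eventually_sequentiallyI)
    fix n :: nat assume "3 \<le> n"
    then have "\<bar>f n\<bar> * 1 \<le> \<bar>f n\<bar> * sqrt (real n * ln (real n))" by (intro mult_left_mono w1) auto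
    also have "\<dots> \<le> \<bar>f n * sqrt (real n * ln (real n))\<bar>" using w1[OF \<open>3 \<le> n\<close>] by (simp add: abs_mult)
    finally show "norm (f n) \<le> norm (f n * sqrt (real n * ln (real n)))" by simp
  qed
  then show "f \<longlonglongrightarrow> 0" by (rule Lim_null_comparison) (rule tendsto_norm_zero[OF lim])
  have "eventually (\<lambda>n. norm (f (Suc n) * sqrt (real n * ln (real n))) \<le>
      norm (f (Suc n) * sqrt (real (Suc n) * ln (real (Suc n))))) sequentially"
  proof (rule eventually_sequentiallyI)
    fix n :: nat assume n: "1 \<le> n"
    have "real n * ln (real n) \<le> real (Suc n) * ln (real (Suc n))" using n by (intro mult_mono) auto
    then show "norm (f (Suc n) * sqrt (real n * ln (real n))) \<le>
        norm (f (Suc n) * sqrt (real (Suc n) * ln (real (Suc n))))"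
      using n by (simp only: norm_mult) (intro mult_left_mono; simp)
  qed
  then show "(\<lambda>n. f (Suc n) * sqrt (real n * ln (real n))) \<longlonglongrightarrow> 0"
    by (rule Lim_null_comparison) (rule tendsto_norm_zero[OF LIMSEQ_Suc[OF lim]])
qed

theorem theorem10p7:
  fixes lam :: "('y::polish_space \<times> 'm::polish_space) measure"
    and \<phi> :: "'y \<times> 'm \<Rightarrow> 'y \<times> 'm \<Rightarrow> real"
    and P :: "real \<Rightarrow> 'w measure"
    and \<kappa> :: "'w \<Rightarrow> enat"
    and X :: "nat \<Rightarrow> 'w \<Rightarrow> 'y \<times> 'm"
    and U :: "nat set \<Rightarrow> 'w \<Rightarrow> real"
    and Q :: "'m measure"
    and f :: "nat \<Rightarrow> real"
    and y :: 'y
  assumes lam_borel: "sets lam = sets borel"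
    and lam_locally_finite: "\<And>B. B \<in> sets borel \<Longrightarrow> bounded B \<Longrightarrow> emeasure lam B < \<infinity>"
    and lam_diffuse: "\<And>x. emeasure lam {x} = 0"
    and phi_measurable: "(\<lambda>(x, z). \<phi> x z) \<in> borel_measurable borel"
    and phi_range: "\<And>x z. 0 \<le> \<phi> x z \<and> \<phi> x z \<le> 1"
    and phi_sym: "\<And>x z. \<phi> x z = \<phi> z x"
    and phi_integrable: "AE x in lam. (\<integral>\<^sup>+ z. ennreal (\<phi> x z) \<partial>lam) < \<infinity>"
    and input: "\<And>t. t > 0 \<Longrightarrow> rcm_input (P t) (scale_measure (ennreal t) lam) \<kappa> X U"
    and Q_borel: "sets Q = sets borel"
    and Q_finite: "finite_measure Q"
    and f_lim: "(\<lambda>n. f n * sqrt (real n * ln (real n))) \<longlonglongrightarrow> 0"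
  shows "(\<lambda>t. \<integral>q. (\<integral>\<omega>. extend_zero f (ecard (cluster \<phi> \<kappa> X U (y, q) \<omega>)) \<partial>P t) \<partial>Q)
           C1_differentiable_on {0<..}"
proof -
  interpret connection \<phi> by unfold_locales (fact phi_measurable, fact phi_range)
  interpret Q: finite_measure Q by (rule Q_finite)
  \<comment> \<open>The centre of the balls is arbitrary.\<close>
  define B where "B k = ball (undefined :: 'y \<times> 'm) (real k)" for k
  have B: "B k \<in> sets borel" for k unfolding B_def by simp
  have fin: "emeasure lam (B k) < \<infinity>" for k
    by (rule lam_locally_finite[OF B]) (simp add: B_def)
  have mono: "B k \<subseteq> B l" if "k \<le> l" for k l using that by (auto simp: B_def)
  have cover: "(\<Union>k. B k) = UNIV"
  proof -
    have "x \<in> (\<Union>k. B k)" for x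
      using reals_Archimedean2[of "dist undefined x"] by (auto simp: B_def)
    then show ?thesis by blast
  qed
  have v: "Pair y \<in> borel_measurable Q"
  proof -
    have "Pair y \<in> measurable borel (borel \<Otimes>\<^sub>M borel)" by measurable
    then show ?thesis by (simp add: borel_prod cong: measurable_cong_sets add: Q_borel)
  qed
  note f0 = log_weight_decay(1)[OF f_lim]
  obtain F where F: "\<And>n. \<bar>f n\<bar> \<le> F"
    using convergent_imp_Bseq[OF convergentI[OF f0]] unfolding Bseq_def by auto
  have F0: "F \<ge> 0" using F[of 0] by linarith
  let ?M = "\<lambda>k n. cluster_measure \<phi> lam (B k) n Q (Pair y)"
  let ?a = "\<lambda>k n. exposure \<phi> lam (B k) n (Pair y)"
  show ?thesis
  proof (rule C1_limit_of_cluster_series[where M="?M" and a="?a" and A="\<lambda>k n. measure lam (B k)"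
        and c="\<lambda>n. f (Suc n)" and K="measure Q (space Q)"])
    show "bounded_laplace (?M k n) (?a k n) (measure lam (B k))" for k n
      by (rule bounded_laplace_cluster_measure[OF lam_borel B fin Q_finite v])
    show "(\<lambda>n. f (Suc n) * sqrt (real n * ln (real n))) \<longlonglongrightarrow> 0"
      by (rule log_weight_decay(2)[OF f_lim])
  next
    fix t :: real assume t: "t > 0"
    interpret R: rcm "P t" \<kappa> X lam t \<phi> U
      by (rule rcm_of_input[OF input[OF t] t lam_borel]) unfold_locales
    let ?p = "\<lambda>k n q. R.truncated_prob (B k) n (y, q)"
    note p_meas[measurable] = R.truncated_prob_mixture(1)[OF B fin Q_finite v]
    note p_int = R.truncated_prob_mixture(2)[OF B fin Q_finite v]
    have p_nonneg: "?p k n q \<ge> 0" for k n q by (simp add: R.truncated_prob_def)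
    have p_le: "?p k n q \<le> 1" for k n q by (simp add: R.truncated_prob_def)
    have p_integrable: "integrable Q (?p k n)" for k n
      using p_nonneg p_le by (intro Q.integrable_const_bound[where B=1]) auto
    have sum_int: "(\<Sum>n<k. c n * (t ^ n * (\<integral>p. exp (- (t * ?a k n p)) \<partial>?M k n))) = (\<integral>q. (\<Sum>n<k. c n * ?p k n q) \<partial>Q)"
      for k and c :: "nat \<Rightarrow> real"
      unfolding p_int[symmetric] using p_integrable by (subst Bochner_Integration.integral_sum) auto
    show "(\<Sum>n<k. t ^ n * (\<integral>p. exp (- (t * ?a k n p)) \<partial>?M k n)) \<le> measure Q (space Q)" for k
    proof -
      have "(\<Sum>n<k. t ^ n * (\<integral>p. exp (- (t * ?a k n p)) \<partial>?M k n)) = (\<integral>q. (\<Sum>n<k. ?p k n q) \<partial>Q)"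
        using sum_int[of "\<lambda>_. 1" k] by simp
      also have "\<dots> \<le> (\<integral>q. 1 \<partial>Q)"
        using p_integrable by (intro integral_mono R.sum_truncated_prob_le_1 B) auto
      finally show ?thesis by simp
    qed
    let ?g = "\<lambda>q. \<integral>\<omega>. extend_zero f (ecard (cluster \<phi> \<kappa> X U (y, q) \<omega>)) \<partial>P t"
    have lim: "(\<lambda>k. \<Sum>n<k. f (Suc n) * ?p k n q) \<longlonglongrightarrow> ?g q" for q
      by (rule R.expectation_cluster_size_limit[OF B fin mono cover lam_diffuse f0])
    have s_meas[measurable]: "(\<lambda>q. \<Sum>n<k. f (Suc n) * ?p k n q) \<in> borel_measurable Q" for k
      by measurable
    have "(\<lambda>k. \<integral>q. (\<Sum>n<k. f (Suc n) * ?p k n q) \<partial>Q) \<longlonglongrightarrow> (\<integral>q. ?g q \<partial>Q)"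
    proof (rule integral_dominated_convergence[where w="\<lambda>_. F"])
      show "?g \<in> borel_measurable Q" by (rule borel_measurable_LIMSEQ_real[OF lim s_meas])
      show "AE q in Q. norm (\<Sum>n<k. f (Suc n) * ?p k n q) \<le> F" for k
      proof (rule AE_I2)
        fix q
        have "\<bar>\<Sum>n<k. f (Suc n) * ?p k n q\<bar> \<le> (\<Sum>n<k. \<bar>f (Suc n) * ?p k n q\<bar>)" by (rule sum_abs)
        also have "\<dots> \<le> (\<Sum>n<k. F * ?p k n q)"
          using F p_nonneg by (intro sum_mono) (auto simp: abs_mult intro!: mult_right_mono)
        also have "\<dots> = F * (\<Sum>n<k. ?p k n q)" by (simp add: sum_distrib_left)
        also have "\<dots> \<le> F * 1" by (intro mult_left_mono R.sum_truncated_prob_le_1 B F0)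
        finally show "norm (\<Sum>n<k. f (Suc n) * ?p k n q) \<le> F" by simp
      qed
    qed (use lim in auto)
    then show "(\<lambda>k. \<Sum>n<k. f (Suc n) * (t ^ n * (\<integral>p. exp (- (t * ?a k n p)) \<partial>?M k n))) \<longlonglongrightarrow>
        (\<integral>q. ?g q \<partial>Q)"
      unfolding sum_int .
  qed
qed

end
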